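(* Let $\mathcal{C}$ be a corepita 2-category and let $p:\mathrm{S}_*\to\mathrm{S}$ be a plentiful generic DOF in $\mathcal{C}$ (so $\mathrm{S}$ is a plentiful DOF classifier). Then $\mathrm{S}$ is an internal elementary topos in $\mathcal{C}$.
   Context: Conventions. 2-categories are strict. Composition is in diagrammatic order: $fg$ means first $f$, then $g$ (also for functors and whiskerings). $|\mathcal{C}|$ is the underlying 1-category of $\mathcal{C}$. For $f:X\to Y$ and an object $A$, $f_*:\mathcal{C}(A,X)\to\mathcal{C}(A,Y)$ and $f^*:\mathcal{C}(Y,A)\to\mathcal{C}(X,A)$ are given by composition with $f$. Limits. A functor $F$ is an isofibration if every isomorphism $Fx\to b$ lifts to an isomorphism with domain $x$; a morphism $f$ of $\mathcal{C}$ is an isofibration if $f_*:\mathcal{C}(A,X)\to\mathcal{C}(A,Y)$ is one for all $A$. A commutative square with vertex $P$ over a cospan $X\to Z\leftarrow Y$ is a strict pullback if $\mathcal{C}(B,P)\to\mathcal{C}(B,X)\times_{\mathcal{C}(B,Z)}\mathcal{C}(B,Y)$ is an isomorphism of categories for all $B$. A square $h:P\to X$, $k:P\to Y$ over $f:X\to Z$, $g:Y\to Z$ with an invertible 2-cell $hf\Rightarrow kg$ is a bipullback if for all $B$ the evident functor from $\mathcal{C}(B,P)$ to the category of triples $(h',k',\gamma')$ ($h':B\to X$, $k':B\to Y$, $\gamma':h'f\Rightarrow k'g$ invertible; morphisms are compatible pairs of 2-cells) is an equivalence. A strict terminal object $\mathbf{1}$ has $\mathcal{C}(A,\mathbf 1)$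 the one-morphism category for all $A$. A strict arrow object of $X$ is an object $X^{\to}$ with a 2-cell $\partial:\partial_0\Rightarrow\partial_1:X^\to\to X$ such that composing with $\partial$ gives an isomorphism $\mathcal{C}(A,X^\to)\cong\mathcal{C}(A,X)^\to$ for all $A$. $\mathcal{C}$ is pita if it has a strict terminal object, strict arrow objects, and strict pullbacks of isofibrations along arbitrary morphisms. Groupoids and cores. $X\in\mathcal{C}$ is a groupoid if every $\mathcal{C}(A,X)$ is a groupoid. A morphism $f:A\to X$ is an arrow-wise iso if $\alpha f$ is invertible for every 2-cell $\alpha$ between morphisms into $A$. A core of $X$ is an object $X^{\mathrm{iso}}$ with an arrow-wise iso $i:X^{\mathrm{iso}}\to X$ such that for all $A$, $i_*$ is an isomorphism from $\mathcal{C}(A,X^{\mathrm{iso}})$ onto the subcategory of $\mathcal{C}(A,X)$ whose objects are the arrow-wise isos and whose morphisms are the invertible 2-cells between them. A morphism $f:X\to Y$ induces $f^{\mathrm{iso}}:X^{\mathrm{iso}}\to Y^{\mathrm{iso}}$ with $f^{\mathrm{iso}}i=if$. $\mathcal{C}$ is corepita if it is pita and every object has a core. DOFs and SOFs. A functor $F:\mathbf{C}\to\mathbf{D}$ is a discrete opfibration (DOF) if for every $x\in\mathbf{C}$ and $u:Fx\to b$ there is a unique morphism $v$ with domain $x$ and $Fv=u$. It is a setoidal opfibration (SOF) if it is faithful, every such $u$ has some lift $v:x\to y$, and for any two lifts $v:x\to y$, $v':x\to y'$ of $u$ there is $w:y\to y'$ with $vw=v'$ and $Fw=\mathrm{id}_b$.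 A morphism $f$ in $\mathcal{C}$ is a DOF (resp. SOF) if $f_*:\mathcal{C}(A,X)\to\mathcal{C}(A,Y)$ is one for all $A$. Generic DOFs. A DOF $p:\mathrm{S}_*\to\mathrm{S}$ is generic (and $\mathrm{S}$ is a DOF classifier) if, for any strict pullbacks $\dot f:F\to A$ and $\dot h:H\to A$ of $p$ along $f,h:A\to\mathrm{S}$, with top morphisms $\ddot f:F\to\mathrm{S}_*$, $\ddot h:H\to\mathrm{S}_*$, and any $g:F\to H$ with $g\dot h=\dot f$, there is a unique 2-cell $\gamma:f\Rightarrow h$ for which there exists a 2-cell $\ddot\gamma:\ddot f\Rightarrow g\ddot h$ with $\ddot\gamma p=\dot f\gamma$. A morphism is $p$-small if it is a strict pullback of $p$; a SOF $E'\to B$ is $p$-small if it is the left side of some bipullback square with right side $p$. $p$ is pre-plentiful if (i) every DOF which is a monomorphism in $|\mathcal{C}|$ is $p$-small and (ii) composites of $p$-small morphisms are $p$-small. A 2-cell $\alpha$ (a morphism of $\mathcal{C}(A,X)$) is a stable monomorphism if $h\alpha$ is a monomorphism in $\mathcal{C}(A',X)$ for every $h:A'\to A$. A monomorphism object of $X$ is an object $\mathrm{Mon}(X)$ with a stable monomorphism $\partial:\partial_0\Rightarrow\partial_1:\mathrm{Mon}(X)\to X$ such that, for all $A$, $\partial_*:\mathcal{C}(A,\mathrm{Mon}(X))\to\mathcal{C}(A,X)^\to$ is an isomorphism onto the full subcategory of stable monomorphisms. A pre-plentiful generic DOF $p$ is plentiful if $\mathrm{Mon}(\mathrm{S})$,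 $\mathrm{S}^{\mathrm{iso}}$, $\mathrm{Mon}(\mathrm{S})^{\mathrm{iso}}$ exist and $\partial_1^{\mathrm{iso}}:\mathrm{Mon}(\mathrm{S})^{\mathrm{iso}}\to\mathrm{S}^{\mathrm{iso}}$ (which is always a SOF) is $p$-small. Internal topoi. $X\in\mathcal{C}$ has finite limits if each $\mathcal{C}(A,X)$ has finite limits and each $f^*:\mathcal{C}(A,X)\to\mathcal{C}(A',X)$, $f:A'\to A$, preserves them. In a category with finite limits, a power object of $a$ is an object $P(a)$ with a monomorphism $\epsilon_a\rightarrowtail a\times P(a)$ such that for each monomorphism $R\rightarrowtail a\times y$ there is a unique $r:y\to P(a)$ such that $R$ is a pullback of $\epsilon_a$ along $\mathrm{id}\times r$. A finite-limit-preserving functor preserves the power object $P(a)$ if it carries $\epsilon_a\rightarrowtail a\times P(a)$ to a power object of the image of $a$. $X$ is an internal elementary topos if it has finite limits, $\mathcal{C}(A,X)$ has power objects for every groupoid $A$, and $f^*:\mathcal{C}(A,X)\to\mathcal{C}(A',X)$ preserves finite limits and power objects for every $f:A'\to A$ between groupoids. *)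

theory Defs
  imports Main
begin

section \<open>Categories and functors\<close>

text \<open>Composition is in diagrammatic order throughout: \<open>f \<bullet> g\<close> is first \<open>f\<close>, then \<open>g\<close>.
  All operations are only meaningful on the carriers \<open>Ob\<close>, \<open>Ar\<close>.\<close>

record ('o, 'm) cat =
  Ob :: "'o set"
  Ar :: "'m set"
  Dom :: "'m \<Rightarrow> 'o"
  Cod :: "'m \<Rightarrow> 'o"
  Idn :: "'o \<Rightarrow> 'm"
  Cmp :: "'m \<Rightarrow> 'm \<Rightarrow> 'm"  (infixl "\<bullet>\<index>" 70)

locale category =
  fixes C :: "('o, 'm) cat"  (structure)
  assumes dom_in: "f \<in> Ar C \<Longrightarrow> Dom C f \<in> Ob C"
    and cod_in: "f \<in> Ar C \<Longrightarrow> Cod C f \<in> Ob C"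
    and idn_in: "x \<in> Ob C \<Longrightarrow> Idn C x \<in> Ar C"
    and dom_idn: "x \<in> Ob C \<Longrightarrow> Dom C (Idn C x) = x"
    and cod_idn: "x \<in> Ob C \<Longrightarrow> Cod C (Idn C x) = x"
    and cmp_in: "\<lbrakk>f \<in> Ar C; g \<in> Ar C; Cod C f = Dom C g\<rbrakk> \<Longrightarrow> f \<bullet> g \<in> Ar C"
    and dom_cmp: "\<lbrakk>f \<in> Ar C; g \<in> Ar C; Cod C f = Dom C g\<rbrakk> \<Longrightarrow> Dom C (f \<bullet> g) = Dom C f"
    and cod_cmp: "\<lbrakk>f \<in> Ar C; g \<in> Ar C; Cod C f = Dom C g\<rbrakk> \<Longrightarrow> Cod C (f \<bullet> g) = Cod C g"
    and idn_left: "f \<in> Ar C \<Longrightarrow> Idn C (Dom C f) \<bullet> f = f"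
    and idn_right: "f \<in> Ar C \<Longrightarrow> f \<bullet> Idn C (Cod C f) = f"
    and cmp_assoc: "\<lbrakk>f \<in> Ar C; g \<in> Ar C; h \<in> Ar C; Cod C f = Dom C g; Cod C g = Dom C h\<rbrakk>
      \<Longrightarrow> (f \<bullet> g) \<bullet> h = f \<bullet> (g \<bullet> h)"

definition hom :: "('o, 'm) cat \<Rightarrow> 'o \<Rightarrow> 'o \<Rightarrow> 'm set" where
  "hom C x y = {f \<in> Ar C. Dom C f = x \<and> Cod C f = y}"

definition is_iso :: "('o, 'm) cat \<Rightarrow> 'm \<Rightarrow> bool" where
  "is_iso C f \<longleftrightarrow> f \<in> Ar C \<and>
    (\<exists>g \<in> hom C (Cod C f) (Dom C f).
      f \<bullet>\<^bsub>C\<^esub> g = Idn C (Dom C f) \<and> g \<bullet>\<^bsub>C\<^esub> f = Idn C (Cod C f))"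

definition is_mono :: "('o, 'm) cat \<Rightarrow> 'm \<Rightarrow> bool" where
  "is_mono C f \<longleftrightarrow> f \<in> Ar C \<and>
    (\<forall>x \<in> Ob C. \<forall>u \<in> hom C x (Dom C f). \<forall>v \<in> hom C x (Dom C f).
      u \<bullet>\<^bsub>C\<^esub> f = v \<bullet>\<^bsub>C\<^esub> f \<longrightarrow> u = v)"

definition groupoid :: "('o, 'm) cat \<Rightarrow> bool" where
  "groupoid C \<longleftrightarrow> (\<forall>f \<in> Ar C. is_iso C f)"

definition full_subcat :: "('o, 'm) cat \<Rightarrow> ('o \<Rightarrow> bool) \<Rightarrow> ('o, 'm) cat" where
  "full_subcat C P = C\<lparr>Ob := {x \<in> Ob C. P x}, Ar := {f \<in> Ar C. P (Dom C f) \<and> P (Cod C f)}\<rparr>"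

record ('o, 'm, 'p, 'n) funct =
  FO :: "'o \<Rightarrow> 'p"
  FA :: "'m \<Rightarrow> 'n"

definition is_functor :: "('o, 'm) cat \<Rightarrow> ('p, 'n) cat \<Rightarrow> ('o, 'm, 'p, 'n) funct \<Rightarrow> bool" where
  "is_functor C D F \<longleftrightarrow>
    (\<forall>x \<in> Ob C. FO F x \<in> Ob D) \<and>
    (\<forall>f \<in> Ar C. FA F f \<in> hom D (FO F (Dom C f)) (FO F (Cod C f))) \<and>
    (\<forall>x \<in> Ob C. FA F (Idn C x) = Idn D (FO F x)) \<and>
    (\<forall>f \<in> Ar C. \<forall>g \<in> Ar C. Cod C f = Dom C g \<longrightarrow>
      FA F (f \<bullet>\<^bsub>C\<^esub> g) = FA F f \<bullet>\<^bsub>D\<^esub> FA F g)"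

definition id_funct :: "('o, 'm, 'o, 'm) funct" where
  "id_funct = \<lparr>FO = (\<lambda>x. x), FA = (\<lambda>f. f)\<rparr>"

definition comp_funct ::
  "('o, 'm, 'p, 'n) funct \<Rightarrow> ('p, 'n, 'q, 'k) funct \<Rightarrow> ('o, 'm, 'q, 'k) funct" where
  "comp_funct F G = \<lparr>FO = (\<lambda>x. FO G (FO F x)), FA = (\<lambda>f. FA G (FA F f))\<rparr>"

definition cat_isomorphism :: "('o, 'm) cat \<Rightarrow> ('p, 'n) cat \<Rightarrow> ('o, 'm, 'p, 'n) funct \<Rightarrow> bool" where
  "cat_isomorphism C D F \<longleftrightarrow>
    is_functor C D F \<and> bij_betw (FO F) (Ob C) (Ob D) \<and> bij_betw (FA F) (Ar C) (Ar D)"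

definition natural_iso ::
  "('o, 'm) cat \<Rightarrow> ('p, 'n) cat \<Rightarrow> ('o, 'm, 'p, 'n) funct \<Rightarrow> ('o, 'm, 'p, 'n) funct
    \<Rightarrow> ('o \<Rightarrow> 'n) \<Rightarrow> bool" where
  "natural_iso C D F G \<eta> \<longleftrightarrow>
    (\<forall>x \<in> Ob C. \<eta> x \<in> hom D (FO F x) (FO G x) \<and> is_iso D (\<eta> x)) \<and>
    (\<forall>f \<in> Ar C. FA F f \<bullet>\<^bsub>D\<^esub> \<eta> (Cod C f) = \<eta> (Dom C f) \<bullet>\<^bsub>D\<^esub> FA G f)"

definition cat_equivalence :: "('o, 'm) cat \<Rightarrow> ('p, 'n) cat \<Rightarrow> ('o, 'm, 'p, 'n) funct \<Rightarrow> bool" where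
  "cat_equivalence C D F \<longleftrightarrow> is_functor C D F \<and>
    (\<exists>G \<eta> \<epsilon>. is_functor D C G \<and>
      natural_iso C C id_funct (comp_funct F G) \<eta> \<and>
      natural_iso D D (comp_funct G F) id_funct \<epsilon>)"

definition is_isofibration :: "('o, 'm) cat \<Rightarrow> ('p, 'n) cat \<Rightarrow> ('o, 'm, 'p, 'n) funct \<Rightarrow> bool" where
  "is_isofibration C D F \<longleftrightarrow>
    (\<forall>x \<in> Ob C. \<forall>u. is_iso D u \<and> Dom D u = FO F x \<longrightarrow>
      (\<exists>v. is_iso C v \<and> Dom C v = x \<and> FA F v = u))"

definition is_DOF :: "('o, 'm) cat \<Rightarrow> ('p, 'n) cat \<Rightarrow> ('o, 'm, 'p, 'n) funct \<Rightarrow> bool" where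
  "is_DOF C D F \<longleftrightarrow>
    (\<forall>x \<in> Ob C. \<forall>u \<in> Ar D. Dom D u = FO F x \<longrightarrow>
      (\<exists>!v. v \<in> Ar C \<and> Dom C v = x \<and> FA F v = u))"

definition is_faithful :: "('o, 'm) cat \<Rightarrow> ('o, 'm, 'p, 'n) funct \<Rightarrow> bool" where
  "is_faithful C F \<longleftrightarrow>
    (\<forall>x \<in> Ob C. \<forall>y \<in> Ob C. inj_on (FA F) (hom C x y))"

definition is_SOF :: "('o, 'm) cat \<Rightarrow> ('p, 'n) cat \<Rightarrow> ('o, 'm, 'p, 'n) funct \<Rightarrow> bool" where
  "is_SOF C D F \<longleftrightarrow> is_faithful C F \<and>
    (\<forall>x \<in> Ob C. \<forall>u \<in> Ar D. Dom D u = FO F x \<longrightarrow>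
      (\<exists>v \<in> Ar C. Dom C v = x \<and> FA F v = u) \<and>
      (\<forall>v \<in> Ar C. \<forall>v' \<in> Ar C.
        Dom C v = x \<and> FA F v = u \<and> Dom C v' = x \<and> FA F v' = u \<longrightarrow>
        (\<exists>w \<in> hom C (Cod C v) (Cod C v'). v \<bullet>\<^bsub>C\<^esub> w = v' \<and> FA F w = Idn D (Cod D u))))"

text \<open>An arrow of the arrow category is a commutative square, stored together with its
  domain and codomain.\<close>

definition arrow_cat :: "('o, 'm) cat \<Rightarrow> ('m, 'm \<times> ('m \<times> 'm) \<times> 'm) cat" where
  "arrow_cat C = \<lparr>
    Ob = Ar C,
    Ar = {(u, (s, t), v). u \<in> Ar C \<and> v \<in> Ar C \<and>
           s \<in> hom C (Dom C u) (Dom C v) \<and> t \<in> hom C (Cod C u) (Cod C v) \<and>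
           u \<bullet>\<^bsub>C\<^esub> t = s \<bullet>\<^bsub>C\<^esub> v},
    Dom = (\<lambda>(u, (s, t), v). u),
    Cod = (\<lambda>(u, (s, t), v). v),
    Idn = (\<lambda>u. (u, (Idn C (Dom C u), Idn C (Cod C u)), u)),
    Cmp = (\<lambda>(u, (s, t), v) (v', (s', t'), w). (u, (s \<bullet>\<^bsub>C\<^esub> s', t \<bullet>\<^bsub>C\<^esub> t'), w))\<rparr>"

definition fibre_product ::
  "('o1, 'm1) cat \<Rightarrow> ('o2, 'm2) cat \<Rightarrow> ('o1, 'm1, 'p, 'n) funct \<Rightarrow> ('o2, 'm2, 'p, 'n) funct
    \<Rightarrow> ('o1 \<times> 'o2, 'm1 \<times> 'm2) cat" where
  "fibre_product C D F G = \<lparr>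
    Ob = {(x, y). x \<in> Ob C \<and> y \<in> Ob D \<and> FO F x = FO G y},
    Ar = {(u, v). u \<in> Ar C \<and> v \<in> Ar D \<and> FA F u = FA G v},
    Dom = (\<lambda>(u, v). (Dom C u, Dom D v)),
    Cod = (\<lambda>(u, v). (Cod C u, Cod D v)),
    Idn = (\<lambda>(x, y). (Idn C x, Idn D y)),
    Cmp = (\<lambda>(u, v) (u', v'). (u \<bullet>\<^bsub>C\<^esub> u', v \<bullet>\<^bsub>D\<^esub> v'))\<rparr>"

text \<open>The iso-comma category of two functors \<open>F : C \<rightarrow> E\<close>, \<open>G : D \<rightarrow> E\<close>: objects are triples
  \<open>(x, y, c)\<close> with \<open>c : F x \<rightarrow> G y\<close> invertible, arrows are compatible pairs.\<close>

definition iso_comma ::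
  "('o1, 'm1) cat \<Rightarrow> ('o2, 'm2) cat \<Rightarrow> ('p, 'n) cat
    \<Rightarrow> ('o1, 'm1, 'p, 'n) funct \<Rightarrow> ('o2, 'm2, 'p, 'n) funct
    \<Rightarrow> ('o1 \<times> 'o2 \<times> 'n, ('o1 \<times> 'o2 \<times> 'n) \<times> ('m1 \<times> 'm2) \<times> ('o1 \<times> 'o2 \<times> 'n)) cat" where
  "iso_comma C D E F G =
    (let Obs = {(x, y, c). x \<in> Ob C \<and> y \<in> Ob D \<and> c \<in> hom E (FO F x) (FO G y) \<and> is_iso E c}
     in \<lparr>
      Ob = Obs,
      Ar = {((x, y, c), (u, v), (x', y', c')).
             (x, y, c) \<in> Obs \<and> (x', y', c') \<in> Obs \<and> u \<in> hom C x x' \<and> v \<in> hom D y y' \<and>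
             c \<bullet>\<^bsub>E\<^esub> FA G v = FA F u \<bullet>\<^bsub>E\<^esub> c'},
      Dom = (\<lambda>(a, (u, v), b). a),
      Cod = (\<lambda>(a, (u, v), b). b),
      Idn = (\<lambda>(x, y, c). ((x, y, c), (Idn C x, Idn D y), (x, y, c))),
      Cmp = (\<lambda>(a, (u, v), b) (b', (u', v'), d). (a, (u \<bullet>\<^bsub>C\<^esub> u', v \<bullet>\<^bsub>D\<^esub> v'), d))\<rparr>)"

section \<open>Finite limits and power objects\<close>

definition is_cone ::
  "('o, 'm) cat \<Rightarrow> ('j, 'k) cat \<Rightarrow> ('j, 'k, 'o, 'm) funct \<Rightarrow> 'o \<Rightarrow> ('j \<Rightarrow> 'm) \<Rightarrow> bool" where
  "is_cone C J D l \<pi> \<longleftrightarrow> l \<in> Ob C \<and>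
    (\<forall>j \<in> Ob J. \<pi> j \<in> hom C l (FO D j)) \<and>
    (\<forall>k \<in> Ar J. \<pi> (Dom J k) \<bullet>\<^bsub>C\<^esub> FA D k = \<pi> (Cod J k))"

definition is_limit ::
  "('o, 'm) cat \<Rightarrow> ('j, 'k) cat \<Rightarrow> ('j, 'k, 'o, 'm) funct \<Rightarrow> 'o \<Rightarrow> ('j \<Rightarrow> 'm) \<Rightarrow> bool" where
  "is_limit C J D l \<pi> \<longleftrightarrow> is_cone C J D l \<pi> \<and>
    (\<forall>c \<mu>. is_cone C J D c \<mu> \<longrightarrow>
      (\<exists>!u. u \<in> hom C c l \<and> (\<forall>j \<in> Ob J. u \<bullet>\<^bsub>C\<^esub> \<pi> j = \<mu> j)))"

text \<open>Every finite category is isomorphic to one whose objects and arrows are natural numbers,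
  so index categories of this type account for all finite diagrams.\<close>

definition finite_category :: "(nat, nat) cat \<Rightarrow> bool" where
  "finite_category J \<longleftrightarrow> category J \<and> finite (Ob J) \<and> finite (Ar J)"

definition has_finite_limits :: "('o, 'm) cat \<Rightarrow> bool" where
  "has_finite_limits C \<longleftrightarrow>
    (\<forall>J D. finite_category J \<and> is_functor J C D \<longrightarrow> (\<exists>l \<pi>. is_limit C J D l \<pi>))"

definition preserves_finite_limits ::
  "('o, 'm) cat \<Rightarrow> ('p, 'n) cat \<Rightarrow> ('o, 'm, 'p, 'n) funct \<Rightarrow> bool" where
  "preserves_finite_limits C C' F \<longleftrightarrow>
    (\<forall>J D l \<pi>. finite_category J \<and> is_functor J C D \<and> is_limit C J D l \<pi> \<longrightarrow>
      is_limit C' J (comp_funct D F) (FO F l) (\<lambda>j. FA F (\<pi> j)))"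

definition is_product :: "('o, 'm) cat \<Rightarrow> 'o \<Rightarrow> 'o \<Rightarrow> 'o \<Rightarrow> 'm \<Rightarrow> 'm \<Rightarrow> bool" where
  "is_product C a b q \<pi>\<^sub>1 \<pi>\<^sub>2 \<longleftrightarrow>
    a \<in> Ob C \<and> b \<in> Ob C \<and> q \<in> Ob C \<and> \<pi>\<^sub>1 \<in> hom C q a \<and> \<pi>\<^sub>2 \<in> hom C q b \<and>
    (\<forall>x \<in> Ob C. \<forall>u \<in> hom C x a. \<forall>v \<in> hom C x b.
      \<exists>!w. w \<in> hom C x q \<and> w \<bullet>\<^bsub>C\<^esub> \<pi>\<^sub>1 = u \<and> w \<bullet>\<^bsub>C\<^esub> \<pi>\<^sub>2 = v)"

text \<open>\<open>is_pullback C f g h k\<close>: the square \<open>h f = k g\<close> is a pullback of \<open>f\<close> and \<open>g\<close>.\<close>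

definition is_pullback :: "('o, 'm) cat \<Rightarrow> 'm \<Rightarrow> 'm \<Rightarrow> 'm \<Rightarrow> 'm \<Rightarrow> bool" where
  "is_pullback C f g h k \<longleftrightarrow>
    f \<in> Ar C \<and> g \<in> Ar C \<and> h \<in> Ar C \<and> k \<in> Ar C \<and> Cod C f = Cod C g \<and>
    Dom C h = Dom C k \<and> Cod C h = Dom C f \<and> Cod C k = Dom C g \<and>
    h \<bullet>\<^bsub>C\<^esub> f = k \<bullet>\<^bsub>C\<^esub> g \<and>
    (\<forall>x \<in> Ob C. \<forall>u \<in> hom C x (Dom C f). \<forall>v \<in> hom C x (Dom C g).
      u \<bullet>\<^bsub>C\<^esub> f = v \<bullet>\<^bsub>C\<^esub> g \<longrightarrow>
      (\<exists>!w. w \<in> hom C x (Dom C h) \<and> w \<bullet>\<^bsub>C\<^esub> h = u \<and> w \<bullet>\<^bsub>C\<^esub> k = v))"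

text \<open>\<open>is_power_object C a P q \<pi>\<^sub>1 \<pi>\<^sub>2 e\<close>: \<open>P\<close> is a power object of \<open>a\<close> with membership
  monomorphism \<open>e\<close> into \<open>q\<close>, a product of \<open>a\<close> and \<open>P\<close> with projections \<open>\<pi>\<^sub>1\<close>, \<open>\<pi>\<^sub>2\<close>.
  In the universal property, \<open>w\<close> is any product \<open>a \<times> y\<close>, and \<open>s\<close> is the arrow
  \<open>id \<times> r : a \<times> y \<rightarrow> a \<times> P\<close>.\<close>

definition is_power_object ::
  "('o, 'm) cat \<Rightarrow> 'o \<Rightarrow> 'o \<Rightarrow> 'o \<Rightarrow> 'm \<Rightarrow> 'm \<Rightarrow> 'm \<Rightarrow> bool" where
  "is_power_object C a P q \<pi>\<^sub>1 \<pi>\<^sub>2 e \<longleftrightarrow>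
    is_product C a P q \<pi>\<^sub>1 \<pi>\<^sub>2 \<and> is_mono C e \<and> Cod C e = q \<and>
    (\<forall>y w \<rho>\<^sub>1 \<rho>\<^sub>2 m. is_product C a y w \<rho>\<^sub>1 \<rho>\<^sub>2 \<and> is_mono C m \<and> Cod C m = w \<longrightarrow>
      (\<exists>!r. r \<in> hom C y P \<and>
        (\<exists>s \<in> hom C w q. s \<bullet>\<^bsub>C\<^esub> \<pi>\<^sub>1 = \<rho>\<^sub>1 \<and> s \<bullet>\<^bsub>C\<^esub> \<pi>\<^sub>2 = \<rho>\<^sub>2 \<bullet>\<^bsub>C\<^esub> r \<and>
          (\<exists>t. is_pullback C s e m t))))"

definition has_power_objects :: "('o, 'm) cat \<Rightarrow> bool" where
  "has_power_objects C \<longleftrightarrow> (\<forall>a \<in> Ob C. \<exists>P q \<pi>\<^sub>1 \<pi>\<^sub>2 e. is_power_object C a P q \<pi>\<^sub>1 \<pi>\<^sub>2 e)"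

definition preserves_power_objects ::
  "('o, 'm) cat \<Rightarrow> ('p, 'n) cat \<Rightarrow> ('o, 'm, 'p, 'n) funct \<Rightarrow> bool" where
  "preserves_power_objects C D F \<longleftrightarrow>
    (\<forall>a P q \<pi>\<^sub>1 \<pi>\<^sub>2 e. is_power_object C a P q \<pi>\<^sub>1 \<pi>\<^sub>2 e \<longrightarrow>
      is_power_object D (FO F a) (FO F P) (FO F q) (FA F \<pi>\<^sub>1) (FA F \<pi>\<^sub>2) (FA F e))"

section \<open>Strict 2-categories\<close>

record ('o, 'm, 'c) two_cat =
  Obj :: "'o set"
  Mor :: "'m set"
  Cell :: "'c set"
  src :: "'m \<Rightarrow> 'o"
  tgt :: "'m \<Rightarrow> 'o"
  id1 :: "'o \<Rightarrow> 'm"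
  comp1 :: "'m \<Rightarrow> 'm \<Rightarrow> 'm"  (infixl "\<cdot>\<index>" 75)
  dom2 :: "'c \<Rightarrow> 'm"
  cod2 :: "'c \<Rightarrow> 'm"
  id2 :: "'m \<Rightarrow> 'c"
  vcomp :: "'c \<Rightarrow> 'c \<Rightarrow> 'c"
  hcomp :: "'c \<Rightarrow> 'c \<Rightarrow> 'c"

definition underlying :: "('o, 'm, 'c) two_cat \<Rightarrow> ('o, 'm) cat" where
  "underlying K = \<lparr>Ob = Obj K, Ar = Mor K, Dom = src K, Cod = tgt K, Idn = id1 K, Cmp = comp1 K\<rparr>"

definition vertical :: "('o, 'm, 'c) two_cat \<Rightarrow> ('m, 'c) cat" where
  "vertical K = \<lparr>Ob = Mor K, Ar = Cell K, Dom = dom2 K, Cod = cod2 K, Idn = id2 K, Cmp = vcomp K\<rparr>"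

locale two_category =
  fixes K :: "('o, 'm, 'c) two_cat"  (structure)
  assumes underlying_category: "category (underlying K)"
    and vertical_category: "category (vertical K)"
    and src_cod2: "\<alpha> \<in> Cell K \<Longrightarrow> src K (cod2 K \<alpha>) = src K (dom2 K \<alpha>)"
    and tgt_cod2: "\<alpha> \<in> Cell K \<Longrightarrow> tgt K (cod2 K \<alpha>) = tgt K (dom2 K \<alpha>)"
    and hcomp_in: "\<lbrakk>\<alpha> \<in> Cell K; \<beta> \<in> Cell K; tgt K (dom2 K \<alpha>) = src K (dom2 K \<beta>)\<rbrakk>
      \<Longrightarrow> hcomp K \<alpha> \<beta> \<in> Cell K"
    and dom2_hcomp: "\<lbrakk>\<alpha> \<in> Cell K; \<beta> \<in> Cell K; tgt K (dom2 K \<alpha>) = src K (dom2 K \<beta>)\<rbrakk>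
      \<Longrightarrow> dom2 K (hcomp K \<alpha> \<beta>) = dom2 K \<alpha> \<cdot> dom2 K \<beta>"
    and cod2_hcomp: "\<lbrakk>\<alpha> \<in> Cell K; \<beta> \<in> Cell K; tgt K (dom2 K \<alpha>) = src K (dom2 K \<beta>)\<rbrakk>
      \<Longrightarrow> cod2 K (hcomp K \<alpha> \<beta>) = cod2 K \<alpha> \<cdot> cod2 K \<beta>"
    and hcomp_id2: "\<lbrakk>f \<in> Mor K; g \<in> Mor K; tgt K f = src K g\<rbrakk>
      \<Longrightarrow> hcomp K (id2 K f) (id2 K g) = id2 K (f \<cdot> g)"
    and interchange: "\<lbrakk>\<alpha> \<in> Cell K; \<alpha>' \<in> Cell K; \<beta> \<in> Cell K; \<beta>' \<in> Cell K;
        cod2 K \<alpha> = dom2 K \<alpha>'; cod2 K \<beta> = dom2 K \<beta>'; tgt K (dom2 K \<alpha>) = src K (dom2 K \<beta>)\<rbrakk>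
      \<Longrightarrow> hcomp K (vcomp K \<alpha> \<alpha>') (vcomp K \<beta> \<beta>') = vcomp K (hcomp K \<alpha> \<beta>) (hcomp K \<alpha>' \<beta>')"
    and hcomp_id_left: "\<alpha> \<in> Cell K \<Longrightarrow> hcomp K (id2 K (id1 K (src K (dom2 K \<alpha>)))) \<alpha> = \<alpha>"
    and hcomp_id_right: "\<alpha> \<in> Cell K \<Longrightarrow> hcomp K \<alpha> (id2 K (id1 K (tgt K (dom2 K \<alpha>)))) = \<alpha>"
    and hcomp_assoc: "\<lbrakk>\<alpha> \<in> Cell K; \<beta> \<in> Cell K; \<gamma> \<in> Cell K;
        tgt K (dom2 K \<alpha>) = src K (dom2 K \<beta>); tgt K (dom2 K \<beta>) = src K (dom2 K \<gamma>)\<rbrakk>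
      \<Longrightarrow> hcomp K (hcomp K \<alpha> \<beta>) \<gamma> = hcomp K \<alpha> (hcomp K \<beta> \<gamma>)"

definition hom1 :: "('o, 'm, 'c) two_cat \<Rightarrow> 'o \<Rightarrow> 'o \<Rightarrow> 'm set" where
  "hom1 K A X = {f \<in> Mor K. src K f = A \<and> tgt K f = X}"

definition Hom :: "('o, 'm, 'c) two_cat \<Rightarrow> 'o \<Rightarrow> 'o \<Rightarrow> ('m, 'c) cat" where
  "Hom K A X = full_subcat (vertical K) (\<lambda>f. f \<in> hom1 K A X)"

definition lwhisker :: "('o, 'm, 'c) two_cat \<Rightarrow> 'm \<Rightarrow> 'c \<Rightarrow> 'c"  (infixr "\<rhd>\<index>" 76) where
  "f \<rhd>\<^bsub>K\<^esub> \<alpha> = hcomp K (id2 K f) \<alpha>"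

definition rwhisker :: "('o, 'm, 'c) two_cat \<Rightarrow> 'c \<Rightarrow> 'm \<Rightarrow> 'c"  (infixl "\<lhd>\<index>" 76) where
  "\<alpha> \<lhd>\<^bsub>K\<^esub> f = hcomp K \<alpha> (id2 K f)"

text \<open>\<open>post K f\<close> and \<open>pre K f\<close> are the functors \<open>f\<^sub>*\<close> and \<open>f\<^sup>*\<close> between hom categories.\<close>

definition post :: "('o, 'm, 'c) two_cat \<Rightarrow> 'm \<Rightarrow> ('m, 'c, 'm, 'c) funct" where
  "post K f = \<lparr>FO = (\<lambda>h. h \<cdot>\<^bsub>K\<^esub> f), FA = (\<lambda>\<alpha>. \<alpha> \<lhd>\<^bsub>K\<^esub> f)\<rparr>"

definition pre :: "('o, 'm, 'c) two_cat \<Rightarrow> 'm \<Rightarrow> ('m, 'c, 'm, 'c) funct" where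
  "pre K f = \<lparr>FO = (\<lambda>h. f \<cdot>\<^bsub>K\<^esub> h), FA = (\<lambda>\<alpha>. f \<rhd>\<^bsub>K\<^esub> \<alpha>)\<rparr>"

text \<open>For a 2-cell \<open>d : d\<^sub>0 \<Rightarrow> d\<^sub>1 : P \<rightarrow> X\<close>, composing with \<open>d\<close> is a functor
  from the hom category \<open>(A, P)\<close> to the arrow category of \<open>(A, X)\<close>.\<close>

definition post_cell :: "('o, 'm, 'c) two_cat \<Rightarrow> 'c \<Rightarrow> ('m, 'c, 'c, 'c \<times> ('c \<times> 'c) \<times> 'c) funct" where
  "post_cell K d = \<lparr>
    FO = (\<lambda>a. a \<rhd>\<^bsub>K\<^esub> d),
    FA = (\<lambda>\<alpha>. (dom2 K \<alpha> \<rhd>\<^bsub>K\<^esub> d,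
               (\<alpha> \<lhd>\<^bsub>K\<^esub> dom2 K d, \<alpha> \<lhd>\<^bsub>K\<^esub> cod2 K d),
               cod2 K \<alpha> \<rhd>\<^bsub>K\<^esub> d))\<rparr>"

definition isofibration :: "('o, 'm, 'c) two_cat \<Rightarrow> 'm \<Rightarrow> bool" where
  "isofibration K f \<longleftrightarrow> f \<in> Mor K \<and>
    (\<forall>A \<in> Obj K. is_isofibration (Hom K A (src K f)) (Hom K A (tgt K f)) (post K f))"

definition DOF :: "('o, 'm, 'c) two_cat \<Rightarrow> 'm \<Rightarrow> bool" where
  "DOF K f \<longleftrightarrow> f \<in> Mor K \<and>
    (\<forall>A \<in> Obj K. is_DOF (Hom K A (src K f)) (Hom K A (tgt K f)) (post K f))"

definition SOF :: "('o, 'm, 'c) two_cat \<Rightarrow> 'm \<Rightarrow> bool" where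
  "SOF K f \<longleftrightarrow> f \<in> Mor K \<and>
    (\<forall>A \<in> Obj K. is_SOF (Hom K A (src K f)) (Hom K A (tgt K f)) (post K f))"

section \<open>Limits in a 2-category\<close>

text \<open>In \<open>strict_pullback K f g h k\<close> and \<open>bipullback K f g h k \<theta>\<close> the cospan is \<open>f\<close>, \<open>g\<close>,
  the projections to the domains of \<open>f\<close> and \<open>g\<close> are \<open>h\<close> and \<open>k\<close>. Drawn with
  \<open>f\<close> at the bottom and \<open>g\<close> on the right, \<open>h\<close> is the left side and \<open>k\<close> the top.\<close>

definition square_boundary :: "('o, 'm, 'c) two_cat \<Rightarrow> 'm \<Rightarrow> 'm \<Rightarrow> 'm \<Rightarrow> 'm \<Rightarrow> bool" where
  "square_boundary K f g h k \<longleftrightarrow>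
    f \<in> Mor K \<and> g \<in> Mor K \<and> h \<in> Mor K \<and> k \<in> Mor K \<and> tgt K f = tgt K g \<and>
    src K h = src K k \<and> tgt K h = src K f \<and> tgt K k = src K g"

definition strict_pullback :: "('o, 'm, 'c) two_cat \<Rightarrow> 'm \<Rightarrow> 'm \<Rightarrow> 'm \<Rightarrow> 'm \<Rightarrow> bool" where
  "strict_pullback K f g h k \<longleftrightarrow>
    square_boundary K f g h k \<and> h \<cdot>\<^bsub>K\<^esub> f = k \<cdot>\<^bsub>K\<^esub> g \<and>
    (\<forall>B \<in> Obj K. cat_isomorphism (Hom K B (src K h))
      (fibre_product (Hom K B (src K f)) (Hom K B (src K g)) (post K f) (post K g))
      \<lparr>FO = (\<lambda>b. (b \<cdot>\<^bsub>K\<^esub> h, b \<cdot>\<^bsub>K\<^esub> k)), FA = (\<lambda>\<beta>. (\<beta> \<lhd>\<^bsub>K\<^esub> h, \<beta> \<lhd>\<^bsub>K\<^esub> k))\<rparr>)"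

definition bipullback :: "('o, 'm, 'c) two_cat \<Rightarrow> 'm \<Rightarrow> 'm \<Rightarrow> 'm \<Rightarrow> 'm \<Rightarrow> 'c \<Rightarrow> bool" where
  "bipullback K f g h k \<theta> \<longleftrightarrow>
    square_boundary K f g h k \<and>
    \<theta> \<in> hom (Hom K (src K h) (tgt K f)) (h \<cdot>\<^bsub>K\<^esub> f) (k \<cdot>\<^bsub>K\<^esub> g) \<and>
    is_iso (Hom K (src K h) (tgt K f)) \<theta> \<and>
    (\<forall>B \<in> Obj K. cat_equivalence (Hom K B (src K h))
      (iso_comma (Hom K B (src K f)) (Hom K B (src K g)) (Hom K B (tgt K f)) (post K f) (post K g))
      (let T = (\<lambda>b. (b \<cdot>\<^bsub>K\<^esub> h, b \<cdot>\<^bsub>K\<^esub> k, b \<rhd>\<^bsub>K\<^esub> \<theta>))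
       in \<lparr>FO = T,
           FA = (\<lambda>\<beta>. (T (dom2 K \<beta>), (\<beta> \<lhd>\<^bsub>K\<^esub> h, \<beta> \<lhd>\<^bsub>K\<^esub> k), T (cod2 K \<beta>)))\<rparr>))"

definition strict_terminal :: "('o, 'm, 'c) two_cat \<Rightarrow> 'o \<Rightarrow> bool" where
  "strict_terminal K T \<longleftrightarrow> T \<in> Obj K \<and>
    (\<forall>A \<in> Obj K. \<exists>t. Ob (Hom K A T) = {t} \<and> Ar (Hom K A T) = {id2 K t})"

definition arrow_object :: "('o, 'm, 'c) two_cat \<Rightarrow> 'o \<Rightarrow> 'o \<Rightarrow> 'c \<Rightarrow> bool" where
  "arrow_object K X P d \<longleftrightarrow> X \<in> Obj K \<and> P \<in> Obj K \<and> d \<in> Ar (Hom K P X) \<and>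
    (\<forall>A \<in> Obj K. cat_isomorphism (Hom K A P) (arrow_cat (Hom K A X)) (post_cell K d))"

definition pita :: "('o, 'm, 'c) two_cat \<Rightarrow> bool" where
  "pita K \<longleftrightarrow>
    (\<exists>T. strict_terminal K T) \<and>
    (\<forall>X \<in> Obj K. \<exists>P d. arrow_object K X P d) \<and>
    (\<forall>f g. isofibration K f \<and> g \<in> Mor K \<and> tgt K f = tgt K g \<longrightarrow>
      (\<exists>h k. strict_pullback K f g h k))"

section \<open>Groupoids and cores\<close>

definition groupoid_object :: "('o, 'm, 'c) two_cat \<Rightarrow> 'o \<Rightarrow> bool" where
  "groupoid_object K X \<longleftrightarrow> X \<in> Obj K \<and> (\<forall>A \<in> Obj K. groupoid (Hom K A X))"

definition arrowwise_iso :: "('o, 'm, 'c) two_cat \<Rightarrow> 'm \<Rightarrow> bool" where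
  "arrowwise_iso K f \<longleftrightarrow> f \<in> Mor K \<and>
    (\<forall>B \<in> Obj K. \<forall>\<alpha> \<in> Ar (Hom K B (src K f)). is_iso (Hom K B (tgt K f)) (\<alpha> \<lhd>\<^bsub>K\<^esub> f))"

definition arrowwise_iso_subcat :: "('o, 'm, 'c) two_cat \<Rightarrow> 'o \<Rightarrow> 'o \<Rightarrow> ('m, 'c) cat" where
  "arrowwise_iso_subcat K A X = (Hom K A X)\<lparr>
    Ob := {f \<in> hom1 K A X. arrowwise_iso K f},
    Ar := {\<alpha>. is_iso (Hom K A X) \<alpha> \<and> arrowwise_iso K (dom2 K \<alpha>) \<and> arrowwise_iso K (cod2 K \<alpha>)}\<rparr>"

definition is_core :: "('o, 'm, 'c) two_cat \<Rightarrow> 'o \<Rightarrow> 'o \<Rightarrow> 'm \<Rightarrow> bool" where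
  "is_core K X Xi i \<longleftrightarrow> X \<in> Obj K \<and> Xi \<in> Obj K \<and> i \<in> hom1 K Xi X \<and> arrowwise_iso K i \<and>
    (\<forall>A \<in> Obj K. cat_isomorphism (Hom K A Xi) (arrowwise_iso_subcat K A X) (post K i))"

text \<open>\<open>induced_on_cores K f i i' g\<close>: for cores \<open>i\<close>, \<open>i'\<close> of the domain and codomain of \<open>f\<close>,
  \<open>g\<close> is the (unique) induced morphism between these cores.\<close>

definition induced_on_cores :: "('o, 'm, 'c) two_cat \<Rightarrow> 'm \<Rightarrow> 'm \<Rightarrow> 'm \<Rightarrow> 'm \<Rightarrow> bool" where
  "induced_on_cores K f i i' g \<longleftrightarrow>
    g \<in> hom1 K (src K i) (src K i') \<and> g \<cdot>\<^bsub>K\<^esub> i' = i \<cdot>\<^bsub>K\<^esub> f"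

definition corepita :: "('o, 'm, 'c) two_cat \<Rightarrow> bool" where
  "corepita K \<longleftrightarrow> pita K \<and> (\<forall>X \<in> Obj K. \<exists>Xi i. is_core K X Xi i)"

section \<open>Generic and plentiful discrete opfibrations\<close>

text \<open>\<open>pb_along K p f l t\<close>: \<open>l\<close> is a strict pullback of \<open>p\<close> along \<open>f\<close>, with top morphism \<open>t\<close>.\<close>

abbreviation pb_along :: "('o, 'm, 'c) two_cat \<Rightarrow> 'm \<Rightarrow> 'm \<Rightarrow> 'm \<Rightarrow> 'm \<Rightarrow> bool" where
  "pb_along K p f l t \<equiv> strict_pullback K f p l t"

definition generic_DOF :: "('o, 'm, 'c) two_cat \<Rightarrow> 'm \<Rightarrow> bool" where
  "generic_DOF K p \<longleftrightarrow> DOF K p \<and>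
    (\<forall>A \<in> Obj K. \<forall>f \<in> hom1 K A (tgt K p). \<forall>h \<in> hom1 K A (tgt K p). \<forall>lf tf lh th g.
      pb_along K p f lf tf \<and> pb_along K p h lh th \<and>
      g \<in> hom1 K (src K lf) (src K lh) \<and> g \<cdot>\<^bsub>K\<^esub> lh = lf \<longrightarrow>
      (\<exists>!\<gamma>. \<gamma> \<in> hom (Hom K A (tgt K p)) f h \<and>
        (\<exists>\<gamma>' \<in> hom (Hom K (src K lf) (src K p)) tf (g \<cdot>\<^bsub>K\<^esub> th).
          \<gamma>' \<lhd>\<^bsub>K\<^esub> p = lf \<rhd>\<^bsub>K\<^esub> \<gamma>)))"

definition small_morphism :: "('o, 'm, 'c) two_cat \<Rightarrow> 'm \<Rightarrow> 'm \<Rightarrow> bool" where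
  "small_morphism K p l \<longleftrightarrow> (\<exists>f t. pb_along K p f l t)"

definition small_SOF :: "('o, 'm, 'c) two_cat \<Rightarrow> 'm \<Rightarrow> 'm \<Rightarrow> bool" where
  "small_SOF K p l \<longleftrightarrow> SOF K l \<and> (\<exists>f t \<theta>. bipullback K f p l t \<theta>)"

definition pre_plentiful :: "('o, 'm, 'c) two_cat \<Rightarrow> 'm \<Rightarrow> bool" where
  "pre_plentiful K p \<longleftrightarrow>
    (\<forall>f. DOF K f \<and> is_mono (underlying K) f \<longrightarrow> small_morphism K p f) \<and>
    (\<forall>f g. small_morphism K p f \<and> small_morphism K p g \<and> tgt K f = src K g \<longrightarrow>
      small_morphism K p (f \<cdot>\<^bsub>K\<^esub> g))"

definition stable_mono :: "('o, 'm, 'c) two_cat \<Rightarrow> 'o \<Rightarrow> 'o \<Rightarrow> 'c \<Rightarrow> bool" where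
  "stable_mono K A X \<alpha> \<longleftrightarrow> \<alpha> \<in> Ar (Hom K A X) \<and>
    (\<forall>A' \<in> Obj K. \<forall>h \<in> hom1 K A' A. is_mono (Hom K A' X) (h \<rhd>\<^bsub>K\<^esub> \<alpha>))"

definition mono_object :: "('o, 'm, 'c) two_cat \<Rightarrow> 'o \<Rightarrow> 'o \<Rightarrow> 'c \<Rightarrow> bool" where
  "mono_object K X M d \<longleftrightarrow> X \<in> Obj K \<and> M \<in> Obj K \<and> stable_mono K M X d \<and>
    (\<forall>A \<in> Obj K. cat_isomorphism (Hom K A M)
      (full_subcat (arrow_cat (Hom K A X)) (stable_mono K A X)) (post_cell K d))"

text \<open>Below, \<open>M\<close> with the 2-cell \<open>d\<close> is \<open>Mon(S)\<close>, where \<open>S\<close> is the codomain of \<open>p\<close>;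
  \<open>i\<close> and \<open>j\<close> are the cores of \<open>S\<close> and \<open>M\<close>, and \<open>c\<close> is the morphism induced
  by the codomain projection \<open>cod2 K d : M \<rightarrow> S\<close>.\<close>

definition plentiful :: "('o, 'm, 'c) two_cat \<Rightarrow> 'm \<Rightarrow> bool" where
  "plentiful K p \<longleftrightarrow> generic_DOF K p \<and> pre_plentiful K p \<and>
    (\<exists>M d Si i Mi j c. mono_object K (tgt K p) M d \<and>
      is_core K (tgt K p) Si i \<and> is_core K M Mi j \<and>
      induced_on_cores K (cod2 K d) j i c \<and> small_SOF K p c)"

section \<open>Internal topoi\<close>

definition internal_finite_limits :: "('o, 'm, 'c) two_cat \<Rightarrow> 'o \<Rightarrow> bool" where
  "internal_finite_limits K X \<longleftrightarrow> X \<in> Obj K \<and>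
    (\<forall>A \<in> Obj K. has_finite_limits (Hom K A X)) \<and>
    (\<forall>A \<in> Obj K. \<forall>A' \<in> Obj K. \<forall>f \<in> hom1 K A' A.
      preserves_finite_limits (Hom K A X) (Hom K A' X) (pre K f))"

definition internal_elementary_topos :: "('o, 'm, 'c) two_cat \<Rightarrow> 'o \<Rightarrow> bool" where
  "internal_elementary_topos K X \<longleftrightarrow> internal_finite_limits K X \<and>
    (\<forall>A. groupoid_object K A \<longrightarrow> has_power_objects (Hom K A X)) \<and>
    (\<forall>A A' f. groupoid_object K A \<and> groupoid_object K A' \<and> f \<in> hom1 K A' A \<longrightarrow>
      preserves_finite_limits (Hom K A X) (Hom K A' X) (pre K f) \<and>
      preserves_power_objects (Hom K A X) (Hom K A' X) (pre K f))"

end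

theory Submission
  imports Defs
begin

text \<open>Lifting along \<open>p\<close> lets a 2-cell \<open>f \<Rightarrow> h : A \<rightarrow> S\<close> act on the elements of \<open>f\<close>: maps
  \<open>s : X \<rightarrow> S\<^sub>p\<close> with \<open>s p = x f\<close>, for varying \<open>x : X \<rightarrow> A\<close>. These are represented by the pullback of \<open>p\<close>
  along \<open>f\<close>, and genericity says that the category of morphisms \<open>A \<rightarrow> S\<close> embeds fully faithfully in presheaves
  of elements. Properties stated elementwise for all \<open>x\<close> are therefore automatically stable under base
  change. Finite limits exist elementwise because composites of small DOFs and mono DOFs are small.
  For a groupoid \<open>A\<close> and \<open>a : A \<rightarrow> S\<close>, lift \<open>a\<close> to the core of \<open>S\<close> and compose with the map classifying
  the small SOF \<open>\<partial>\<^sub>1\<close> on cores; the elements of the resulting \<open>P : A \<rightarrow> S\<close> over \<open>b : B \<rightarrow> A\<close>, \<open>B\<close> a groupoid, are the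
  subobjects of \<open>b a\<close>. For \<open>y : A \<rightarrow> S\<close>, taking for \<open>b\<close> the pullback of \<open>p\<close> along \<open>y\<close> (its domain is again
  a groupoid) identifies 2-cells \<open>y \<Rightarrow> P\<close> with subobjects of \<open>a \<times> y\<close>.\<close>

text \<open>Two obstacles shape the proof. Preservation is demanded of every limit cone and every
  power object of a hom category, not of chosen ones. So each elementwise notion needs a converse: a
  limit, product, monomorphism or power object in the single category of morphisms from
  \<open>A\<close> to \<open>S\<close> already has its elementwise property at all stages over
  \<open>A\<close>. For limits, products and power objects this follows by comparison with an
  elementwise one that is known to exist. The other obstacle is strictness. Smallness of the
  codomain projection on cores is witnessed by a bipullback, so lifts exist only up to isomorphism,
  while an element of \<open>P\<close> is a strict morphism. Unique lifting along \<open>p\<close>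
  bridges the gap: an isomorphism out of the image of an element is absorbed by moving the element,
  and a 2-cell between elements that lies over an identity is an identity. Isomorphic monomorphisms
  thus give equal elements, which is why elements of \<open>P\<close> are subobjects. Groupoids
  enter because a morphism factors through a core exactly when it is an arrow-wise isomorphism,
  which is automatic for morphisms out of a groupoid.\<close>

lemma bij_betw_ex1: "bij_betw F X Y \<longleftrightarrow> (\<forall>x\<in>X. F x \<in> Y) \<and> (\<forall>y\<in>Y. \<exists>!x. x \<in> X \<and> F x = y)"
  unfolding bij_betw_def inj_on_def by (auto simp: image_iff)

section \<open>Calculus of 2-cells, whiskering and inverses\<close>

context two_category
begin

abbreviation vertical_comp :: "'c \<Rightarrow> 'c \<Rightarrow> 'c"  (infixl "\<odot>" 70)
  where "\<alpha> \<odot> \<beta> \<equiv> vcomp K \<alpha> \<beta>"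

lemma src_Obj [simp]: "f \<in> Mor K \<Longrightarrow> src K f \<in> Obj K"
  and tgt_Obj [simp]: "f \<in> Mor K \<Longrightarrow> tgt K f \<in> Obj K"
  and id1_Mor [simp]: "A \<in> Obj K \<Longrightarrow> id1 K A \<in> Mor K"
  and src_id1 [simp]: "A \<in> Obj K \<Longrightarrow> src K (id1 K A) = A"
  and tgt_id1 [simp]: "A \<in> Obj K \<Longrightarrow> tgt K (id1 K A) = A"
  and comp1_Mor [simp]: "\<lbrakk>f \<in> Mor K; g \<in> Mor K; tgt K f = src K g\<rbrakk> \<Longrightarrow> f \<cdot> g \<in> Mor K"
  and src_comp1 [simp]: "\<lbrakk>f \<in> Mor K; g \<in> Mor K; tgt K f = src K g\<rbrakk> \<Longrightarrow> src K (f \<cdot> g) = src K f"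
  and tgt_comp1 [simp]: "\<lbrakk>f \<in> Mor K; g \<in> Mor K; tgt K f = src K g\<rbrakk> \<Longrightarrow> tgt K (f \<cdot> g) = tgt K g"
  and id1_comp1 [simp]: "\<lbrakk>f \<in> Mor K; A = src K f\<rbrakk> \<Longrightarrow> id1 K A \<cdot> f = f"
  and comp1_id1 [simp]: "\<lbrakk>f \<in> Mor K; A = tgt K f\<rbrakk> \<Longrightarrow> f \<cdot> id1 K A = f"
  and comp1_assoc [simp]: "\<lbrakk>f \<in> Mor K; g \<in> Mor K; h \<in> Mor K; tgt K f = src K g; tgt K g = src K h\<rbrakk>
    \<Longrightarrow> (f \<cdot> g) \<cdot> h = f \<cdot> (g \<cdot> h)"
  using underlying_category by (simp_all add: category_def underlying_def)

lemma dom2_Mor [simp]: "\<alpha> \<in> Cell K \<Longrightarrow> dom2 K \<alpha> \<in> Mor K"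
  and cod2_Mor [simp]: "\<alpha> \<in> Cell K \<Longrightarrow> cod2 K \<alpha> \<in> Mor K"
  and id2_Cell [simp]: "f \<in> Mor K \<Longrightarrow> id2 K f \<in> Cell K"
  and dom2_id2 [simp]: "f \<in> Mor K \<Longrightarrow> dom2 K (id2 K f) = f"
  and cod2_id2 [simp]: "f \<in> Mor K \<Longrightarrow> cod2 K (id2 K f) = f"
  and vcomp_Cell [simp]: "\<lbrakk>\<alpha> \<in> Cell K; \<beta> \<in> Cell K; cod2 K \<alpha> = dom2 K \<beta>\<rbrakk> \<Longrightarrow> \<alpha> \<odot> \<beta> \<in> Cell K"
  and dom2_vcomp [simp]: "\<lbrakk>\<alpha> \<in> Cell K; \<beta> \<in> Cell K; cod2 K \<alpha> = dom2 K \<beta>\<rbrakk> \<Longrightarrow> dom2 K (\<alpha> \<odot> \<beta>) = dom2 K \<alpha>"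
  and cod2_vcomp [simp]: "\<lbrakk>\<alpha> \<in> Cell K; \<beta> \<in> Cell K; cod2 K \<alpha> = dom2 K \<beta>\<rbrakk> \<Longrightarrow> cod2 K (\<alpha> \<odot> \<beta>) = cod2 K \<beta>"
  and id2_vcomp [simp]: "\<lbrakk>\<alpha> \<in> Cell K; f = dom2 K \<alpha>\<rbrakk> \<Longrightarrow> id2 K f \<odot> \<alpha> = \<alpha>"
  and vcomp_id2 [simp]: "\<lbrakk>\<alpha> \<in> Cell K; f = cod2 K \<alpha>\<rbrakk> \<Longrightarrow> \<alpha> \<odot> id2 K f = \<alpha>"
  and vcomp_assoc: "\<lbrakk>\<alpha> \<in> Cell K; \<beta> \<in> Cell K; \<gamma> \<in> Cell K; cod2 K \<alpha> = dom2 K \<beta>; cod2 K \<beta> = dom2 K \<gamma>\<rbrakk>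
    \<Longrightarrow> (\<alpha> \<odot> \<beta>) \<odot> \<gamma> = \<alpha> \<odot> (\<beta> \<odot> \<gamma>)"
  using vertical_category by (simp_all add: category_def vertical_def)

declare src_cod2 [simp] tgt_cod2 [simp]

lemma lwhisker_Cell [simp]: "\<lbrakk>f \<in> Mor K; \<alpha> \<in> Cell K; tgt K f = src K (dom2 K \<alpha>)\<rbrakk> \<Longrightarrow> f \<rhd> \<alpha> \<in> Cell K"
  and dom2_lwhisker [simp]: "\<lbrakk>f \<in> Mor K; \<alpha> \<in> Cell K; tgt K f = src K (dom2 K \<alpha>)\<rbrakk> \<Longrightarrow> dom2 K (f \<rhd> \<alpha>) = f \<cdot> dom2 K \<alpha>"
  and cod2_lwhisker [simp]: "\<lbrakk>f \<in> Mor K; \<alpha> \<in> Cell K; tgt K f = src K (dom2 K \<alpha>)\<rbrakk> \<Longrightarrow> cod2 K (f \<rhd> \<alpha>) = f \<cdot> cod2 K \<alpha>"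
  and rwhisker_Cell [simp]: "\<lbrakk>\<alpha> \<in> Cell K; f \<in> Mor K; tgt K (dom2 K \<alpha>) = src K f\<rbrakk> \<Longrightarrow> \<alpha> \<lhd> f \<in> Cell K"
  and dom2_rwhisker [simp]: "\<lbrakk>\<alpha> \<in> Cell K; f \<in> Mor K; tgt K (dom2 K \<alpha>) = src K f\<rbrakk> \<Longrightarrow> dom2 K (\<alpha> \<lhd> f) = dom2 K \<alpha> \<cdot> f"
  and cod2_rwhisker [simp]: "\<lbrakk>\<alpha> \<in> Cell K; f \<in> Mor K; tgt K (dom2 K \<alpha>) = src K f\<rbrakk> \<Longrightarrow> cod2 K (\<alpha> \<lhd> f) = cod2 K \<alpha> \<cdot> f"
  by (simp_all add: lwhisker_def rwhisker_def hcomp_in dom2_hcomp cod2_hcomp)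

lemma lwhisker_id2 [simp]: "\<lbrakk>f \<in> Mor K; g \<in> Mor K; tgt K f = src K g\<rbrakk> \<Longrightarrow> f \<rhd> id2 K g = id2 K (f \<cdot> g)"
  and id2_rwhisker [simp]: "\<lbrakk>f \<in> Mor K; g \<in> Mor K; tgt K f = src K g\<rbrakk> \<Longrightarrow> id2 K f \<lhd> g = id2 K (f \<cdot> g)"
  and id1_lwhisker [simp]: "\<lbrakk>\<alpha> \<in> Cell K; A = src K (dom2 K \<alpha>)\<rbrakk> \<Longrightarrow> id1 K A \<rhd> \<alpha> = \<alpha>"
  and rwhisker_id1 [simp]: "\<lbrakk>\<alpha> \<in> Cell K; A = tgt K (dom2 K \<alpha>)\<rbrakk> \<Longrightarrow> \<alpha> \<lhd> id1 K A = \<alpha>"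
  by (simp_all add: lwhisker_def rwhisker_def hcomp_id2 hcomp_id_left hcomp_id_right)

lemma comp1_lwhisker [simp]:
  "\<lbrakk>f \<in> Mor K; g \<in> Mor K; \<alpha> \<in> Cell K; tgt K f = src K g; tgt K g = src K (dom2 K \<alpha>)\<rbrakk>
    \<Longrightarrow> (f \<cdot> g) \<rhd> \<alpha> = f \<rhd> (g \<rhd> \<alpha>)"
  using hcomp_assoc[of "id2 K f" "id2 K g" \<alpha>] by (simp add: lwhisker_def hcomp_id2)

lemma rwhisker_comp1 [simp]:
  "\<lbrakk>f \<in> Mor K; g \<in> Mor K; \<alpha> \<in> Cell K; tgt K f = src K g; tgt K (dom2 K \<alpha>) = src K f\<rbrakk>
    \<Longrightarrow> \<alpha> \<lhd> (f \<cdot> g) = (\<alpha> \<lhd> f) \<lhd> g"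
  using hcomp_assoc[of \<alpha> "id2 K f" "id2 K g"] by (simp add: rwhisker_def hcomp_id2)

lemma lwhisker_rwhisker [simp]:
  "\<lbrakk>f \<in> Mor K; g \<in> Mor K; \<alpha> \<in> Cell K; tgt K f = src K (dom2 K \<alpha>); tgt K (dom2 K \<alpha>) = src K g\<rbrakk>
    \<Longrightarrow> f \<rhd> (\<alpha> \<lhd> g) = (f \<rhd> \<alpha>) \<lhd> g"
  using hcomp_assoc[of "id2 K f" \<alpha> "id2 K g"] by (simp add: lwhisker_def rwhisker_def)

lemma lwhisker_vcomp:
  "\<lbrakk>f \<in> Mor K; \<alpha> \<in> Cell K; \<beta> \<in> Cell K; cod2 K \<alpha> = dom2 K \<beta>; tgt K f = src K (dom2 K \<alpha>)\<rbrakk>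
    \<Longrightarrow> f \<rhd> (\<alpha> \<odot> \<beta>) = (f \<rhd> \<alpha>) \<odot> (f \<rhd> \<beta>)"
  using interchange[of "id2 K f" "id2 K f" \<alpha> \<beta>] by (simp add: lwhisker_def)

lemma rwhisker_vcomp:
  "\<lbrakk>f \<in> Mor K; \<alpha> \<in> Cell K; \<beta> \<in> Cell K; cod2 K \<alpha> = dom2 K \<beta>; tgt K (dom2 K \<alpha>) = src K f\<rbrakk>
    \<Longrightarrow> (\<alpha> \<odot> \<beta>) \<lhd> f = (\<alpha> \<lhd> f) \<odot> (\<beta> \<lhd> f)"
  using interchange[of \<alpha> \<beta> "id2 K f" "id2 K f"] by (simp add: rwhisker_def)

text \<open>Both sides are the horizontal composite of \<alpha> and \<beta>, by the interchange law
  with identities inserted in the two possible orders.\<close>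

lemma whisker_interchange:
  "\<lbrakk>\<alpha> \<in> Cell K; \<beta> \<in> Cell K; tgt K (dom2 K \<alpha>) = src K (dom2 K \<beta>)\<rbrakk>
    \<Longrightarrow> (\<alpha> \<lhd> dom2 K \<beta>) \<odot> (cod2 K \<alpha> \<rhd> \<beta>) = (dom2 K \<alpha> \<rhd> \<beta>) \<odot> (\<alpha> \<lhd> cod2 K \<beta>)"
  using interchange[of \<alpha> "id2 K (cod2 K \<alpha>)" "id2 K (dom2 K \<beta>)" \<beta>]
    interchange[of "id2 K (dom2 K \<alpha>)" \<alpha> \<beta> "id2 K (cod2 K \<beta>)"]
  by (simp add: lwhisker_def rwhisker_def)

lemma Hom_simps [simp]:
  "Ob (Hom K A X) = hom1 K A X"
  "Dom (Hom K A X) = dom2 K" "Cod (Hom K A X) = cod2 K"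
  "Idn (Hom K A X) = id2 K" "Cmp (Hom K A X) = vcomp K"
  by (auto simp: Hom_def full_subcat_def vertical_def hom1_def)

lemma hom1_iff: "f \<in> hom1 K A X \<longleftrightarrow> f \<in> Mor K \<and> src K f = A \<and> tgt K f = X"
  by (simp add: hom1_def)

lemma Ar_Hom [simp]:
  "\<alpha> \<in> Ar (Hom K A X) \<longleftrightarrow> \<alpha> \<in> Cell K \<and> src K (dom2 K \<alpha>) = A \<and> tgt K (dom2 K \<alpha>) = X"
  by (auto simp: Hom_def full_subcat_def vertical_def hom1_def)

lemma hom_Hom:
  "\<alpha> \<in> hom (Hom K A X) f g \<longleftrightarrow>
    \<alpha> \<in> Cell K \<and> dom2 K \<alpha> = f \<and> cod2 K \<alpha> = g \<and> src K f = A \<and> tgt K f = X"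
  by (auto simp: hom_def)

lemma category_Hom: "category (Hom K A X)"
  by unfold_locales (auto simp: hom1_iff vcomp_assoc)

text \<open>Names the inverse and mentions no hom category, so that whiskering, which changes the
  hom category, still yields an explicit inverse.\<close>

definition invertible2 :: "'c \<Rightarrow> 'c \<Rightarrow> bool" where
  "invertible2 \<alpha> \<beta> \<longleftrightarrow> \<alpha> \<in> Cell K \<and> \<beta> \<in> Cell K \<and> dom2 K \<beta> = cod2 K \<alpha> \<and> cod2 K \<beta> = dom2 K \<alpha> \<and>
    \<alpha> \<odot> \<beta> = id2 K (dom2 K \<alpha>) \<and> \<beta> \<odot> \<alpha> = id2 K (cod2 K \<alpha>)"

lemma is_iso_Hom:
  "is_iso (Hom K A X) \<alpha> \<longleftrightarrow> src K (dom2 K \<alpha>) = A \<and> tgt K (dom2 K \<alpha>) = X \<and> (\<exists>\<beta>. invertible2 \<alpha> \<beta>)"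
proof
  assume "is_iso (Hom K A X) \<alpha>"
  then show "src K (dom2 K \<alpha>) = A \<and> tgt K (dom2 K \<alpha>) = X \<and> (\<exists>\<beta>. invertible2 \<alpha> \<beta>)"
    by (auto simp: is_iso_def invertible2_def hom_Hom)
next
  assume "src K (dom2 K \<alpha>) = A \<and> tgt K (dom2 K \<alpha>) = X \<and> (\<exists>\<beta>. invertible2 \<alpha> \<beta>)"
  then obtain \<beta> where "src K (dom2 K \<alpha>) = A" "tgt K (dom2 K \<alpha>) = X" "invertible2 \<alpha> \<beta>" by blast
  then show "is_iso (Hom K A X) \<alpha>"
    unfolding is_iso_def by (auto simp: invertible2_def hom_Hom intro!: bexI[of _ \<beta>])
qed

lemma invertible2_sym: "invertible2 \<alpha> \<beta> \<Longrightarrow> invertible2 \<beta> \<alpha>"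
  by (simp add: invertible2_def)

lemma invertible2_rwhisker:
  assumes "invertible2 \<alpha> \<beta>" "f \<in> Mor K" "tgt K (dom2 K \<alpha>) = src K f"
  shows "invertible2 (\<alpha> \<lhd> f) (\<beta> \<lhd> f)"
proof -
  obtain a b where ab [simp]: "dom2 K \<alpha> = a" "cod2 K \<alpha> = b" "dom2 K \<beta> = b" "cod2 K \<beta> = a"
    and [simp]: "\<alpha> \<in> Cell K" "\<beta> \<in> Cell K" and inv: "\<alpha> \<odot> \<beta> = id2 K a" "\<beta> \<odot> \<alpha> = id2 K b"
    using assms by (auto simp: invertible2_def)
  have [simp]: "f \<in> Mor K" "a \<in> Mor K" "b \<in> Mor K" "tgt K a = src K f" "tgt K b = src K f"
    using assms dom2_Mor[of \<alpha>] cod2_Mor[of \<alpha>] tgt_cod2[of \<alpha>] by auto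
  show ?thesis
    using rwhisker_vcomp[of f \<alpha> \<beta>] rwhisker_vcomp[of f \<beta> \<alpha>] by (simp add: inv invertible2_def)
qed

lemma invertible2_lwhisker:
  assumes "invertible2 \<alpha> \<beta>" "f \<in> Mor K" "tgt K f = src K (dom2 K \<alpha>)"
  shows "invertible2 (f \<rhd> \<alpha>) (f \<rhd> \<beta>)"
proof -
  obtain a b where ab [simp]: "dom2 K \<alpha> = a" "cod2 K \<alpha> = b" "dom2 K \<beta> = b" "cod2 K \<beta> = a"
    and [simp]: "\<alpha> \<in> Cell K" "\<beta> \<in> Cell K" and inv: "\<alpha> \<odot> \<beta> = id2 K a" "\<beta> \<odot> \<alpha> = id2 K b"
    using assms by (auto simp: invertible2_def)
  have [simp]: "f \<in> Mor K" "a \<in> Mor K" "b \<in> Mor K" "src K a = tgt K f" "src K b = tgt K f"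
    using assms dom2_Mor[of \<alpha>] cod2_Mor[of \<alpha>] src_cod2[of \<alpha>] by auto
  show ?thesis
    using lwhisker_vcomp[of f \<alpha> \<beta>] lwhisker_vcomp[of f \<beta> \<alpha>] by (simp add: inv invertible2_def)
qed

lemma invertible2_vcomp:
  assumes "invertible2 \<alpha> \<beta>" "invertible2 \<alpha>' \<beta>'" "cod2 K \<alpha> = dom2 K \<alpha>'"
  shows "invertible2 (\<alpha> \<odot> \<alpha>') (\<beta>' \<odot> \<beta>)"
proof -
  have *: "(\<alpha> \<odot> \<alpha>') \<odot> (\<beta>' \<odot> \<beta>) = id2 K (dom2 K \<alpha>)"
    if "invertible2 \<alpha> \<beta>" "invertible2 \<alpha>' \<beta>'" "cod2 K \<alpha> = dom2 K \<alpha>'" for \<alpha> \<beta> \<alpha>' \<beta>'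
  proof -
    have "(\<alpha> \<odot> \<alpha>') \<odot> (\<beta>' \<odot> \<beta>) = \<alpha> \<odot> ((\<alpha>' \<odot> \<beta>') \<odot> \<beta>)"
      using that vcomp_assoc[of \<alpha> \<alpha>' "\<beta>' \<odot> \<beta>"] vcomp_assoc[of \<alpha>' \<beta>' \<beta>] by (simp add: invertible2_def)
    then show ?thesis using that by (simp add: invertible2_def)
  qed
  show ?thesis
    using assms *[OF assms] *[of \<beta>' \<alpha>' \<beta> \<alpha>] by (auto simp: invertible2_def)
qed

section \<open>Discrete opfibrations and strict pullbacks\<close>

text \<open>The test object is the source of \<open>s\<close> and can stay implicit; lifting then
  involves only conditions on boundaries, with no hom category to identify.\<close>

lemma DOF_iff:
  "DOF K f \<longleftrightarrow> f \<in> Mor K \<and>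
    (\<forall>s \<in> Mor K. \<forall>\<sigma> \<in> Cell K. tgt K s = src K f \<longrightarrow> dom2 K \<sigma> = s \<cdot> f \<longrightarrow>
      (\<exists>!v. v \<in> Cell K \<and> dom2 K v = s \<and> v \<lhd> f = \<sigma>))" (is "_ \<longleftrightarrow> ?R")
proof
  assume D: "DOF K f"
  show ?R
  proof (intro conjI ballI impI)
    show "f \<in> Mor K" using D by (simp add: DOF_def)
    fix s \<sigma> assume a: "s \<in> Mor K" "\<sigma> \<in> Cell K" "tgt K s = src K f" "dom2 K \<sigma> = s \<cdot> f"
    then have "is_DOF (Hom K (src K s) (src K f)) (Hom K (src K s) (tgt K f)) (post K f)"
      using D by (simp add: DOF_def)
    moreover have "s \<in> Ob (Hom K (src K s) (src K f))" "\<sigma> \<in> Ar (Hom K (src K s) (tgt K f))"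
      "Dom (Hom K (src K s) (tgt K f)) \<sigma> = FO (post K f) s"
      using a \<open>f \<in> Mor K\<close> by (auto simp: hom1_iff post_def)
    ultimately have "\<exists>!v. v \<in> Ar (Hom K (src K s) (src K f)) \<and> Dom (Hom K (src K s) (src K f)) v = s
        \<and> FA (post K f) v = \<sigma>"
      unfolding is_DOF_def by blast
    then show "\<exists>!v. v \<in> Cell K \<and> dom2 K v = s \<and> v \<lhd> f = \<sigma>"
      using a by (simp add: post_def) (metis (no_types, lifting))
  qed
next
  assume R: ?R
  show "DOF K f" unfolding DOF_def is_DOF_def
  proof (intro conjI ballI impI)
    show "f \<in> Mor K" using R by simp
    fix A s \<sigma>
    assume a: "A \<in> Obj K" "s \<in> Ob (Hom K A (src K f))" "\<sigma> \<in> Ar (Hom K A (tgt K f))"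
      "Dom (Hom K A (tgt K f)) \<sigma> = FO (post K f) s"
    then have "s \<in> Mor K" "\<sigma> \<in> Cell K" "tgt K s = src K f" "dom2 K \<sigma> = s \<cdot> f"
      by (auto simp: hom1_iff post_def)
    with R have "\<exists>!v. v \<in> Cell K \<and> dom2 K v = s \<and> v \<lhd> f = \<sigma>" by blast
    then show "\<exists>!v. v \<in> Ar (Hom K A (src K f)) \<and> Dom (Hom K A (src K f)) v = s \<and> FA (post K f) v = \<sigma>"
      using a by (simp add: post_def hom1_iff) (metis (no_types, lifting))
  qed
qed

lemma DOF_Mor: "DOF K f \<Longrightarrow> f \<in> Mor K"
  by (simp add: DOF_def)

lemma DOF_lift:
  assumes "DOF K f" "s \<in> Mor K" "\<sigma> \<in> Cell K" "tgt K s = src K f" "dom2 K \<sigma> = s \<cdot> f"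
  obtains v where "v \<in> Cell K" "dom2 K v = s" "v \<lhd> f = \<sigma>"
  using assms unfolding DOF_iff by blast

lemma DOF_unique:
  assumes "DOF K f" "v \<in> Cell K" "v' \<in> Cell K" "dom2 K v = dom2 K v'" "v \<lhd> f = v' \<lhd> f"
    "tgt K (dom2 K v) = src K f"
  shows "v = v'"
proof -
  have "dom2 K v' \<in> Mor K" "v' \<lhd> f \<in> Cell K" "dom2 K (v' \<lhd> f) = dom2 K v' \<cdot> f"
    using assms DOF_Mor by auto
  moreover have "tgt K (dom2 K v') = src K f" using assms by metis
  ultimately have "\<exists>!w. w \<in> Cell K \<and> dom2 K w = dom2 K v' \<and> w \<lhd> f = v' \<lhd> f"
    using assms(1) unfolding DOF_iff by blast
  then show ?thesis using assms by blast
qed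

text \<open>Lift the inverse \<tau> from the codomain of \<open>v\<close>. Each composite of the
  lift with \<open>v\<close> lies over an identity, hence is one by uniqueness of lifts.\<close>

lemma DOF_reflects_invertible:
  assumes f: "DOF K f" and v: "v \<in> Cell K" "tgt K (dom2 K v) = src K f"
    and inv: "invertible2 (v \<lhd> f) \<tau>"
  shows "\<exists>w. invertible2 v w"
proof -
  note [simp] = DOF_Mor[OF f]
  have \<tau>: "\<tau> \<in> Cell K" "dom2 K \<tau> = cod2 K v \<cdot> f" "cod2 K \<tau> = dom2 K v \<cdot> f"
    "(v \<lhd> f) \<odot> \<tau> = id2 K (dom2 K v \<cdot> f)" "\<tau> \<odot> (v \<lhd> f) = id2 K (cod2 K v \<cdot> f)"
    using inv v by (auto simp: invertible2_def)
  obtain w where w: "w \<in> Cell K" "dom2 K w = cod2 K v" "w \<lhd> f = \<tau>"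
    using DOF_lift[OF f, of "cod2 K v" \<tau>] v \<tau> by auto
  have tw: "tgt K (dom2 K w) = src K f" using w v by simp
  have "v \<odot> w = id2 K (dom2 K v)"
    by (rule DOF_unique[OF f]) (use v w tw \<tau> in \<open>simp_all add: rwhisker_vcomp\<close>)
  \<comment> \<open>A lift comes with a prescribed domain only; the codomain of \<open>w\<close> is
    read off from the equation just proved.\<close>
  moreover from this have cw: "cod2 K w = dom2 K v"
    using v w by (metis cod2_id2 cod2_vcomp dom2_Mor)
  moreover have "w \<odot> v = id2 K (cod2 K v)"
    by (rule DOF_unique[OF f]) (use v w tw \<tau> cw in \<open>simp_all add: rwhisker_vcomp\<close>)
  ultimately show ?thesis using v w by (auto simp: invertible2_def)
qed

text \<open>The lift of an isomorphism is invertible because discrete opfibrations reflect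
  invertibility. This makes the strict pullbacks of a pita 2-category available for them.\<close>

lemma DOF_isofibration:
  assumes "DOF K f"
  shows "isofibration K f"
  unfolding isofibration_def is_isofibration_def
proof (intro conjI ballI allI impI)
  show "f \<in> Mor K" using assms by (rule DOF_Mor)
  fix A s u assume "A \<in> Obj K" "s \<in> Ob (Hom K A (src K f))"
    "is_iso (Hom K A (tgt K f)) u \<and> Dom (Hom K A (tgt K f)) u = FO (post K f) s"
  then obtain u' where a: "s \<in> Mor K" "src K s = A" "tgt K s = src K f" "invertible2 u u'"
    "dom2 K u = s \<cdot> f"
    by (auto simp: is_iso_Hom hom1_iff post_def)
  then obtain v where v: "v \<in> Cell K" "dom2 K v = s" "v \<lhd> f = u"
    using DOF_lift[OF assms, of s u] by (auto simp: invertible2_def)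
  then have "\<exists>w. invertible2 v w"
    using DOF_reflects_invertible[OF assms, of v u'] a by auto
  then show "\<exists>v. is_iso (Hom K A (src K f)) v \<and> Dom (Hom K A (src K f)) v = s \<and> FA (post K f) v = u"
    using a v by (intro exI[of _ v]) (auto simp: is_iso_Hom post_def)
qed

text \<open>A lift of \<open>\<sigma> \<lhd> h\<close> along \<open>g \<cdot> h\<close> already
  lifts \<sigma> along \<open>g\<close>, since 2-cells with a common domain are separated by
  \<open>h\<close>.\<close>

lemma DOF_cancel:
  assumes gh: "DOF K (g \<cdot> h)" and h: "DOF K h" and g: "g \<in> Mor K" "tgt K g = src K h"
  shows "DOF K g"
  unfolding DOF_iff
proof (intro conjI ballI impI)
  note [simp] = DOF_Mor[OF h] g
  show "g \<in> Mor K" by simp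
  fix s \<sigma> assume a: "s \<in> Mor K" "\<sigma> \<in> Cell K" "tgt K s = src K g" "dom2 K \<sigma> = s \<cdot> g"
  show "\<exists>!v. v \<in> Cell K \<and> dom2 K v = s \<and> v \<lhd> g = \<sigma>"
  proof (rule ex_ex1I)
    obtain v where v: "v \<in> Cell K" "dom2 K v = s" "v \<lhd> (g \<cdot> h) = \<sigma> \<lhd> h"
      using DOF_lift[OF gh, of s "\<sigma> \<lhd> h"] a by auto
    have "v \<lhd> g = \<sigma>"
      by (rule DOF_unique[OF h]) (use a v in simp_all)
    then show "\<exists>v. v \<in> Cell K \<and> dom2 K v = s \<and> v \<lhd> g = \<sigma>" using v by blast
  next
    fix v w assume vw: "v \<in> Cell K \<and> dom2 K v = s \<and> v \<lhd> g = \<sigma>" "w \<in> Cell K \<and> dom2 K w = s \<and> w \<lhd> g = \<sigma>"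
    show "v = w" by (rule DOF_unique[OF gh]) (use a vw in simp_all)
  qed
qed

text \<open>The comparison functor exists for any commuting square, so only its bijectivity on
  morphisms and on 2-cells is a condition; the test object is again recovered as a source.\<close>

lemma strict_pullback_iff:
  "strict_pullback K f g h k \<longleftrightarrow>
    square_boundary K f g h k \<and> h \<cdot> f = k \<cdot> g \<and>
    (\<forall>u\<in>Mor K. \<forall>v\<in>Mor K. tgt K u = src K f \<and> tgt K v = src K g \<and> u \<cdot> f = v \<cdot> g \<longrightarrow>
      (\<exists>!w. w \<in> Mor K \<and> tgt K w = src K h \<and> w \<cdot> h = u \<and> w \<cdot> k = v)) \<and>
    (\<forall>\<alpha>\<in>Cell K. \<forall>\<beta>\<in>Cell K. tgt K (dom2 K \<alpha>) = src K f \<and> tgt K (dom2 K \<beta>) = src K g \<and> \<alpha> \<lhd> f = \<beta> \<lhd> g \<longrightarrow>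
      (\<exists>!w. w \<in> Cell K \<and> tgt K (dom2 K w) = src K h \<and> w \<lhd> h = \<alpha> \<and> w \<lhd> k = \<beta>))"
  (is "_ \<longleftrightarrow> _ \<and> _ \<and> ?M \<and> ?C")
proof (cases "square_boundary K f g h k \<and> h \<cdot> f = k \<cdot> g")
  case False
  then show ?thesis by (auto simp: strict_pullback_def)
next
  case True
  then have [simp]: "f \<in> Mor K" "g \<in> Mor K" "h \<in> Mor K" "k \<in> Mor K" and t: "tgt K f = tgt K g"
    "src K h = src K k" "tgt K h = src K f" "tgt K k = src K g" and c: "h \<cdot> f = k \<cdot> g"
    by (auto simp: square_boundary_def)
  let ?D = "\<lambda>B. fibre_product (Hom K B (src K f)) (Hom K B (src K g)) (post K f) (post K g)"
  let ?F = "\<lparr>FO = (\<lambda>b. (b \<cdot> h, b \<cdot> k)), FA = (\<lambda>\<beta>. (\<beta> \<lhd> h, \<beta> \<lhd> k))\<rparr>"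
  have cc: "\<beta> \<lhd> h \<lhd> f = \<beta> \<lhd> k \<lhd> g" if "\<beta> \<in> Cell K" "tgt K (dom2 K \<beta>) = src K k" for \<beta>
    using that c t rwhisker_comp1[of h f \<beta>] rwhisker_comp1[of k g \<beta>] by simp
  have fu: "is_functor (Hom K B (src K h)) (?D B) ?F" for B
    unfolding is_functor_def using t c
    by (auto simp: hom1_iff fibre_product_def post_def hom_def cc rwhisker_vcomp)
  have ob: "bij_betw (FO ?F) (Ob (Hom K B (src K h))) (Ob (?D B)) \<longleftrightarrow>
      (\<forall>u\<in>hom1 K B (src K f). \<forall>v\<in>hom1 K B (src K g). u \<cdot> f = v \<cdot> g \<longrightarrow>
        (\<exists>!w. w \<in> hom1 K B (src K h) \<and> w \<cdot> h = u \<and> w \<cdot> k = v))" for B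
    unfolding bij_betw_ex1 using t c
    by (simp add: hom1_iff fibre_product_def post_def Ball_def) blast
  have ar: "bij_betw (FA ?F) (Ar (Hom K B (src K h))) (Ar (?D B)) \<longleftrightarrow>
      (\<forall>u\<in>Ar (Hom K B (src K f)). \<forall>v\<in>Ar (Hom K B (src K g)). u \<lhd> f = v \<lhd> g \<longrightarrow>
        (\<exists>!w. w \<in> Ar (Hom K B (src K h)) \<and> w \<lhd> h = u \<and> w \<lhd> k = v))" for B
    unfolding bij_betw_ex1 using t c
    by (simp add: fibre_product_def post_def cc Ball_def) blast
  have sp: "strict_pullback K f g h k \<longleftrightarrow> (\<forall>B\<in>Obj K.
      (\<forall>u\<in>hom1 K B (src K f). \<forall>v\<in>hom1 K B (src K g). u \<cdot> f = v \<cdot> g \<longrightarrow>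
        (\<exists>!w. w \<in> hom1 K B (src K h) \<and> w \<cdot> h = u \<and> w \<cdot> k = v)) \<and>
      (\<forall>u\<in>Ar (Hom K B (src K f)). \<forall>v\<in>Ar (Hom K B (src K g)). u \<lhd> f = v \<lhd> g \<longrightarrow>
        (\<exists>!w. w \<in> Ar (Hom K B (src K h)) \<and> w \<lhd> h = u \<and> w \<lhd> k = v)))"
    using True by (simp only: strict_pullback_def cat_isomorphism_def fu ob ar) simp
  have m: "?M \<longleftrightarrow> (\<forall>B\<in>Obj K. \<forall>u\<in>hom1 K B (src K f). \<forall>v\<in>hom1 K B (src K g). u \<cdot> f = v \<cdot> g \<longrightarrow>
        (\<exists>!w. w \<in> hom1 K B (src K h) \<and> w \<cdot> h = u \<and> w \<cdot> k = v))" (is "_ \<longleftrightarrow> ?M'")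
  proof
    assume M: ?M
    show ?M'
    proof (intro ballI impI)
      fix B u v assume a: "u \<in> hom1 K B (src K f)" "v \<in> hom1 K B (src K g)" "u \<cdot> f = v \<cdot> g"
      then have "\<exists>!w. w \<in> Mor K \<and> tgt K w = src K h \<and> w \<cdot> h = u \<and> w \<cdot> k = v"
        using M by (simp add: hom1_iff)
      moreover have "src K w = B" if "w \<in> Mor K" "tgt K w = src K h" "w \<cdot> h = u" for w
        using that a by (auto simp: hom1_iff)
      ultimately show "\<exists>!w. w \<in> hom1 K B (src K h) \<and> w \<cdot> h = u \<and> w \<cdot> k = v"
        by (simp add: hom1_iff) metis
    qed
  next
    assume M: ?M'
    show ?M
    proof (intro ballI impI)
      fix u v assume a: "u \<in> Mor K" "v \<in> Mor K" "tgt K u = src K f \<and> tgt K v = src K g \<and> u \<cdot> f = v \<cdot> g"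
      then have "src K v = src K u"
        by (metis \<open>f \<in> Mor K\<close> \<open>g \<in> Mor K\<close> src_comp1)
      with a M have "\<exists>!w. w \<in> hom1 K (src K u) (src K h) \<and> w \<cdot> h = u \<and> w \<cdot> k = v"
        by (simp add: hom1_iff)
      moreover have "src K w = src K u" if "w \<in> Mor K" "tgt K w = src K h" "w \<cdot> h = u" for w
        using that t by auto
      ultimately show "\<exists>!w. w \<in> Mor K \<and> tgt K w = src K h \<and> w \<cdot> h = u \<and> w \<cdot> k = v"
        by (simp add: hom1_iff) metis
    qed
  qed
  have cl: "?C \<longleftrightarrow> (\<forall>B\<in>Obj K. \<forall>u\<in>Ar (Hom K B (src K f)). \<forall>v\<in>Ar (Hom K B (src K g)). u \<lhd> f = v \<lhd> g \<longrightarrow>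
        (\<exists>!w. w \<in> Ar (Hom K B (src K h)) \<and> w \<lhd> h = u \<and> w \<lhd> k = v))" (is "_ \<longleftrightarrow> ?C'")
  proof
    assume M: ?C
    show ?C'
    proof (intro ballI impI)
      fix B u v assume a: "u\<in>Ar (Hom K B (src K f))" "v\<in>Ar (Hom K B (src K g))" "u \<lhd> f = v \<lhd> g"
      then have "\<exists>!w. w \<in> Cell K \<and> tgt K (dom2 K w) = src K h \<and> w \<lhd> h = u \<and> w \<lhd> k = v"
        using M by simp
      moreover have "src K (dom2 K w) = B" if "w \<in> Cell K" "tgt K (dom2 K w) = src K h" "w \<lhd> h = u" for w
        using that a t by auto
      ultimately show "\<exists>!w. w \<in> Ar (Hom K B (src K h)) \<and> w \<lhd> h = u \<and> w \<lhd> k = v"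
        by simp metis
    qed
  next
    assume M: ?C'
    show ?C
    proof (intro ballI impI)
      fix u v assume a: "u \<in> Cell K" "v \<in> Cell K"
        "tgt K (dom2 K u) = src K f \<and> tgt K (dom2 K v) = src K g \<and> u \<lhd> f = v \<lhd> g"
      then have "src K (dom2 K v) = src K (dom2 K u)"
        by (metis \<open>f \<in> Mor K\<close> \<open>g \<in> Mor K\<close> src_comp1 dom2_rwhisker dom2_Mor)
      with a M have "\<exists>!w. w \<in> Ar (Hom K (src K (dom2 K u)) (src K h)) \<and> w \<lhd> h = u \<and> w \<lhd> k = v"
        by simp
      moreover have "src K (dom2 K w) = src K (dom2 K u)"
        if "w \<in> Cell K" "tgt K (dom2 K w) = src K h" "w \<lhd> h = u" for w
        using that t by auto
      ultimately show "\<exists>!w. w \<in> Cell K \<and> tgt K (dom2 K w) = src K h \<and> w \<lhd> h = u \<and> w \<lhd> k = v"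
        by simp metis
    qed
  qed
  show ?thesis unfolding sp m cl using True by blast
qed

lemma strict_pullback_sym:
  assumes "strict_pullback K f g h k"
  shows "strict_pullback K g f k h"
proof -
  from assms have t: "src K h = src K k" by (simp add: strict_pullback_iff square_boundary_def)
  show ?thesis
    using assms unfolding strict_pullback_iff square_boundary_def t
    by (intro conjI ballI impI) (simp_all add: conj_ac)
qed

lemma strict_pullbackD:
  assumes "strict_pullback K f g h k"
  shows "f \<in> Mor K" "g \<in> Mor K" "h \<in> Mor K" "k \<in> Mor K" "tgt K f = tgt K g"
    "src K k = src K h" "tgt K h = src K f" "tgt K k = src K g" "h \<cdot> f = k \<cdot> g"
  using assms by (simp_all add: strict_pullback_iff square_boundary_def)

lemma strict_pullback_pair:
  assumes "strict_pullback K f g h k" "u \<in> Mor K" "v \<in> Mor K" "tgt K u = src K f" "tgt K v = src K g"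
    "u \<cdot> f = v \<cdot> g"
  obtains w where "w \<in> Mor K" "tgt K w = src K h" "w \<cdot> h = u" "w \<cdot> k = v"
  using assms unfolding strict_pullback_iff by blast

lemma strict_pullback_eq:
  assumes P: "strict_pullback K f g h k" and w: "w \<in> Mor K" "w' \<in> Mor K" "tgt K w = src K h"
    "tgt K w' = src K h" "w \<cdot> h = w' \<cdot> h" "w \<cdot> k = w' \<cdot> k"
  shows "w = w'"
proof -
  note D = strict_pullbackD[OF P]
  have "(w \<cdot> h) \<cdot> f = (w \<cdot> k) \<cdot> g" using w D by simp
  then have "\<exists>!x. x \<in> Mor K \<and> tgt K x = src K h \<and> x \<cdot> h = w \<cdot> h \<and> x \<cdot> k = w \<cdot> k"
    using P w D unfolding strict_pullback_iff by (metis comp1_Mor tgt_comp1)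
  then show ?thesis using w by metis
qed

lemma is_mono_underlying:
  "is_mono (underlying K) m \<longleftrightarrow> m \<in> Mor K \<and>
    (\<forall>u\<in>Mor K. \<forall>v\<in>Mor K. tgt K u = src K m \<and> tgt K v = src K m \<and> u \<cdot> m = v \<cdot> m \<longrightarrow> u = v)"
proof
  assume a: "is_mono (underlying K) m"
  show "m \<in> Mor K \<and>
    (\<forall>u\<in>Mor K. \<forall>v\<in>Mor K. tgt K u = src K m \<and> tgt K v = src K m \<and> u \<cdot> m = v \<cdot> m \<longrightarrow> u = v)"
  proof (intro conjI ballI impI)
    show m: "m \<in> Mor K" using a by (simp add: is_mono_def underlying_def)
    fix u v assume uv: "u \<in> Mor K" "v \<in> Mor K" "tgt K u = src K m \<and> tgt K v = src K m \<and> u \<cdot> m = v \<cdot> m"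
    then have "src K v = src K u" using m src_comp1 by metis
    with uv a src_Obj[of u] show "u = v" unfolding is_mono_def underlying_def hom_def
      by (simp del: src_Obj)
  qed
qed (auto simp: is_mono_def underlying_def hom_def)

definition mono_DOF :: "'m \<Rightarrow> bool" where
  "mono_DOF m \<longleftrightarrow> DOF K m \<and> is_mono (underlying K) m"

lemma mono_DOF_eq:
  "\<lbrakk>mono_DOF m; u \<in> Mor K; v \<in> Mor K; tgt K u = src K m; tgt K v = src K m; u \<cdot> m = v \<cdot> m\<rbrakk> \<Longrightarrow> u = v"
  unfolding mono_DOF_def is_mono_underlying by blast

lemma mono_DOF_Mor [simp]: "mono_DOF m \<Longrightarrow> m \<in> Mor K"
  by (simp add: mono_DOF_def DOF_Mor)

text \<open>A lift along \<open>k\<close> is paired from \<sigma> itself and a lift along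
  \<open>f\<close> of \<sigma> whiskered by \<open>g\<close>.\<close>

lemma DOF_pullback:
  assumes P: "strict_pullback K f g h k" and f: "DOF K f"
  shows "DOF K k"
  unfolding DOF_iff
proof (intro conjI ballI impI)
  note D [simp] = strict_pullbackD[OF P]
  show "k \<in> Mor K" by simp
  fix s \<sigma> assume a [simp]: "s \<in> Mor K" "\<sigma> \<in> Cell K" "tgt K s = src K k" "dom2 K \<sigma> = s \<cdot> k"
  obtain v where v: "v \<in> Cell K" "dom2 K v = s \<cdot> h" "v \<lhd> f = \<sigma> \<lhd> g"
    using DOF_lift[OF f, of "s \<cdot> h" "\<sigma> \<lhd> g"] by auto
  then have "\<exists>!w. w \<in> Cell K \<and> tgt K (dom2 K w) = src K h \<and> w \<lhd> h = v \<and> w \<lhd> k = \<sigma>"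
    using P unfolding strict_pullback_iff by simp
  then obtain w where w: "w \<in> Cell K" "tgt K (dom2 K w) = src K h" "w \<lhd> h = v" "w \<lhd> k = \<sigma>"
    and uniq: "\<And>w'. \<lbrakk>w' \<in> Cell K; tgt K (dom2 K w') = src K h; w' \<lhd> h = v; w' \<lhd> k = \<sigma>\<rbrakk> \<Longrightarrow> w' = w"
    by blast
  \<comment> \<open>The pairing fixes the whiskerings of \<open>w\<close>, not its domain, which is
    compared with \<open>s\<close> through the two projections.\<close>
  have e: "dom2 K w \<cdot> h = s \<cdot> h" "dom2 K w \<cdot> k = s \<cdot> k"
    using w v a dom2_rwhisker[of w h] dom2_rwhisker[of w k] by auto
  have dw: "dom2 K w = s"
    by (rule strict_pullback_eq[OF P _ a(1) w(2) _ e]) (simp_all add: w(1))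
  show "\<exists>!w. w \<in> Cell K \<and> dom2 K w = s \<and> w \<lhd> k = \<sigma>"
  proof (intro ex1I conjI)
    show "w \<in> Cell K" "dom2 K w = s" "w \<lhd> k = \<sigma>" using w dw by simp_all
    fix w' assume w': "w' \<in> Cell K \<and> dom2 K w' = s \<and> w' \<lhd> k = \<sigma>"
    have "(w' \<lhd> h) \<lhd> f = (w' \<lhd> k) \<lhd> g"
      using w' D rwhisker_comp1[of h f w'] rwhisker_comp1[of k g w'] by simp
    then have e: "(w' \<lhd> h) \<lhd> f = v \<lhd> f" using w' v by simp
    have "w' \<lhd> h = v"
      by (rule DOF_unique[OF f _ v(1) _ e]) (use w' v(2) in simp_all)
    then show "w' = w" using uniq w' by simp
  qed
qed

lemma mono_DOF_pullback:
  assumes P: "strict_pullback K f g h k" and f: "mono_DOF f"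
  shows "mono_DOF k"
  unfolding mono_DOF_def is_mono_underlying
proof (intro conjI ballI impI)
  note D [simp] = strict_pullbackD[OF P]
  show "DOF K k" using DOF_pullback[OF P] f by (simp add: mono_DOF_def)
  show "k \<in> Mor K" by simp
  fix u v assume a: "u \<in> Mor K" "v \<in> Mor K" "tgt K u = src K k \<and> tgt K v = src K k \<and> u \<cdot> k = v \<cdot> k"
  have "(w \<cdot> h) \<cdot> f = (w \<cdot> k) \<cdot> g" if "w \<in> Mor K" "tgt K w = src K k" for w
    using that by simp
  then have e: "(u \<cdot> h) \<cdot> f = (v \<cdot> h) \<cdot> f" using a by metis
  have e': "u \<cdot> h = v \<cdot> h" by (rule mono_DOF_eq[OF f _ _ _ _ e]) (use a in simp_all)
  show "u = v" by (rule strict_pullback_eq[OF P _ _ _ _ e']) (use a in simp_all)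
qed

lemma DOF_id1: "A \<in> Obj K \<Longrightarrow> DOF K (id1 K A)"
  unfolding DOF_iff by auto

lemma mono_DOF_id1: "A \<in> Obj K \<Longrightarrow> mono_DOF (id1 K A)"
  unfolding mono_DOF_def is_mono_underlying by (metis DOF_id1 comp1_id1 id1_Mor src_id1 tgt_id1)

text \<open>Hom sets of the hom categories without their index objects, which the boundary morphisms
  determine.\<close>

definition cells :: "'m \<Rightarrow> 'm \<Rightarrow> 'c set" where
  "cells f h = {\<gamma> \<in> Cell K. dom2 K \<gamma> = f \<and> cod2 K \<gamma> = h}"

lemma cells_vcomp: "\<lbrakk>\<gamma> \<in> cells f h; \<delta> \<in> cells h k\<rbrakk> \<Longrightarrow> \<gamma> \<odot> \<delta> \<in> cells f k"
  by (auto simp: cells_def)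

lemma cells_lwhisker: "\<lbrakk>\<gamma> \<in> cells f h; b \<in> Mor K; tgt K b = src K f\<rbrakk> \<Longrightarrow> b \<rhd> \<gamma> \<in> cells (b \<cdot> f) (b \<cdot> h)"
  by (auto simp: cells_def)

lemma cells_id2: "f \<in> Mor K \<Longrightarrow> id2 K f \<in> cells f f"
  by (simp add: cells_def)

lemma hom_Hom_cells:
  "\<lbrakk>f \<in> hom1 K A X; h \<in> hom1 K A X\<rbrakk> \<Longrightarrow> hom (Hom K A X) f h = cells f h"
  by (auto simp: hom_Hom cells_def hom1_iff)

lemma cells_rwhisker: "\<lbrakk>\<gamma> \<in> cells f h; b \<in> Mor K; tgt K f = src K b\<rbrakk> \<Longrightarrow> \<gamma> \<lhd> b \<in> cells (f \<cdot> b) (h \<cdot> b)"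
  by (auto simp: cells_def)

lemma cells_assoc:
  "\<lbrakk>\<alpha> \<in> cells f g; \<beta> \<in> cells g h; \<gamma> \<in> cells h k\<rbrakk> \<Longrightarrow> (\<alpha> \<odot> \<beta>) \<odot> \<gamma> = \<alpha> \<odot> (\<beta> \<odot> \<gamma>)"
  by (rule vcomp_assoc) (auto simp: cells_def)

lemma cells_id2_vcomp: "\<alpha> \<in> cells f g \<Longrightarrow> id2 K f \<odot> \<alpha> = \<alpha>"
  and cells_vcomp_id2: "\<alpha> \<in> cells f g \<Longrightarrow> \<alpha> \<odot> id2 K g = \<alpha>"
  by (auto simp: cells_def)

lemma cells_Mor: "\<alpha> \<in> cells f g \<Longrightarrow> f \<in> Mor K \<and> g \<in> Mor K \<and> src K g = src K f \<and> tgt K g = tgt K f"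
  by (auto simp: cells_def)

lemma cells_invertible2:
  "\<alpha> \<in> cells f g \<Longrightarrow> invertible2 \<alpha> \<beta> \<longleftrightarrow> \<beta> \<in> cells g f \<and> \<alpha> \<odot> \<beta> = id2 K f \<and> \<beta> \<odot> \<alpha> = id2 K g"
  by (auto simp: cells_def invertible2_def)

text \<open>Mono DOFs are used through the sieve of morphisms that factor through them; such sieves
  play the part of subobjects before a classifying morphism is available.\<close>

definition factors_through :: "'m \<Rightarrow> 'm \<Rightarrow> bool" where
  "factors_through y m \<longleftrightarrow> (\<exists>v\<in>Mor K. tgt K v = src K m \<and> v \<cdot> m = y)"

end

section \<open>Pita 2-categories with a pre-plentiful generic DOF\<close>

locale DOF_classifier = two_category K
  for K :: "('o, 'm, 'c) two_cat"  (structure) +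
  fixes p :: 'm and S\<^sub>p S :: 'o
  assumes pita: "pita K"
    and p_hom1: "p \<in> hom1 K S\<^sub>p S"
    and p_generic: "generic_DOF K p"
    and p_pre_plentiful: "pre_plentiful K p"
begin

lemma p_Mor [simp]: "p \<in> Mor K" and src_p [simp]: "src K p = S\<^sub>p" and tgt_p [simp]: "tgt K p = S"
  using p_hom1 by (simp_all add: hom1_iff)

lemma p_DOF: "DOF K p"
  using p_generic by (simp add: generic_DOF_def)

lemma DOF_pullback_exists:
  assumes "DOF K f" "g \<in> Mor K" "tgt K f = tgt K g"
  obtains h k where "strict_pullback K f g h k"
  using pita DOF_isofibration[OF assms(1)] assms unfolding pita_def by blast

text \<open>Strict pullback of mono DOFs is inverse image of sieves; it exists because
  \<open>m\<close> is a discrete opfibration and hence an isofibration.\<close>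

lemma mono_DOF_sieve:
  assumes m: "mono_DOF m" and z: "z \<in> Mor K" "tgt K z = tgt K m"
  shows "\<exists>k. mono_DOF k \<and> tgt K k = src K z \<and>
    (\<forall>y\<in>Mor K. tgt K y = src K z \<longrightarrow> factors_through y k = factors_through (y \<cdot> z) m)"
proof -
  obtain h k where P: "strict_pullback K m z h k"
    using DOF_pullback_exists[of m z] m z by (auto simp: mono_DOF_def)
  note D [simp] = strict_pullbackD[OF P]
  have "factors_through y k = factors_through (y \<cdot> z) m" if y: "y \<in> Mor K" "tgt K y = src K z" for y
  proof
    assume "factors_through y k"
    then obtain v where v: "v \<in> Mor K" "tgt K v = src K k" "v \<cdot> k = y"
      by (auto simp: factors_through_def)
    then have "(v \<cdot> h) \<cdot> m = y \<cdot> z" by auto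
    then show "factors_through (y \<cdot> z) m" using v unfolding factors_through_def
      by (intro bexI[of _ "v \<cdot> h"]) simp_all
  next
    assume "factors_through (y \<cdot> z) m"
    then obtain v where v: "v \<in> Mor K" "tgt K v = src K m" "v \<cdot> m = y \<cdot> z"
      by (auto simp: factors_through_def)
    then obtain w where "w \<in> Mor K" "tgt K w = src K h" "w \<cdot> h = v" "w \<cdot> k = y"
      using strict_pullback_pair[OF P, of v y] y by auto
    then show "factors_through y k" by (auto simp: factors_through_def)
  qed
  then show ?thesis using mono_DOF_pullback[OF P m] by (intro exI[of _ k]) simp
qed

section \<open>Elements\<close>

text \<open>Since the pullback of \<open>p\<close> along \<open>f\<close> represents \<open>x \<mapsto> El (x f)\<close>, genericity of \<open>p\<close>
  becomes a Yoneda lemma, \<open>ev_ext\<close> and \<open>ev_exists\<close>.\<close>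

definition El :: "'m \<Rightarrow> 'm set" where
  "El u = {s \<in> Mor K. tgt K s = S\<^sub>p \<and> s \<cdot> p = u}"

definition lift :: "'m \<Rightarrow> 'c \<Rightarrow> 'c" where
  "lift s \<sigma> = (THE v. v \<in> Cell K \<and> dom2 K v = s \<and> v \<lhd> p = \<sigma>)"

text \<open>Transport of the element \<open>s\<close> along a 2-cell in the discrete opfibration
  \<open>p\<close>. The stage \<open>x\<close> is a separate argument because \<open>s\<close>
  determines only the composite of \<open>x\<close> with the domain of \<gamma>.\<close>

definition ev :: "'m \<Rightarrow> 'c \<Rightarrow> 'm \<Rightarrow> 'm" where
  "ev x \<gamma> s = cod2 K (lift s (x \<rhd> \<gamma>))"

lemma ElI: "\<lbrakk>s \<in> Mor K; tgt K s = S\<^sub>p; s \<cdot> p = u\<rbrakk> \<Longrightarrow> s \<in> El u"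
  by (simp add: El_def)

lemma El_Mor [simp]: "s \<in> El u \<Longrightarrow> s \<in> Mor K" and tgt_El [simp]: "s \<in> El u \<Longrightarrow> tgt K s = S\<^sub>p"
  and El_comp_p: "s \<in> El u \<Longrightarrow> s \<cdot> p = u"
  unfolding El_def by blast+

lemma src_El: "s \<in> El u \<Longrightarrow> src K s = src K u"
  using El_comp_p[of s u] src_comp1[of s p] by simp

lemma El_comp1: "\<lbrakk>s \<in> El u; y \<in> Mor K; tgt K y = src K u\<rbrakk> \<Longrightarrow> y \<cdot> s \<in> El (y \<cdot> u)"
  using src_El[of s u] El_comp_p[of s u] by (intro ElI) simp_all

lemma El_comp1': "\<lbrakk>s \<in> El (x \<cdot> f); y \<in> Mor K; x \<in> Mor K; f \<in> Mor K; tgt K x = src K f; tgt K y = src K x\<rbrakk>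
  \<Longrightarrow> y \<cdot> s \<in> El (y \<cdot> (x \<cdot> f))"
  by (rule El_comp1) simp_all

lemma lift_props:
  assumes "\<sigma> \<in> Cell K" "s \<in> El (dom2 K \<sigma>)"
  shows "lift s \<sigma> \<in> Cell K" "dom2 K (lift s \<sigma>) = s" "lift s \<sigma> \<lhd> p = \<sigma>"
proof -
  have "\<exists>!v. v \<in> Cell K \<and> dom2 K v = s \<and> v \<lhd> p = \<sigma>"
    using p_DOF assms El_comp_p[OF assms(2)] unfolding DOF_iff by simp
  from theI'[OF this] show "lift s \<sigma> \<in> Cell K" "dom2 K (lift s \<sigma>) = s" "lift s \<sigma> \<lhd> p = \<sigma>"
    by (simp_all add: lift_def)
qed

lemma lift_eqI:
  assumes "v \<in> Cell K" "tgt K (dom2 K v) = S\<^sub>p"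
  shows "lift (dom2 K v) (v \<lhd> p) = v"
proof -
  have s: "dom2 K v \<in> El (dom2 K (v \<lhd> p))" using assms by (intro ElI) simp_all
  show ?thesis
    by (rule DOF_unique[OF p_DOF]) (use assms lift_props[OF _ s] in simp_all)
qed

lemma ev_El:
  assumes "\<gamma> \<in> Cell K" "x \<in> Mor K" "tgt K x = src K (dom2 K \<gamma>)" "s \<in> El (x \<cdot> dom2 K \<gamma>)"
  shows "ev x \<gamma> s \<in> El (x \<cdot> cod2 K \<gamma>)"
proof -
  have "s \<in> El (dom2 K (x \<rhd> \<gamma>))" "x \<rhd> \<gamma> \<in> Cell K" using assms by simp_all
  note l = lift_props[OF this(2,1)]
  have "tgt K (dom2 K (lift s (x \<rhd> \<gamma>))) = S\<^sub>p" using l assms by simp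
  then have "cod2 K (lift s (x \<rhd> \<gamma>)) \<cdot> p = cod2 K (lift s (x \<rhd> \<gamma>) \<lhd> p)"
    using l(1) by simp
  then show ?thesis using l assms unfolding ev_def by (intro ElI) simp_all
qed

lemma ev_vcomp:
  assumes "\<gamma> \<in> Cell K" "\<delta> \<in> Cell K" "cod2 K \<gamma> = dom2 K \<delta>" "x \<in> Mor K" "tgt K x = src K (dom2 K \<gamma>)"
    "s \<in> El (x \<cdot> dom2 K \<gamma>)"
  shows "ev x (\<gamma> \<odot> \<delta>) s = ev x \<delta> (ev x \<gamma> s)"
proof -
  have sd: "src K (dom2 K \<delta>) = src K (dom2 K \<gamma>)" using assms src_cod2[of \<gamma>] by simp
  have s: "s \<in> El (dom2 K (x \<rhd> \<gamma>))" "x \<rhd> \<gamma> \<in> Cell K" using assms by simp_all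
  note l = lift_props[OF this(2,1)]
  have e: "ev x \<gamma> s \<in> El (dom2 K (x \<rhd> \<delta>))" "x \<rhd> \<delta> \<in> Cell K"
    using ev_El[of \<gamma> x s] assms sd by simp_all
  note l' = lift_props[OF this(2,1)]
  define v where "v = lift s (x \<rhd> \<gamma>) \<odot> lift (ev x \<gamma> s) (x \<rhd> \<delta>)"
  have v: "v \<in> Cell K" "dom2 K v = s" "cod2 K v = ev x \<delta> (ev x \<gamma> s)"
    using l l' by (simp_all add: v_def ev_def)
  have "v \<lhd> p = (x \<rhd> \<gamma>) \<odot> (x \<rhd> \<delta>)"
    using l l' assms by (simp add: v_def rwhisker_vcomp ev_def)
  also have "\<dots> = x \<rhd> (\<gamma> \<odot> \<delta>)" using assms by (simp add: lwhisker_vcomp)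
  finally have "lift s (x \<rhd> (\<gamma> \<odot> \<delta>)) = v"
    using lift_eqI[of v] v assms by simp
  then show ?thesis using v by (simp add: ev_def)
qed

text \<open>Naturality in the stage: a lift whiskered on the left by \<open>y\<close> is the lift of
  the whiskered 2-cell, by uniqueness.\<close>

lemma ev_comp1:
  assumes "\<gamma> \<in> Cell K" "x \<in> Mor K" "tgt K x = src K (dom2 K \<gamma>)" "s \<in> El (x \<cdot> dom2 K \<gamma>)"
    "y \<in> Mor K" "tgt K y = src K x"
  shows "ev (y \<cdot> x) \<gamma> (y \<cdot> s) = y \<cdot> ev x \<gamma> s"
proof -
  have s: "s \<in> El (dom2 K (x \<rhd> \<gamma>))" "x \<rhd> \<gamma> \<in> Cell K" using assms by simp_all
  note l = lift_props[OF this(2,1)]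
  have ss: "src K s = src K x" using src_El[OF assms(4)] assms by simp
  define v where "v = y \<rhd> lift s (x \<rhd> \<gamma>)"
  have "v \<in> Cell K" "dom2 K v = y \<cdot> s" "cod2 K v = y \<cdot> ev x \<gamma> s" "v \<lhd> p = (y \<cdot> x) \<rhd> \<gamma>"
    using l assms ss lwhisker_rwhisker[of y p "lift s (x \<rhd> \<gamma>)", symmetric]
    by (simp_all add: v_def ev_def del: lwhisker_rwhisker)
  then show ?thesis
    using lift_eqI[of v] assms ss by (simp add: ev_def)
qed

lemma ev_lwhisker:
  "\<lbrakk>\<gamma> \<in> Cell K; b \<in> Mor K; x \<in> Mor K; tgt K x = src K b; tgt K b = src K (dom2 K \<gamma>)\<rbrakk>
    \<Longrightarrow> ev x (b \<rhd> \<gamma>) s = ev (x \<cdot> b) \<gamma> s"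
  by (simp add: ev_def)

lemma ev_id2:
  assumes "f \<in> Mor K" "x \<in> Mor K" "tgt K x = src K f" "s \<in> El (x \<cdot> f)"
  shows "ev x (id2 K f) s = s"
  using lift_eqI[of "id2 K s"] assms by (simp add: ev_def El_comp_p)

lemma cells_El:
  "\<lbrakk>\<gamma> \<in> cells f h; x \<in> Mor K; tgt K x = src K f; s \<in> El (x \<cdot> f)\<rbrakk> \<Longrightarrow> ev x \<gamma> s \<in> El (x \<cdot> h)"
  using ev_El[of \<gamma> x s] by (auto simp: cells_def)

lemma cells_ev_vcomp:
  "\<lbrakk>\<gamma> \<in> cells f h; \<delta> \<in> cells h k; x \<in> Mor K; tgt K x = src K f; s \<in> El (x \<cdot> f)\<rbrakk>
    \<Longrightarrow> ev x (\<gamma> \<odot> \<delta>) s = ev x \<delta> (ev x \<gamma> s)"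
  by (rule ev_vcomp) (auto simp: cells_def)

lemma cells_ev_comp1:
  "\<lbrakk>\<gamma> \<in> cells f h; x \<in> Mor K; tgt K x = src K f; s \<in> El (x \<cdot> f); y \<in> Mor K; tgt K y = src K x\<rbrakk>
    \<Longrightarrow> ev (y \<cdot> x) \<gamma> (y \<cdot> s) = y \<cdot> ev x \<gamma> s"
  by (rule ev_comp1) (auto simp: cells_def)

lemma cells_ev_lwhisker:
  "\<lbrakk>\<gamma> \<in> cells f h; b \<in> Mor K; x \<in> Mor K; tgt K x = src K b; tgt K b = src K f\<rbrakk>
    \<Longrightarrow> ev x (b \<rhd> \<gamma>) s = ev (x \<cdot> b) \<gamma> s"
  by (rule ev_lwhisker) (auto simp: cells_def)

lemma pb_exists:
  assumes "f \<in> Mor K" "tgt K f = S"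
  obtains l t where "pb_along K p f l t"
  using DOF_pullback_exists[OF p_DOF, of f] assms strict_pullback_sym[of p f] tgt_p by metis

lemma pb_simps:
  assumes "pb_along K p f l t"
  shows "f \<in> Mor K" "tgt K f = S" "l \<in> Mor K" "t \<in> Mor K" "tgt K l = src K f" "tgt K t = S\<^sub>p"
    "src K t = src K l" "t \<in> El (l \<cdot> f)"
proof -
  note D = strict_pullbackD[OF assms]
  show "f \<in> Mor K" "tgt K f = S" "l \<in> Mor K" "t \<in> Mor K" "tgt K l = src K f" "tgt K t = S\<^sub>p"
    "src K t = src K l"
    using D by simp_all
  show "t \<in> El (l \<cdot> f)"
    by (rule ElI) (use D in simp_all)
qed

lemma pb_DOF: "pb_along K p f l t \<Longrightarrow> DOF K l"
  using DOF_pullback[OF strict_pullback_sym p_DOF] by blast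

text \<open>So \<open>t\<close> is the universal element of \<open>f\<close>, living at the stage
  \<open>l\<close>; with naturality, a claim about all elements reduces to one about
  \<open>t\<close>.\<close>

lemma pb_point:
  assumes P: "pb_along K p f l t" and "x \<in> Mor K" "tgt K x = src K f" "s \<in> El (x \<cdot> f)"
  obtains v where "v \<in> Mor K" "tgt K v = src K l" "src K v = src K x" "v \<cdot> l = x" "v \<cdot> t = s"
proof -
  obtain v where v: "v \<in> Mor K" "tgt K v = src K l" "v \<cdot> l = x" "v \<cdot> t = s"
    using strict_pullback_pair[OF P, of x s] assms El_comp_p[OF assms(4)] by auto
  moreover have "src K v = src K x" using v pb_simps[OF P] by auto
  ultimately show thesis using that by blast
qed

lemma pb_point_eq:
  assumes "pb_along K p f l t" "v \<in> Mor K" "v' \<in> Mor K" "tgt K v = src K l" "tgt K v' = src K l"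
    "v \<cdot> l = v' \<cdot> l" "v \<cdot> t = v' \<cdot> t"
  shows "v = v'"
  using strict_pullback_eq assms by blast

lemma pb_El:
  assumes "pb_along K p f l t" "v \<in> Mor K" "tgt K v = src K l"
  shows "v \<cdot> t \<in> El ((v \<cdot> l) \<cdot> f)"
  using El_comp1[of t "l \<cdot> f" v] pb_simps[OF assms(1)] assms by simp

text \<open>A morphism over the base from the pullback of \<open>p\<close> along \<open>f\<close> to
  that along \<open>h\<close> is an element \<open>r\<close> of \<open>h\<close> at stage
  \<open>l\<close>. The 2-cell over \<gamma> required by genericity must be the unique lift at
  \<open>t\<close>, so it exists exactly when that lift ends at \<open>r\<close>.\<close>

lemma generic_iff:
  assumes P: "pb_along K p f l t" and h: "h \<in> Mor K" "src K h = src K f" "tgt K h = S"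
    and r: "r \<in> El (l \<cdot> h)"
  shows "\<exists>!\<gamma>. \<gamma> \<in> cells f h \<and> ev l \<gamma> t = r"
proof -
  note D = pb_simps[OF P]
  obtain l' t' where Q: "pb_along K p h l' t'" using pb_exists h by blast
  note E = pb_simps[OF Q]
  obtain g where g: "g \<in> Mor K" "tgt K g = src K l'" "src K g = src K l" "g \<cdot> l' = l" "g \<cdot> t' = r"
    using pb_point[OF Q, of l r] D E h r by auto
  have gen: "\<exists>!\<gamma>. \<gamma> \<in> hom (Hom K A S) f h \<and>
        (\<exists>\<gamma>' \<in> hom (Hom K (src K lf) S\<^sub>p) tf (g \<cdot> th). \<gamma>' \<lhd> p = lf \<rhd> \<gamma>)"
    if "A \<in> Obj K" "f \<in> hom1 K A S" "h \<in> hom1 K A S" "pb_along K p f lf tf" "pb_along K p h lh th"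
      "g \<in> hom1 K (src K lf) (src K lh)" "g \<cdot> lh = lf" for A f h lf tf lh th g
    using p_generic that unfolding generic_DOF_def tgt_p src_p by blast
  have "\<exists>!\<gamma>. \<gamma> \<in> hom (Hom K (src K f) S) f h \<and>
        (\<exists>\<gamma>' \<in> hom (Hom K (src K l) S\<^sub>p) t (g \<cdot> t'). \<gamma>' \<lhd> p = l \<rhd> \<gamma>)"
    by (rule gen[OF _ _ _ P Q]) (use D h g in \<open>simp_all add: hom1_iff\<close>)
  moreover have "hom (Hom K (src K f) S) f h = cells f h"
    using D h by (auto simp: hom_Hom cells_def)
  moreover have "(\<exists>\<gamma>' \<in> hom (Hom K (src K l) S\<^sub>p) t (g \<cdot> t'). \<gamma>' \<lhd> p = l \<rhd> \<gamma>) \<longleftrightarrow> ev l \<gamma> t = r"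
    if \<gamma>: "\<gamma> \<in> cells f h" for \<gamma>
  proof
    assume "\<exists>\<gamma>' \<in> hom (Hom K (src K l) S\<^sub>p) t (g \<cdot> t'). \<gamma>' \<lhd> p = l \<rhd> \<gamma>"
    then obtain \<gamma>' where c: "\<gamma>' \<in> Cell K" "dom2 K \<gamma>' = t" "cod2 K \<gamma>' = r" "\<gamma>' \<lhd> p = l \<rhd> \<gamma>"
      using g by (auto simp: hom_Hom)
    then show "ev l \<gamma> t = r" using lift_eqI[of \<gamma>'] D by (simp add: ev_def)
  next
    assume a: "ev l \<gamma> t = r"
    have "l \<rhd> \<gamma> \<in> Cell K" "t \<in> El (dom2 K (l \<rhd> \<gamma>))" using \<gamma> D by (auto simp: cells_def)
    note L = lift_props[OF this]
    show "\<exists>\<gamma>' \<in> hom (Hom K (src K l) S\<^sub>p) t (g \<cdot> t'). \<gamma>' \<lhd> p = l \<rhd> \<gamma>"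
      using L a D g by (intro bexI[of _ "lift t (l \<rhd> \<gamma>)"]) (auto simp: hom_Hom ev_def)
  qed
  ultimately show ?thesis by (simp cong: conj_cong)
qed

lemma ev_ext:
  assumes "\<gamma> \<in> cells f h" "\<delta> \<in> cells f h" "tgt K f = S"
    and eq: "\<And>x s. \<lbrakk>x \<in> Mor K; tgt K x = src K f; s \<in> El (x \<cdot> f)\<rbrakk> \<Longrightarrow> ev x \<gamma> s = ev x \<delta> s"
  shows "\<gamma> = \<delta>"
proof -
  have f: "f \<in> Mor K" "h \<in> Mor K" "src K h = src K f" "tgt K h = S"
    using assms by (auto simp: cells_def)
  obtain l t where P: "pb_along K p f l t" using pb_exists f assms by blast
  note D = pb_simps[OF P]
  have "\<exists>!\<gamma>. \<gamma> \<in> cells f h \<and> ev l \<gamma> t = ev l \<delta> t"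
    using generic_iff[OF P, of h "ev l \<delta> t"] cells_El[OF assms(2)] D f by auto
  then show ?thesis using assms eq[of l t] D by auto
qed

lemma ev_exists:
  assumes f: "f \<in> Mor K" "tgt K f = S" and h: "h \<in> Mor K" "src K h = src K f" "tgt K h = S"
    and El: "\<And>x s. \<lbrakk>x \<in> Mor K; tgt K x = src K f; s \<in> El (x \<cdot> f)\<rbrakk> \<Longrightarrow> \<phi> x s \<in> El (x \<cdot> h)"
    and nat: "\<And>x s y. \<lbrakk>x \<in> Mor K; tgt K x = src K f; s \<in> El (x \<cdot> f); y \<in> Mor K; tgt K y = src K x\<rbrakk>
      \<Longrightarrow> \<phi> (y \<cdot> x) (y \<cdot> s) = y \<cdot> \<phi> x s"
  obtains \<gamma> where "\<gamma> \<in> cells f h"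
    "\<And>x s. \<lbrakk>x \<in> Mor K; tgt K x = src K f; s \<in> El (x \<cdot> f)\<rbrakk> \<Longrightarrow> ev x \<gamma> s = \<phi> x s"
proof -
  obtain l t where P: "pb_along K p f l t" using pb_exists f by blast
  note D = pb_simps[OF P]
  \<comment> \<open>A natural family is determined by its value at the universal element, so only
    that value is prescribed.\<close>
  obtain \<gamma> where \<gamma>: "\<gamma> \<in> cells f h" "ev l \<gamma> t = \<phi> l t"
    using generic_iff[OF P h] El D by blast
  have "ev x \<gamma> s = \<phi> x s" if x: "x \<in> Mor K" "tgt K x = src K f" "s \<in> El (x \<cdot> f)" for x s
  proof -
    obtain v where v: "v \<in> Mor K" "tgt K v = src K l" "v \<cdot> l = x" "v \<cdot> t = s"
      using pb_point[OF P x] by blast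
    then show ?thesis
      using cells_ev_comp1[OF \<gamma>(1), of l t v] nat[of l t v] D \<gamma> by simp
  qed
  with \<gamma> show thesis using that by blast
qed

section \<open>Pointwise monomorphisms and comprehension\<close>

definition img :: "'m \<Rightarrow> 'c \<Rightarrow> 'm set" where
  "img x n = ev x n ` El (x \<cdot> dom2 K n)"

definition pointwise_mono :: "'c \<Rightarrow> bool" where
  "pointwise_mono n \<longleftrightarrow> n \<in> Cell K \<and> tgt K (dom2 K n) = S \<and>
    (\<forall>x\<in>Mor K. tgt K x = src K (dom2 K n) \<longrightarrow> inj_on (ev x n) (El (x \<cdot> dom2 K n)))"

lemma pointwise_mono_eq:
  "\<lbrakk>pointwise_mono n; n \<in> cells f h; x \<in> Mor K; tgt K x = src K f; s \<in> El (x \<cdot> f); s' \<in> El (x \<cdot> f);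
    ev x n s = ev x n s'\<rbrakk> \<Longrightarrow> s = s'"
  unfolding pointwise_mono_def cells_def by (auto dest: inj_onD)

lemma pointwise_monoI:
  assumes "n \<in> cells f h" "tgt K f = S"
    "\<And>x s s'. \<lbrakk>x \<in> Mor K; tgt K x = src K f; s \<in> El (x \<cdot> f); s' \<in> El (x \<cdot> f); ev x n s = ev x n s'\<rbrakk> \<Longrightarrow> s = s'"
  shows "pointwise_mono n"
  using assms unfolding pointwise_mono_def cells_def by (auto intro!: inj_onI)

lemma img_iff: "n \<in> cells f h \<Longrightarrow> s \<in> img x n \<longleftrightarrow> (\<exists>s'\<in>El (x \<cdot> f). ev x n s' = s)"
  by (auto simp: img_def cells_def)

lemma img_lwhisker:
  "\<lbrakk>n \<in> cells f h; b \<in> Mor K; x \<in> Mor K; tgt K x = src K b; tgt K b = src K f\<rbrakk>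
    \<Longrightarrow> img x (b \<rhd> n) = img (x \<cdot> b) n"
  by (auto simp: img_def cells_def ev_lwhisker image_iff)

lemma pointwise_mono_lwhisker:
  assumes n: "pointwise_mono n" "n \<in> cells f h" and b: "b \<in> Mor K" "tgt K b = src K f"
  shows "pointwise_mono (b \<rhd> n)"
proof (rule pointwise_monoI[OF cells_lwhisker[OF n(2) b]])
  have f: "f \<in> Mor K" "tgt K f = S" using n by (auto simp: pointwise_mono_def cells_def)
  show "tgt K (b \<cdot> f) = S" using f b by simp
  fix x s s' assume a: "x \<in> Mor K" "tgt K x = src K (b \<cdot> f)" "s \<in> El (x \<cdot> (b \<cdot> f))" "s' \<in> El (x \<cdot> (b \<cdot> f))"
    "ev x (b \<rhd> n) s = ev x (b \<rhd> n) s'"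
  then show "s = s'"
    using pointwise_mono_eq[OF n, of "x \<cdot> b" s s'] f b cells_ev_lwhisker[OF n(2) b(1), of x] by simp
qed

lemma generic_obtain:
  assumes "pb_along K p f l t" "h \<in> Mor K" "src K h = src K f" "tgt K h = S" "r \<in> El (l \<cdot> h)"
  obtains \<gamma> where "\<gamma> \<in> cells f h" "ev l \<gamma> t = r"
  using generic_iff[OF assms] by blast

lemma small_comp1:
  assumes "pb_along K p f l t" "small_morphism K p k" "tgt K k = src K l"
  obtains g u where "pb_along K p g (k \<cdot> l) u"
  using p_pre_plentiful assms unfolding pre_plentiful_def small_morphism_def by metis

lemma mono_DOF_small: "mono_DOF k \<Longrightarrow> small_morphism K p k"
  using p_pre_plentiful unfolding pre_plentiful_def mono_DOF_def by blast

text \<open>\<open>k \<cdot> l\<close> is a composite of small morphisms, hence the pullback of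
  \<open>p\<close> along some \<open>x\<close>; genericity turns the inclusion \<open>k\<close> into
  a 2-cell \<open>n\<close>, injective on elements because \<open>k\<close> is monic.\<close>

lemma subobject_of_mono_DOF:
  assumes P: "pb_along K p w l t" and k: "mono_DOF k" "tgt K k = src K l"
  obtains n x where "pointwise_mono n" "n \<in> cells x w"
    "\<And>v. \<lbrakk>v \<in> Mor K; tgt K v = src K l\<rbrakk> \<Longrightarrow> v \<cdot> t \<in> img (v \<cdot> l) n \<longleftrightarrow> factors_through v k"
proof -
  note D [simp] = pb_simps(1-7)[OF P]
  have [simp]: "k \<in> Mor K" "tgt K k = src K l" using k by simp_all
  obtain x u where Q: "pb_along K p x (k \<cdot> l) u"
    using small_comp1[OF P mono_DOF_small[OF k(1)] k(2)] by blast
  note E = pb_simps[OF Q]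
  have sx: "src K x = src K w" using E by simp
  have "k \<cdot> t \<in> El ((k \<cdot> l) \<cdot> w)" using pb_El[OF P] by simp
  then obtain n where n: "n \<in> cells x w" "ev (k \<cdot> l) n u = k \<cdot> t"
    using generic_obtain[OF Q, of w "k \<cdot> t"] sx by auto
  have evn: "ev (v \<cdot> (k \<cdot> l)) n (v \<cdot> u) = v \<cdot> (k \<cdot> t)" if "v \<in> Mor K" "tgt K v = src K k" for v
    using cells_ev_comp1[OF n(1), of "k \<cdot> l" u v] E n that by simp
  have eqk: "v = v'" if v: "v \<in> Mor K" "tgt K v = src K k" "v' \<in> Mor K" "tgt K v' = src K k"
    "v \<cdot> (k \<cdot> l) = v' \<cdot> (k \<cdot> l)" "v \<cdot> (k \<cdot> t) = v' \<cdot> (k \<cdot> t)" for v v'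
  proof -
    have "v \<cdot> k = v' \<cdot> k" by (rule pb_point_eq[OF P]) (use v in simp_all)
    then show ?thesis using mono_DOF_eq[OF k(1)] v by blast
  qed
  show thesis
  proof (rule that)
    show "pointwise_mono n"
    proof (rule pointwise_monoI[OF n(1)])
      show "tgt K x = S" using E by simp
      fix y s s' assume a: "y \<in> Mor K" "tgt K y = src K x" "s \<in> El (y \<cdot> x)" "s' \<in> El (y \<cdot> x)"
        "ev y n s = ev y n s'"
      obtain v where v: "v \<in> Mor K" "tgt K v = src K (k \<cdot> l)" "v \<cdot> (k \<cdot> l) = y" "v \<cdot> u = s"
        using pb_point[OF Q a(1,2,3)] by blast
      obtain v' where v': "v' \<in> Mor K" "tgt K v' = src K (k \<cdot> l)" "v' \<cdot> (k \<cdot> l) = y" "v' \<cdot> u = s'"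
        using pb_point[OF Q a(1,2,4)] by blast
      have "v = v'"
        using eqk[of v v'] evn[of v] evn[of v'] a v v' by simp
      then show "s = s'" using v v' by simp
    qed
    show "n \<in> cells x w" by (rule n)
    fix v assume v: "v \<in> Mor K" "tgt K v = src K l"
    show "v \<cdot> t \<in> img (v \<cdot> l) n \<longleftrightarrow> factors_through v k"
    proof
      assume "v \<cdot> t \<in> img (v \<cdot> l) n"
      then obtain s where s: "s \<in> El ((v \<cdot> l) \<cdot> x)" "ev (v \<cdot> l) n s = v \<cdot> t"
        using img_iff[OF n(1)] by blast
      obtain v' where v': "v' \<in> Mor K" "tgt K v' = src K (k \<cdot> l)" "v' \<cdot> (k \<cdot> l) = v \<cdot> l" "v' \<cdot> u = s"
        using pb_point[OF Q, of "v \<cdot> l" s] s v sx by auto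
      have "v' \<cdot> k = v"
        by (rule pb_point_eq[OF P]) (use v v' evn[of v'] s in simp_all)
      then show "factors_through v k" using v' by (auto simp: factors_through_def)
    next
      assume "factors_through v k"
      then obtain v' where v': "v' \<in> Mor K" "tgt K v' = src K k" "v' \<cdot> k = v"
        by (auto simp: factors_through_def)
      have "v' \<cdot> u \<in> El ((v' \<cdot> (k \<cdot> l)) \<cdot> x)" using pb_El[OF Q, of v'] v' by simp
      moreover have "v' \<cdot> (k \<cdot> l) = v \<cdot> l" "v' \<cdot> (k \<cdot> t) = v \<cdot> t"
        using v' by auto
      ultimately show "v \<cdot> t \<in> img (v \<cdot> l) n"
        using evn[of v'] v' img_iff[OF n(1), of "v \<cdot> t" "v \<cdot> l"] by auto
    qed
  qed
qed

text \<open>\<open>n\<close> acts on universal elements and so induces a map \<open>m\<close>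
  between the pullbacks of \<open>p\<close> along \<open>x\<close> and \<open>w\<close>. It is a
  discrete opfibration by cancellation, as both legs to the base are, and monic because
  \<open>n\<close> is injective on elements.\<close>

lemma mono_DOF_of_subobject:
  assumes n: "pointwise_mono n" "n \<in> cells x w" and P: "pb_along K p w l t"
  obtains m where "mono_DOF m" "tgt K m = src K l"
    "\<And>v. \<lbrakk>v \<in> Mor K; tgt K v = src K l\<rbrakk> \<Longrightarrow> factors_through v m \<longleftrightarrow> v \<cdot> t \<in> img (v \<cdot> l) n"
proof -
  note D [simp] = pb_simps(1-7)[OF P]
  have x: "x \<in> Mor K" "tgt K x = S" "src K x = src K w"
    using n by (auto simp: cells_def pointwise_mono_def)
  obtain l' t' where Q: "pb_along K p x l' t'" using pb_exists x by blast
  note E = pb_simps[OF Q]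
  have "ev l' n t' \<in> El (l' \<cdot> w)" by (rule cells_El[OF n(2)]) (use E in simp_all)
  then obtain m where m: "m \<in> Mor K" "tgt K m = src K l" "src K m = src K l'" "m \<cdot> l = l'" "m \<cdot> t = ev l' n t'"
    using pb_point[OF P, of l' "ev l' n t'"] E x by auto
  have evn: "ev (v \<cdot> l') n (v \<cdot> t') = v \<cdot> (m \<cdot> t)" if "v \<in> Mor K" "tgt K v = src K l'" for v
    using cells_ev_comp1[OF n(2), of l' t' v] E m that by simp
  have ml: "v \<cdot> (m \<cdot> l) = v \<cdot> l'" for v using m by simp
  have "DOF K m" by (rule DOF_cancel[OF _ pb_DOF[OF P]]) (use m pb_DOF[OF Q] in simp_all)
  moreover have "is_mono (underlying K) m"
    unfolding is_mono_underlying
  proof (intro conjI ballI impI)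
    show "m \<in> Mor K" by (rule m)
    fix u v assume a: "u \<in> Mor K" "v \<in> Mor K" "tgt K u = src K m \<and> tgt K v = src K m \<and> u \<cdot> m = v \<cdot> m"
    have "(w \<cdot> m) \<cdot> l = w \<cdot> l'" "(w \<cdot> m) \<cdot> t = w \<cdot> (m \<cdot> t)" if "w \<in> Mor K" "tgt K w = src K m" for w
      using that m by simp_all
    then have e: "u \<cdot> l' = v \<cdot> l'" "u \<cdot> (m \<cdot> t) = v \<cdot> (m \<cdot> t)" using a by metis+
    have "u \<cdot> t' = v \<cdot> t'"
      by (rule pointwise_mono_eq[OF n, of "u \<cdot> l'"])
        (use a m E e evn[of u] evn[of v] pb_El[OF Q, of u] pb_El[OF Q, of v] in simp_all)
    then show "u = v" using pb_point_eq[OF Q, of u v] e a m by simp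
  qed
  moreover have "factors_through v m \<longleftrightarrow> v \<cdot> t \<in> img (v \<cdot> l) n" if v: "v \<in> Mor K" "tgt K v = src K l" for v
  proof
    assume "factors_through v m"
    then obtain v' where v': "v' \<in> Mor K" "tgt K v' = src K m" "v' \<cdot> m = v"
      by (auto simp: factors_through_def)
    have "v \<cdot> l = v' \<cdot> l'" "v \<cdot> t = v' \<cdot> (m \<cdot> t)"
      unfolding v'(3)[symmetric] using v'(1,2) m by simp_all
    then show "v \<cdot> t \<in> img (v \<cdot> l) n"
      using evn[of v'] v' m pb_El[OF Q, of v'] img_iff[OF n(2)] by auto
  next
    assume "v \<cdot> t \<in> img (v \<cdot> l) n"
    then obtain s where s: "s \<in> El ((v \<cdot> l) \<cdot> x)" "ev (v \<cdot> l) n s = v \<cdot> t"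
      using img_iff[OF n(2)] by blast
    obtain v' where v': "v' \<in> Mor K" "tgt K v' = src K l'" "v' \<cdot> l' = v \<cdot> l" "v' \<cdot> t' = s"
      using pb_point[OF Q, of "v \<cdot> l" s] s v x by auto
    have "v' \<cdot> m = v"
      by (rule pb_point_eq[OF P]) (use v v' m evn[of v'] s ml[of v'] in simp_all)
    then show "factors_through v m" using v' m by (auto simp: factors_through_def)
  qed
  ultimately show thesis using that[of m] m by (simp add: mono_DOF_def)
qed

text \<open>Pulls the subobject \<open>n\<close> of \<open>w'\<close>, viewed as a mono DOF over the pullback of \<open>p\<close> along \<open>w'\<close>,
  back along the map \<open>(b, z)\<close>; the result is a mono DOF over the source of \<open>l\<close>, hence again a
  subobject of \<open>w\<close>.\<close>

lemma comprehension:
  assumes P: "pb_along K p w l t" and n: "pointwise_mono n" "n \<in> cells x w'"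
    and b: "b \<in> Mor K" "src K b = src K l" "tgt K b = src K w'" and z: "z \<in> El (b \<cdot> w')"
  obtains n' x' where "pointwise_mono n'" "n' \<in> cells x' w"
    "\<And>v. \<lbrakk>v \<in> Mor K; tgt K v = src K l\<rbrakk> \<Longrightarrow> v \<cdot> t \<in> img (v \<cdot> l) n' \<longleftrightarrow> v \<cdot> z \<in> img (v \<cdot> b) n"
proof -
  note D [simp] = pb_simps(1-7)[OF P]
  have w': "w' \<in> Mor K" "tgt K w' = S" using n by (auto simp: cells_def pointwise_mono_def)
  obtain l2 t2 where Q: "pb_along K p w' l2 t2" using pb_exists w' by blast
  note E = pb_simps[OF Q]
  obtain m where m: "mono_DOF m" "tgt K m = src K l2"
    "\<And>v. \<lbrakk>v \<in> Mor K; tgt K v = src K l2\<rbrakk> \<Longrightarrow> factors_through v m \<longleftrightarrow> v \<cdot> t2 \<in> img (v \<cdot> l2) n"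
    using mono_DOF_of_subobject[OF n Q] by blast
  obtain Z where Z: "Z \<in> Mor K" "tgt K Z = src K l2" "src K Z = src K l" "Z \<cdot> l2 = b" "Z \<cdot> t2 = z"
    using pb_point[OF Q, of b z] b z by auto
  obtain k where k: "mono_DOF k" "tgt K k = src K l"
    "\<And>y. \<lbrakk>y \<in> Mor K; tgt K y = src K l\<rbrakk> \<Longrightarrow> factors_through y k = factors_through (y \<cdot> Z) m"
    using mono_DOF_sieve[OF m(1), of Z] Z m by auto
  obtain n' x' where n': "pointwise_mono n'" "n' \<in> cells x' w"
    "\<And>v. \<lbrakk>v \<in> Mor K; tgt K v = src K l\<rbrakk> \<Longrightarrow> v \<cdot> t \<in> img (v \<cdot> l) n' \<longleftrightarrow> factors_through v k"
    using subobject_of_mono_DOF[OF P k(1,2)] by blast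
  show thesis
  proof (rule that[OF n'(1,2)])
    fix v assume v: "v \<in> Mor K" "tgt K v = src K l"
    have "(v \<cdot> Z) \<cdot> t2 = v \<cdot> z" "(v \<cdot> Z) \<cdot> l2 = v \<cdot> b" using v Z E by simp_all
    then show "v \<cdot> t \<in> img (v \<cdot> l) n' \<longleftrightarrow> v \<cdot> z \<in> img (v \<cdot> b) n"
      using n'(3)[OF v] k(3)[OF v] m(3)[of "v \<cdot> Z"] v Z by simp
  qed
qed

text \<open>The equalizer of two sections of a DOF is a mono DOF, since a section of a DOF is one.\<close>

lemma El_equalizer:
  assumes u: "u \<in> Mor K" "tgt K u = S" and r: "r \<in> El u" "r' \<in> El u"
  obtains k where "mono_DOF k" "tgt K k = src K u"
    "\<And>y. \<lbrakk>y \<in> Mor K; tgt K y = src K u\<rbrakk> \<Longrightarrow> factors_through y k \<longleftrightarrow> y \<cdot> r = y \<cdot> r'"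
proof -
  obtain l t where P: "pb_along K p u l t" using pb_exists u by blast
  note D [simp] = pb_simps(1-7)[OF P]
  \<comment> \<open>At the identity stage an element of \<open>u\<close> is a section of
    \<open>l\<close>.\<close>
  have point: "\<exists>\<rho>. \<rho> \<in> Mor K \<and> tgt K \<rho> = src K l \<and> src K \<rho> = src K u \<and> \<rho> \<cdot> l = id1 K (src K u) \<and> \<rho> \<cdot> t = r"
    if "r \<in> El u" for r
    using pb_point[OF P, of "id1 K (src K u)" r] that u by auto
  obtain \<rho> where \<rho>: "\<rho> \<in> Mor K" "tgt K \<rho> = src K l" "src K \<rho> = src K u" "\<rho> \<cdot> l = id1 K (src K u)" "\<rho> \<cdot> t = r"
    using point[OF r(1)] by blast
  obtain \<rho>' where \<rho>': "\<rho>' \<in> Mor K" "tgt K \<rho>' = src K l" "src K \<rho>' = src K u" "\<rho>' \<cdot> l = id1 K (src K u)" "\<rho>' \<cdot> t = r'"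
    using point[OF r(2)] by blast
  have "DOF K \<rho>'"
    by (rule DOF_cancel[OF _ pb_DOF[OF P]]) (use \<rho>' u DOF_id1 in simp_all)
  moreover have "is_mono (underlying K) \<rho>'"
    unfolding is_mono_underlying
  proof (intro conjI ballI impI)
    show "\<rho>' \<in> Mor K" by (rule \<rho>')
    fix a b assume ab: "a \<in> Mor K" "b \<in> Mor K" "tgt K a = src K \<rho>' \<and> tgt K b = src K \<rho>' \<and> a \<cdot> \<rho>' = b \<cdot> \<rho>'"
    have "(w \<cdot> \<rho>') \<cdot> l = w" if "w \<in> Mor K" "tgt K w = src K \<rho>'" for w
      using that \<rho>' by simp
    then show "a = b" using ab by metis
  qed
  ultimately have m: "mono_DOF \<rho>'" by (simp add: mono_DOF_def)
  obtain k where k: "mono_DOF k" "tgt K k = src K u"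
    "\<And>y. \<lbrakk>y \<in> Mor K; tgt K y = src K u\<rbrakk> \<Longrightarrow> factors_through y k = factors_through (y \<cdot> \<rho>) \<rho>'"
    using mono_DOF_sieve[OF m, of \<rho>] \<rho> \<rho>' by auto
  \<comment> \<open>If \<open>y \<cdot> \<rho>\<close> factors through \<rho>', composing with
    \<open>l\<close> forces the factor to be \<open>y\<close>, so the two sections agree after
    \<open>y\<close>.\<close>
  have "factors_through (y \<cdot> \<rho>) \<rho>' \<longleftrightarrow> y \<cdot> r = y \<cdot> r'" if y: "y \<in> Mor K" "tgt K y = src K u" for y
  proof
    assume "factors_through (y \<cdot> \<rho>) \<rho>'"
    then obtain v where v: "v \<in> Mor K" "tgt K v = src K \<rho>'" "v \<cdot> \<rho>' = y \<cdot> \<rho>"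
      by (auto simp: factors_through_def)
    have "(v \<cdot> \<rho>') \<cdot> l = v" "(v \<cdot> \<rho>') \<cdot> t = v \<cdot> r'" "(y \<cdot> \<rho>) \<cdot> l = y" "(y \<cdot> \<rho>) \<cdot> t = y \<cdot> r"
      using v(1,2) y \<rho> \<rho>' by simp_all
    then show "y \<cdot> r = y \<cdot> r'" using v(3) by metis
  next
    assume yr: "y \<cdot> r = y \<cdot> r'"
    have "y \<cdot> \<rho>' = y \<cdot> \<rho>"
      by (rule pb_point_eq[OF P]) (use y \<rho> \<rho>' yr in simp_all)
    then show "factors_through (y \<cdot> \<rho>) \<rho>'" using y \<rho>' by (auto simp: factors_through_def)
  qed
  then show thesis using that[of k] k by simp
qed

text \<open>The two images of the universal element of \<open>f\<close> are elements of
  \<open>h\<close> at stage \<open>l\<close>; the sieve on which they agree is given by a mono DOF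
  into the source of \<open>l\<close>, that is, by a subobject of \<open>f\<close>.\<close>

lemma pointwise_equalizer:
  assumes f: "f \<in> Mor K" "tgt K f = S" and gd: "\<gamma> \<in> cells f h" "\<delta> \<in> cells f h"
  obtains n x where "pointwise_mono n" "n \<in> cells x f"
    "\<And>y s. \<lbrakk>y \<in> Mor K; tgt K y = src K f; s \<in> El (y \<cdot> f)\<rbrakk> \<Longrightarrow> s \<in> img y n \<longleftrightarrow> ev y \<gamma> s = ev y \<delta> s"
proof -
  obtain l t where P: "pb_along K p f l t" using pb_exists f by blast
  note D = pb_simps[OF P]
  have h: "h \<in> Mor K" "src K h = src K f" "tgt K h = S" using gd f by (auto simp: cells_def)
  have e: "ev l \<gamma> t \<in> El (l \<cdot> h)" "ev l \<delta> t \<in> El (l \<cdot> h)"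
    by (rule cells_El[OF gd(1)] cells_El[OF gd(2)]; use D in simp)+
  obtain k where k: "mono_DOF k" "tgt K k = src K l"
    "\<And>y. \<lbrakk>y \<in> Mor K; tgt K y = src K l\<rbrakk> \<Longrightarrow> factors_through y k \<longleftrightarrow> y \<cdot> ev l \<gamma> t = y \<cdot> ev l \<delta> t"
    using El_equalizer[OF _ _ e] D h by auto
  obtain n x where n: "pointwise_mono n" "n \<in> cells x f"
    "\<And>v. \<lbrakk>v \<in> Mor K; tgt K v = src K l\<rbrakk> \<Longrightarrow> v \<cdot> t \<in> img (v \<cdot> l) n \<longleftrightarrow> factors_through v k"
    using subobject_of_mono_DOF[OF P k(1,2)] by blast
  show thesis
  proof (rule that[OF n(1,2)])
    fix y s assume y: "y \<in> Mor K" "tgt K y = src K f" "s \<in> El (y \<cdot> f)"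
    obtain v where v: "v \<in> Mor K" "tgt K v = src K l" "v \<cdot> l = y" "v \<cdot> t = s"
      using pb_point[OF P y] by blast
    show "s \<in> img y n \<longleftrightarrow> ev y \<gamma> s = ev y \<delta> s"
      using cells_ev_comp1[OF gd(1), of l t v] cells_ev_comp1[OF gd(2), of l t v] n(3)[of v] k(3)[of v] v D
      by simp
  qed
qed

definition pointwise_product :: "'m \<Rightarrow> 'm \<Rightarrow> 'm \<Rightarrow> 'c \<Rightarrow> 'c \<Rightarrow> bool" where
  "pointwise_product f h q \<pi>\<^sub>1 \<pi>\<^sub>2 \<longleftrightarrow> \<pi>\<^sub>1 \<in> cells q f \<and> \<pi>\<^sub>2 \<in> cells q h \<and> tgt K q = S \<and>
    (\<forall>x\<in>Mor K. tgt K x = src K q \<longrightarrow> (\<forall>s\<in>El (x \<cdot> f). \<forall>s'\<in>El (x \<cdot> h).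
      \<exists>!r. r \<in> El (x \<cdot> q) \<and> ev x \<pi>\<^sub>1 r = s \<and> ev x \<pi>\<^sub>2 r = s'))"

text \<open>A pair of elements is an element of \<open>f\<close> followed by an element of the
  restriction of \<open>h\<close> to the stage \<open>l\<close>. The two pullbacks of
  \<open>p\<close> are small, and closure of small morphisms under composition yields
  \<open>q\<close>.\<close>

lemma pointwise_product_exists:
  assumes f: "f \<in> Mor K" "tgt K f = S" and h: "h \<in> Mor K" "src K h = src K f" "tgt K h = S"
  obtains q \<pi>\<^sub>1 \<pi>\<^sub>2 where "pointwise_product f h q \<pi>\<^sub>1 \<pi>\<^sub>2"
proof -
  obtain l t where P: "pb_along K p f l t" using pb_exists f by blast
  note D [simp] = pb_simps(1-7)[OF P]
  have "l \<cdot> h \<in> Mor K" "tgt K (l \<cdot> h) = S" using h by simp_all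
  then obtain l' t' where Q: "pb_along K p (l \<cdot> h) l' t'" using pb_exists by blast
  note E = pb_simps[OF Q]
  have tl': "tgt K l' = src K l" using E h by simp
  have "small_morphism K p l'" using Q by (auto simp: small_morphism_def)
  then obtain q u where R: "pb_along K p q (l' \<cdot> l) u"
    using small_comp1[OF P] tl' by blast
  note F = pb_simps[OF R]
  have sq: "src K q = src K f" using F E tl' by simp
  have "l' \<cdot> t \<in> El ((l' \<cdot> l) \<cdot> f)" using pb_El[OF P, of l'] E tl' by simp
  then obtain \<pi>\<^sub>1 where p1: "\<pi>\<^sub>1 \<in> cells q f" "ev (l' \<cdot> l) \<pi>\<^sub>1 u = l' \<cdot> t"
    using generic_obtain[OF R, of f "l' \<cdot> t"] f sq by auto
  have "t' \<in> El ((l' \<cdot> l) \<cdot> h)" using E h tl' by simp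
  then obtain \<pi>\<^sub>2 where p2: "\<pi>\<^sub>2 \<in> cells q h" "ev (l' \<cdot> l) \<pi>\<^sub>2 u = t'"
    using generic_obtain[OF R, of h t'] h sq by auto
  have ev1: "ev (v \<cdot> (l' \<cdot> l)) \<pi>\<^sub>1 (v \<cdot> u) = v \<cdot> (l' \<cdot> t)"
    and ev2: "ev (v \<cdot> (l' \<cdot> l)) \<pi>\<^sub>2 (v \<cdot> u) = v \<cdot> t'" if "v \<in> Mor K" "tgt K v = src K l'" for v
    using cells_ev_comp1[OF p1(1), of "l' \<cdot> l" u v] cells_ev_comp1[OF p2(1), of "l' \<cdot> l" u v]
      F E p1 p2 that tl' by simp_all
  have "pointwise_product f h q \<pi>\<^sub>1 \<pi>\<^sub>2"
    unfolding pointwise_product_def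
  proof (intro conjI ballI impI)
    show "\<pi>\<^sub>1 \<in> cells q f" "\<pi>\<^sub>2 \<in> cells q h" "tgt K q = S" using p1 p2 F by simp_all
    fix x s s' assume a: "x \<in> Mor K" "tgt K x = src K q" "s \<in> El (x \<cdot> f)" "s' \<in> El (x \<cdot> h)"
    obtain v0 where v0: "v0 \<in> Mor K" "tgt K v0 = src K l" "v0 \<cdot> l = x" "v0 \<cdot> t = s"
      using pb_point[OF P, of x s] a sq by auto
    have "v0 \<cdot> (l \<cdot> h) = x \<cdot> h" using v0 h comp1_assoc[of v0 l h] by simp
    then obtain v where v: "v \<in> Mor K" "tgt K v = src K l'" "v \<cdot> l' = v0" "v \<cdot> t' = s'"
      using pb_point[OF Q, of v0 s'] v0 a h by auto
    have vx: "v \<cdot> (l' \<cdot> l) = x" "v \<cdot> (l' \<cdot> t) = s"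
      using v v0 E tl' comp1_assoc[of v l' l] comp1_assoc[of v l' t] by simp_all
    show "\<exists>!r. r \<in> El (x \<cdot> q) \<and> ev x \<pi>\<^sub>1 r = s \<and> ev x \<pi>\<^sub>2 r = s'"
    proof (intro ex1I conjI)
      show "v \<cdot> u \<in> El (x \<cdot> q)" using pb_El[OF R, of v] v vx E tl' by simp
      show "ev x \<pi>\<^sub>1 (v \<cdot> u) = s" "ev x \<pi>\<^sub>2 (v \<cdot> u) = s'" using ev1[of v] ev2[of v] v vx by simp_all
      fix r assume r: "r \<in> El (x \<cdot> q) \<and> ev x \<pi>\<^sub>1 r = s \<and> ev x \<pi>\<^sub>2 r = s'"
      then obtain v' where v': "v' \<in> Mor K" "tgt K v' = src K (l' \<cdot> l)" "v' \<cdot> (l' \<cdot> l) = x" "v' \<cdot> u = r"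
        using pb_point[OF R a(1,2)] by blast
      then have [simp]: "tgt K v' = src K l'" using E tl' by simp
      have vv: "v' \<cdot> (l' \<cdot> t) = s" "v' \<cdot> t' = s'" using ev1[of v'] ev2[of v'] v' r by simp_all
      have "(v' \<cdot> l') \<cdot> l = v0 \<cdot> l" "(v' \<cdot> l') \<cdot> t = v0 \<cdot> t"
        unfolding v0(3,4) using v'(1,3) vv(1) E(3) tl' by simp_all
      then have vl: "v' \<cdot> l' = v0"
        using pb_point_eq[OF P, of "v' \<cdot> l'" v0] v'(1) v0(1,2) E(3) tl' by simp
      have "v' = v"
        using pb_point_eq[OF Q, of v' v] v' v vl vv(2) by simp
      then show "r = v \<cdot> u" using v' by simp
    qed
  qed
  then show thesis by (rule that)
qed

text \<open>An identity is a mono DOF, hence small, and a morphism along which \<open>p\<close>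
  pulls back to an identity has one element at each stage.\<close>

lemma pointwise_terminal_exists:
  assumes A: "A \<in> Obj K"
  obtains f where "f \<in> hom1 K A S" "\<And>x. \<lbrakk>x \<in> Mor K; tgt K x = A\<rbrakk> \<Longrightarrow> \<exists>!s. s \<in> El (x \<cdot> f)"
proof -
  obtain f t where P: "pb_along K p f (id1 K A) t"
    using mono_DOF_small[OF mono_DOF_id1[OF A]] unfolding small_morphism_def by blast
  note D = pb_simps[OF P]
  have sf: "src K f = A" using D A by simp
  have "\<exists>!s. s \<in> El (x \<cdot> f)" if x: "x \<in> Mor K" "tgt K x = A" for x
  proof (rule ex1I[of _ "x \<cdot> t"])
    show "x \<cdot> t \<in> El (x \<cdot> f)" using pb_El[OF P x(1)] x A by simp
    fix s assume "s \<in> El (x \<cdot> f)"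
    then obtain v where "v \<in> Mor K" "tgt K v = src K (id1 K A)" "v \<cdot> id1 K A = x" "v \<cdot> t = s"
      using pb_point[OF P, of x s] x sf by auto
    then show "s = x \<cdot> t" using A by simp
  qed
  then show thesis using that[of f] D sf by (simp add: hom1_iff)
qed

end

section \<open>Bipullbacks\<close>

lemma is_functor_comp:
  "\<lbrakk>is_functor A B F; is_functor B C G\<rbrakk> \<Longrightarrow> is_functor A C (comp_funct F G)"
  unfolding is_functor_def comp_funct_def by (auto simp: hom_def)

lemma cat_equivalence_ess_surj:
  assumes "cat_equivalence C D F" "d \<in> Ob D"
  obtains x e where "x \<in> Ob C" "e \<in> hom D (FO F x) d" "is_iso D e"
proof -
  obtain G \<eta> \<epsilon> where "is_functor D C G" "natural_iso D D (comp_funct G F) id_funct \<epsilon>"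
    using assms unfolding cat_equivalence_def by blast
  then show thesis
    using that[of "FO G d" "\<epsilon> d"] assms(2)
    by (simp add: is_functor_def natural_iso_def comp_funct_def id_funct_def)
qed

text \<open>The preimage is \<open>G g\<close> conjugated by the unit. Naturality of \<eta> gives
  only that \<open>F w\<close> and \<open>g\<close> agree under \<open>G\<close>, so faithfulness of
  \<open>G\<close> is established as well; it comes from \<epsilon>.\<close>

lemma cat_equivalence_full:
  assumes C: "category C" and D: "category D" and F: "cat_equivalence C D F"
    and xy: "x \<in> Ob C" "y \<in> Ob C" and g: "g \<in> hom D (FO F x) (FO F y)"
  obtains w where "w \<in> hom C x y" "FA F w = g"
proof -
  interpret C: category C by (rule C)
  interpret D: category D by (rule D)
  obtain G \<eta> \<epsilon> where FF: "is_functor C D F" and GF: "is_functor D C G"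
    and \<eta>: "natural_iso C C id_funct (comp_funct F G) \<eta>"
    and \<epsilon>: "natural_iso D D (comp_funct G F) id_funct \<epsilon>"
    using F unfolding cat_equivalence_def by blast
  have G_inj: "h = h'" if h: "h \<in> hom D a b" "h' \<in> hom D a b" "FA G h = FA G h'" for a b h h'
  proof -
    have a: "a \<in> Ob D" "b \<in> Ob D" using h D.dom_in D.cod_in by (auto simp: hom_def)
    have nat: "FA F (FA G k) \<bullet>\<^bsub>D\<^esub> \<epsilon> b = \<epsilon> a \<bullet>\<^bsub>D\<^esub> k" if "k \<in> hom D a b" for k
      using \<epsilon> that by (auto simp: natural_iso_def comp_funct_def id_funct_def hom_def)
    have e: "\<epsilon> a \<in> Ar D" "Cod D (\<epsilon> a) = a" "is_iso D (\<epsilon> a)"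
      using \<epsilon> a by (auto simp: natural_iso_def comp_funct_def id_funct_def hom_def)
    then obtain i where i: "i \<in> Ar D" "Dom D i = a" "Cod D i = Dom D (\<epsilon> a)" "i \<bullet>\<^bsub>D\<^esub> \<epsilon> a = Idn D a"
      by (auto simp: is_iso_def hom_def)
    have "k = i \<bullet>\<^bsub>D\<^esub> (\<epsilon> a \<bullet>\<^bsub>D\<^esub> k)" if "k \<in> hom D a b" for k
      using D.cmp_assoc[of i "\<epsilon> a" k] D.idn_left[of k] i e that by (simp add: hom_def)
    then show ?thesis using nat[OF h(1)] nat[OF h(2)] h by metis
  qed
  have ob: "FO F x \<in> Ob D" "FO F y \<in> Ob D" using FF xy by (auto simp: is_functor_def)
  have e: "\<eta> z \<in> hom C z (FO G (FO F z)) \<and> is_iso C (\<eta> z)" if "z \<in> Ob C" for z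
    using \<eta> that by (auto simp: natural_iso_def comp_funct_def id_funct_def)
  obtain i where i: "i \<in> Ar C" "Dom C i = FO G (FO F x)" "Cod C i = x" "i \<bullet>\<^bsub>C\<^esub> \<eta> x = Idn C (FO G (FO F x))"
    using e[OF xy(1)] by (auto simp: is_iso_def hom_def)
  obtain i' where i': "i' \<in> Ar C" "Dom C i' = FO G (FO F y)" "Cod C i' = y" "i' \<bullet>\<^bsub>C\<^esub> \<eta> y = Idn C (FO G (FO F y))"
    using e[OF xy(2)] by (auto simp: is_iso_def hom_def)
  have ex: "\<eta> x \<in> Ar C" "Dom C (\<eta> x) = x" "Cod C (\<eta> x) = FO G (FO F x)"
    and ey: "\<eta> y \<in> Ar C" "Dom C (\<eta> y) = y" "Cod C (\<eta> y) = FO G (FO F y)"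
    using e xy by (auto simp: hom_def)
  have Gg: "FA G g \<in> Ar C" "Dom C (FA G g) = FO G (FO F x)" "Cod C (FA G g) = FO G (FO F y)"
    using GF g by (auto simp: is_functor_def hom_def)
  define w where "w = \<eta> x \<bullet>\<^bsub>C\<^esub> (FA G g \<bullet>\<^bsub>C\<^esub> i')"
  have gi: "FA G g \<bullet>\<^bsub>C\<^esub> i' \<in> Ar C" "Dom C (FA G g \<bullet>\<^bsub>C\<^esub> i') = FO G (FO F x)" "Cod C (FA G g \<bullet>\<^bsub>C\<^esub> i') = y"
    using Gg i' by (simp_all add: C.cmp_in C.dom_cmp C.cod_cmp)
  have w: "w \<in> hom C x y"
    using gi ex by (simp add: w_def hom_def C.cmp_in C.dom_cmp C.cod_cmp)
  have Fw: "FA F w \<in> hom D (FO F x) (FO F y)" using FF w by (auto simp: is_functor_def hom_def)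
  then have GFw: "FA G (FA F w) \<in> Ar C" "Dom C (FA G (FA F w)) = FO G (FO F x)"
    using GF by (auto simp: is_functor_def hom_def)
  have "w \<bullet>\<^bsub>C\<^esub> \<eta> y = \<eta> x \<bullet>\<^bsub>C\<^esub> ((FA G g \<bullet>\<^bsub>C\<^esub> i') \<bullet>\<^bsub>C\<^esub> \<eta> y)"
    unfolding w_def by (rule C.cmp_assoc) (use gi ex ey in simp_all)
  also have "(FA G g \<bullet>\<^bsub>C\<^esub> i') \<bullet>\<^bsub>C\<^esub> \<eta> y = FA G g"
    using C.cmp_assoc[of "FA G g" i' "\<eta> y"] Gg i' ey C.idn_right[of "FA G g"] by simp
  finally have 1: "w \<bullet>\<^bsub>C\<^esub> \<eta> y = \<eta> x \<bullet>\<^bsub>C\<^esub> FA G g" .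
  have 2: "w \<bullet>\<^bsub>C\<^esub> \<eta> y = \<eta> x \<bullet>\<^bsub>C\<^esub> FA G (FA F w)"
    using \<eta> w by (auto simp: natural_iso_def comp_funct_def id_funct_def hom_def)
  have canc: "k = i \<bullet>\<^bsub>C\<^esub> (\<eta> x \<bullet>\<^bsub>C\<^esub> k)" if "k \<in> Ar C" "Dom C k = FO G (FO F x)" for k
    using C.cmp_assoc[of i "\<eta> x" k] i ex that C.idn_left[of k] by simp
  have "FA G g = FA G (FA F w)"
    using canc[OF Gg(1,2)] canc[OF GFw] 1 2 by simp
  then have "FA F w = g" using G_inj[OF Fw g] by simp
  with w show thesis by (rule that)
qed

lemma category_iso_comma:
  assumes C: "category C" and D: "category D" and E: "category E"
    and F: "is_functor C E F" and G: "is_functor D E G"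
  shows "category (iso_comma C D E F G)"
proof -
  interpret C: category C by (rule C)
  interpret D: category D by (rule D)
  interpret E: category E by (rule E)
  have Fh: "FA F u \<in> Ar E" "Dom E (FA F u) = FO F (Dom C u)" "Cod E (FA F u) = FO F (Cod C u)" if "u \<in> Ar C" for u
    using F that by (auto simp: is_functor_def hom_def)
  have Gh: "FA G u \<in> Ar E" "Dom E (FA G u) = FO G (Dom D u)" "Cod E (FA G u) = FO G (Cod D u)" if "u \<in> Ar D" for u
    using G that by (auto simp: is_functor_def hom_def)
  have Fi: "FA F (Idn C x) = Idn E (FO F x)" if "x \<in> Ob C" for x using F that by (auto simp: is_functor_def)
  have Gi: "FA G (Idn D x) = Idn E (FO G x)" if "x \<in> Ob D" for x using G that by (auto simp: is_functor_def)
  have idl: "c \<bullet>\<^bsub>E\<^esub> Idn E b = Idn E a \<bullet>\<^bsub>E\<^esub> c" if "c \<in> hom E a b" for a b c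
    using that E.idn_left[of c] E.idn_right[of c] by (simp add: hom_def)
  have comp: "c \<bullet>\<^bsub>E\<^esub> FA G (v \<bullet>\<^bsub>D\<^esub> v') = FA F (u \<bullet>\<^bsub>C\<^esub> u') \<bullet>\<^bsub>E\<^esub> c''"
    if c: "c \<in> hom E (FO F x) (FO G y)" "c' \<in> hom E (FO F x') (FO G y')" "c'' \<in> hom E (FO F x'') (FO G y'')"
      and u: "u \<in> hom C x x'" "u' \<in> hom C x' x''" and v: "v \<in> hom D y y'" "v' \<in> hom D y' y''"
      and e: "c \<bullet>\<^bsub>E\<^esub> FA G v = FA F u \<bullet>\<^bsub>E\<^esub> c'" "c' \<bullet>\<^bsub>E\<^esub> FA G v' = FA F u' \<bullet>\<^bsub>E\<^esub> c''"
    for c c' c'' x x' x'' y y' y'' u u' v v'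
  proof -
    have "FA G (v \<bullet>\<^bsub>D\<^esub> v') = FA G v \<bullet>\<^bsub>E\<^esub> FA G v'" "FA F (u \<bullet>\<^bsub>C\<^esub> u') = FA F u \<bullet>\<^bsub>E\<^esub> FA F u'"
      using F G u v by (auto simp: is_functor_def hom_def)
    moreover have "c \<bullet>\<^bsub>E\<^esub> (FA G v \<bullet>\<^bsub>E\<^esub> FA G v') = (c \<bullet>\<^bsub>E\<^esub> FA G v) \<bullet>\<^bsub>E\<^esub> FA G v'"
      "(FA F u \<bullet>\<^bsub>E\<^esub> c') \<bullet>\<^bsub>E\<^esub> FA G v' = FA F u \<bullet>\<^bsub>E\<^esub> (c' \<bullet>\<^bsub>E\<^esub> FA G v')"
      "FA F u \<bullet>\<^bsub>E\<^esub> (FA F u' \<bullet>\<^bsub>E\<^esub> c'') = (FA F u \<bullet>\<^bsub>E\<^esub> FA F u') \<bullet>\<^bsub>E\<^esub> c''"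
      using c u v by (simp_all add: hom_def E.cmp_assoc Fh Gh)
    ultimately show ?thesis using e by simp
  qed
  show ?thesis
  proof (unfold_locales, goal_cases)
    case (3 a)
    then show ?case
      by (auto simp: iso_comma_def Let_def hom_def[of C] hom_def[of D] C.idn_in D.idn_in C.dom_idn C.cod_idn
          D.dom_idn D.cod_idn Fi Gi idl)
  next
    case (6 f g)
    then show ?case
      by (auto simp: iso_comma_def Let_def intro: comp)
        (auto simp: hom_def C.cmp_in C.dom_cmp C.cod_cmp D.cmp_in D.dom_cmp D.cod_cmp)
  qed (auto simp: iso_comma_def Let_def hom_def C.idn_left D.idn_left C.idn_right D.idn_right C.cmp_assoc D.cmp_assoc)
qed

lemma Ob_iso_comma:
  "(x, y, c) \<in> Ob (iso_comma C D E F G) \<longleftrightarrow>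
    x \<in> Ob C \<and> y \<in> Ob D \<and> c \<in> hom E (FO F x) (FO G y) \<and> is_iso E c"
  by (simp add: iso_comma_def Let_def)

lemma hom_iso_comma:
  "\<phi> \<in> hom (iso_comma C D E F G) (x, y, c) (x', y', c') \<longleftrightarrow>
    (x, y, c) \<in> Ob (iso_comma C D E F G) \<and> (x', y', c') \<in> Ob (iso_comma C D E F G) \<and>
    (\<exists>u\<in>hom C x x'. \<exists>v\<in>hom D y y'. \<phi> = ((x, y, c), (u, v), (x', y', c')) \<and>
      c \<bullet>\<^bsub>E\<^esub> FA G v = FA F u \<bullet>\<^bsub>E\<^esub> c')"
  unfolding hom_def[of "iso_comma C D E F G"] by (auto simp: iso_comma_def Let_def)

lemma Cmp_iso_comma:
  "(a, (u, v), b) \<bullet>\<^bsub>iso_comma C D E F G\<^esub> (b', (u', v'), d) = (a, (u \<bullet>\<^bsub>C\<^esub> u', v \<bullet>\<^bsub>D\<^esub> v'), d)"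
  and Idn_iso_comma: "Idn (iso_comma C D E F G) (x, y, c) = ((x, y, c), (Idn C x, Idn D y), (x, y, c))"
  by (simp_all add: iso_comma_def Let_def)

context two_category
begin

lemma is_functor_post:
  assumes "f \<in> Mor K" "src K f = X" "tgt K f = Y"
  shows "is_functor (Hom K A X) (Hom K A Y) (post K f)"
  unfolding is_functor_def using assms
  by (auto simp: post_def hom1_iff hom_Hom rwhisker_vcomp)

lemma is_functor_pre:
  assumes "f \<in> hom1 K A' A"
  shows "is_functor (Hom K A X) (Hom K A' X) (pre K f)"
  unfolding is_functor_def using assms
  by (auto simp: pre_def hom1_iff hom_Hom lwhisker_vcomp)

lemma bipullbackD:
  assumes "bipullback K f g h k \<theta>"
  shows "f \<in> Mor K" "g \<in> Mor K" "h \<in> Mor K" "k \<in> Mor K" "tgt K f = tgt K g"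
    "src K k = src K h" "tgt K h = src K f" "tgt K k = src K g" "\<theta> \<in> cells (h \<cdot> f) (k \<cdot> g)"
    "\<exists>\<theta>'. invertible2 \<theta> \<theta>'"
  using assms by (auto simp: bipullback_def square_boundary_def hom_Hom cells_def is_iso_Hom)

text \<open>A strictly commuting square is an object of the iso-comma category with identity 2-cell.
  The final equation is the compatibility of the isomorphism of triples, from which that identity
  disappears.\<close>

lemma bipullback_ess_surj:
  assumes P: "bipullback K f g h k \<theta>" and a: "a \<in> Mor K" "tgt K a = src K f"
    and s: "s \<in> Mor K" "tgt K s = src K g" "a \<cdot> f = s \<cdot> g"
  obtains e u v u' v' where "e \<in> Mor K" "tgt K e = src K h" "src K e = src K a"
    "u \<in> cells (e \<cdot> h) a" "v \<in> cells (e \<cdot> k) s"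
    "invertible2 u u'" "invertible2 v v'" "(e \<rhd> \<theta>) \<odot> (v \<lhd> g) = u \<lhd> f"
proof -
  note D = bipullbackD[OF P]
  have ss: "src K s = src K a" using a s D src_comp1 by metis
  let ?B = "src K a"
  let ?D = "iso_comma (Hom K ?B (src K f)) (Hom K ?B (src K g)) (Hom K ?B (tgt K f)) (post K f) (post K g)"
  let ?T = "\<lambda>b. (b \<cdot> h, b \<cdot> k, b \<rhd> \<theta>)"
  let ?F = "\<lparr>FO = ?T, FA = (\<lambda>\<beta>. (?T (dom2 K \<beta>), (\<beta> \<lhd> h, \<beta> \<lhd> k), ?T (cod2 K \<beta>)))\<rparr>"
  have eq: "cat_equivalence (Hom K ?B (src K h)) ?D ?F"
    using P a by (simp add: bipullback_def Let_def)
  have "invertible2 (id2 K (s \<cdot> g)) (id2 K (s \<cdot> g))"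
    using s D by (simp add: invertible2_def)
  then have ob: "(a, s, id2 K (s \<cdot> g)) \<in> Ob ?D"
    using a s D(1-8) ss by (auto simp: Ob_iso_comma hom1_iff post_def hom_Hom is_iso_Hom)
  obtain e \<epsilon> where "e \<in> Ob (Hom K ?B (src K h))"
    "\<epsilon> \<in> hom ?D (FO ?F e) (a, s, id2 K (s \<cdot> g))" and iso: "is_iso ?D \<epsilon>"
    by (rule cat_equivalence_ess_surj[OF eq ob])
  then have e: "e \<in> hom1 K ?B (src K h)" "\<epsilon> \<in> hom ?D (?T e) (a, s, id2 K (s \<cdot> g))"
    by simp_all
  obtain u v where uv: "\<epsilon> = (?T e, (u, v), (a, s, id2 K (s \<cdot> g)))"
    and u: "u \<in> cells (e \<cdot> h) a" and v: "v \<in> cells (e \<cdot> k) s"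
    and sq: "(e \<rhd> \<theta>) \<odot> (v \<lhd> g) = (u \<lhd> f) \<odot> id2 K (s \<cdot> g)"
    using e(2) unfolding hom_iso_comma by (auto simp: post_def hom_Hom cells_def)
  obtain \<epsilon>' where \<epsilon>': "\<epsilon>' \<in> hom ?D (a, s, id2 K (s \<cdot> g)) (?T e)"
    "\<epsilon> \<bullet>\<^bsub>?D\<^esub> \<epsilon>' = Idn ?D (?T e)" "\<epsilon>' \<bullet>\<^bsub>?D\<^esub> \<epsilon> = Idn ?D (a, s, id2 K (s \<cdot> g))"
  proof -
    have "Dom ?D \<epsilon> = ?T e" "Cod ?D \<epsilon> = (a, s, id2 K (s \<cdot> g))" using e(2) by (simp_all add: hom_def[of ?D])
    then show thesis using iso that unfolding is_iso_def by metis
  qed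
  obtain u' v' where uv': "\<epsilon>' = ((a, s, id2 K (s \<cdot> g)), (u', v'), ?T e)"
    and u': "u' \<in> cells a (e \<cdot> h)" and v': "v' \<in> cells s (e \<cdot> k)"
    using \<epsilon>'(1) unfolding hom_iso_comma by (auto simp: hom_Hom cells_def)
  have "u \<odot> u' = id2 K (e \<cdot> h)" "u' \<odot> u = id2 K a" "v \<odot> v' = id2 K (e \<cdot> k)" "v' \<odot> v = id2 K s"
    using \<epsilon>'(2,3) unfolding uv uv' by (simp_all add: Cmp_iso_comma Idn_iso_comma)
  then have "invertible2 u u'" "invertible2 v v'"
    using u v u' v' by (simp_all add: cells_invertible2)
  moreover have "(u \<lhd> f) \<odot> id2 K (s \<cdot> g) = u \<lhd> f"
    using u D a s e(1) by (intro vcomp_id2) (auto simp: cells_def hom1_iff)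
  ultimately show thesis
    using that[of e u v u' v'] e(1) u v sq by (simp add: hom1_iff)
qed

text \<open>Fullness of the comparison functor. Invertibility of \<open>w\<close> is left open: in
  the application it comes from the core in which the 2-cell lives.\<close>

lemma bipullback_full:
  assumes P: "bipullback K f g h k \<theta>" and e: "e \<in> Mor K" "tgt K e = src K h"
    and e': "e' \<in> Mor K" "tgt K e' = src K h" "src K e' = src K e"
    and u: "u \<in> cells (e \<cdot> h) (e' \<cdot> h)" and v: "v \<in> cells (e \<cdot> k) (e' \<cdot> k)"
    and sq: "(e \<rhd> \<theta>) \<odot> (v \<lhd> g) = (u \<lhd> f) \<odot> (e' \<rhd> \<theta>)"
  obtains w where "w \<in> cells e e'" "w \<lhd> h = u" "w \<lhd> k = v"
proof -
  note D = bipullbackD[OF P]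
  let ?B = "src K e"
  let ?D = "iso_comma (Hom K ?B (src K f)) (Hom K ?B (src K g)) (Hom K ?B (tgt K f)) (post K f) (post K g)"
  let ?T = "\<lambda>b. (b \<cdot> h, b \<cdot> k, b \<rhd> \<theta>)"
  let ?F = "\<lparr>FO = ?T, FA = (\<lambda>\<beta>. (?T (dom2 K \<beta>), (\<beta> \<lhd> h, \<beta> \<lhd> k), ?T (cod2 K \<beta>)))\<rparr>"
  have eq: "cat_equivalence (Hom K ?B (src K h)) ?D ?F"
    using P e by (simp add: bipullback_def Let_def)
  have D_cat: "category ?D"
    by (intro category_iso_comma category_Hom is_functor_post) (use D in simp_all)
  have T: "?T b \<in> Ob ?D" if b: "b \<in> Mor K" "tgt K b = src K h" "src K b = ?B" for b
  proof -
    obtain \<theta>' where "invertible2 \<theta> \<theta>'" using D by blast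
    then have "invertible2 (b \<rhd> \<theta>) (b \<rhd> \<theta>')"
      by (rule invertible2_lwhisker) (use b D in \<open>auto simp: cells_def\<close>)
    then show ?thesis
      using b D(1-9) by (auto simp: Ob_iso_comma post_def hom_Hom hom1_iff is_iso_Hom cells_def)
  qed
  have "(?T e, (u, v), ?T e') \<in> hom ?D (?T e) (?T e')"
    unfolding hom_iso_comma
  proof (intro conjI bexI)
    show "?T e \<in> Ob ?D" "?T e' \<in> Ob ?D" using T e e' by blast+
    show "u \<in> hom (Hom K ?B (src K f)) (e \<cdot> h) (e' \<cdot> h)" "v \<in> hom (Hom K ?B (src K g)) (e \<cdot> k) (e' \<cdot> k)"
      using u v e D(1-8) by (simp_all add: hom_Hom cells_def)
  qed (use sq in \<open>simp_all add: post_def\<close>)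
  then have "(?T e, (u, v), ?T e') \<in> hom ?D (FO ?F e) (FO ?F e')" by simp
  from cat_equivalence_full[OF category_Hom D_cat eq _ _ this] obtain w
    where "w \<in> hom (Hom K ?B (src K h)) e e'" "FA ?F w = (?T e, (u, v), ?T e')"
    using e e' by (auto simp: hom1_iff)
  then show thesis using that[of w] by (auto simp: hom_Hom cells_def)
qed

section \<open>Cores and monomorphism objects\<close>

lemma is_coreD:
  assumes "is_core K X Xi i"
  shows "i \<in> Mor K" "src K i = Xi" "tgt K i = X" "arrowwise_iso K i"
  using assms by (auto simp: is_core_def hom1_iff)

lemma arrowwise_iso_D:
  "\<lbrakk>arrowwise_iso K f; \<alpha> \<in> Cell K; tgt K (dom2 K \<alpha>) = src K f\<rbrakk> \<Longrightarrow> \<exists>\<beta>. invertible2 (\<alpha> \<lhd> f) \<beta>"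
  unfolding arrowwise_iso_def is_iso_Hom by (metis Ar_Hom dom2_Mor src_Obj)

lemma core_lift:
  assumes "is_core K X Xi i" "a \<in> Mor K" "tgt K a = X" "arrowwise_iso K a"
  obtains b where "b \<in> Mor K" "src K b = src K a" "tgt K b = Xi" "b \<cdot> i = a"
proof -
  have "bij_betw (FO (post K i)) (Ob (Hom K (src K a) Xi)) (Ob (arrowwise_iso_subcat K (src K a) X))"
    using assms by (simp add: is_core_def cat_isomorphism_def)
  moreover have "a \<in> Ob (arrowwise_iso_subcat K (src K a) X)"
    using assms by (simp add: arrowwise_iso_subcat_def hom1_iff)
  ultimately obtain b where "b \<in> Ob (Hom K (src K a) Xi)" "FO (post K i) b = a"
    unfolding bij_betw_ex1 by blast
  then show thesis using that by (auto simp: hom1_iff post_def)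
qed

lemma core_eq:
  assumes "is_core K X Xi i" "b \<in> Mor K" "tgt K b = Xi" "b' \<in> Mor K" "tgt K b' = Xi" "b \<cdot> i = b' \<cdot> i"
  shows "b = b'"
proof -
  note D = is_coreD[OF assms(1)]
  have s: "src K b' = src K b" using assms D src_comp1 by metis
  have "inj_on (FO (post K i)) (Ob (Hom K (src K b) Xi))"
    using assms by (simp add: is_core_def cat_isomorphism_def bij_betw_def)
  then show ?thesis using assms s by (auto simp: hom1_iff post_def dest: inj_onD)
qed

lemma core_arrowwise_iso:
  assumes i: "is_core K X Xi i" and b: "b \<in> Mor K" "tgt K b = Xi"
  shows "arrowwise_iso K (b \<cdot> i)"
  unfolding arrowwise_iso_def
proof (intro conjI ballI)
  note D = is_coreD[OF i]
  show "b \<cdot> i \<in> Mor K" using b D by simp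
  fix B \<alpha> assume a: "B \<in> Obj K" "\<alpha> \<in> Ar (Hom K B (src K (b \<cdot> i)))"
  then have "\<exists>\<beta>. invertible2 ((\<alpha> \<lhd> b) \<lhd> i) \<beta>"
    using arrowwise_iso_D[OF D(4), of "\<alpha> \<lhd> b"] b D by simp
  then show "is_iso (Hom K B (tgt K (b \<cdot> i))) (\<alpha> \<lhd> (b \<cdot> i))"
    using a b D by (simp add: is_iso_Hom)
qed

lemma core_cells_eq:
  assumes i: "is_core K X Xi i" and w: "w \<in> cells b b'" "w' \<in> cells b b'" "w \<lhd> i = w' \<lhd> i"
    and b: "tgt K b = Xi"
  shows "w = w'"
proof -
  have "inj_on (FA (post K i)) (Ar (Hom K (src K b) Xi))"
    using cells_Mor[OF w(1)] i by (simp add: is_core_def cat_isomorphism_def bij_betw_def)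
  moreover have "w \<in> Ar (Hom K (src K b) Xi)" "w' \<in> Ar (Hom K (src K b) Xi)"
    using w b by (auto simp: cells_def)
  ultimately show ?thesis using w by (auto simp: post_def dest: inj_onD)
qed

lemma core_cells_lift:
  assumes i: "is_core K X Xi i" and b: "b \<in> Mor K" "tgt K b = Xi" "b' \<in> Mor K" "tgt K b' = Xi"
    and \<sigma>: "\<sigma> \<in> cells (b \<cdot> i) (b' \<cdot> i)" "invertible2 \<sigma> \<sigma>'"
  obtains w where "w \<in> cells b b'" "w \<lhd> i = \<sigma>"
proof -
  note D = is_coreD[OF i]
  have c: "dom2 K \<sigma> = b \<cdot> i" "cod2 K \<sigma> = b' \<cdot> i" using \<sigma> by (auto simp: cells_def)
  have "bij_betw (FA (post K i)) (Ar (Hom K (src K b) Xi)) (Ar (arrowwise_iso_subcat K (src K b) X))"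
    using b i by (simp add: is_core_def cat_isomorphism_def)
  moreover have "\<sigma> \<in> Ar (arrowwise_iso_subcat K (src K b) X)"
    using core_arrowwise_iso[OF i b(1,2)] core_arrowwise_iso[OF i b(3,4)] b D \<sigma> c
    by (auto simp: arrowwise_iso_subcat_def is_iso_Hom)
  ultimately obtain w where w: "w \<in> Ar (Hom K (src K b) Xi)" "FA (post K i) w = \<sigma>"
    unfolding bij_betw_ex1 by blast
  then have w': "w \<in> Cell K" "tgt K (dom2 K w) = Xi" "w \<lhd> i = \<sigma>" by (auto simp: post_def)
  then have "dom2 K w \<cdot> i = b \<cdot> i" "cod2 K w \<cdot> i = b' \<cdot> i"
    using c D dom2_rwhisker[of w i] cod2_rwhisker[of w i] by auto
  then have "dom2 K w = b" "cod2 K w = b'"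
    using core_eq[OF i] b w' by auto
  then show thesis using that[of w] w' by (auto simp: cells_def)
qed

text \<open>Since \<open>i\<close> is an arrow-wise isomorphism, \<open>w \<lhd> i\<close> has an
  inverse, which lifts along \<open>i\<close> because it is invertible; whiskering with
  \<open>i\<close> is injective, so the lift is inverse to \<open>w\<close>. Hence cores are
  groupoids.\<close>

lemma core_cells_invertible:
  assumes i: "is_core K X Xi i" and w: "w \<in> cells b b'" and b: "tgt K b = Xi"
  obtains w' where "invertible2 w w'"
proof -
  note D = is_coreD[OF i] and m = cells_Mor[OF w]
  obtain \<tau> where \<tau>: "invertible2 (w \<lhd> i) \<tau>"
    using arrowwise_iso_D[OF D(4), of w] w b D by (auto simp: cells_def)
  have wi: "w \<lhd> i \<in> cells (b \<cdot> i) (b' \<cdot> i)" by (rule cells_rwhisker[OF w]) (use D b in simp_all)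
  then have \<tau>c: "\<tau> \<in> cells (b' \<cdot> i) (b \<cdot> i)" using \<tau> by (simp add: cells_invertible2)
  obtain w' where w': "w' \<in> cells b' b" "w' \<lhd> i = \<tau>"
    using core_cells_lift[OF i _ _ _ _ \<tau>c invertible2_sym[OF \<tau>]] m b by auto
  have "(w \<odot> w') \<lhd> i = id2 K b \<lhd> i" "(w' \<odot> w) \<lhd> i = id2 K b' \<lhd> i"
    using \<tau> w w' D b m wi
    by (simp_all add: cells_invertible2[OF wi]) (auto simp: rwhisker_vcomp cells_def)
  then have "w \<odot> w' = id2 K b" "w' \<odot> w = id2 K b'"
    using core_cells_eq[OF i, of "w \<odot> w'" b b "id2 K b"] core_cells_eq[OF i, of "w' \<odot> w" b' b' "id2 K b'"]
      cells_vcomp[OF w w'(1)] cells_vcomp[OF w'(1) w] cells_id2 m b by simp_all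
  then show thesis using that[of w'] w w' by (simp add: cells_invertible2)
qed

lemma groupoid_arrowwise_iso:
  assumes A: "groupoid_object K A" and a: "a \<in> Mor K" "src K a = A"
  shows "arrowwise_iso K a"
  unfolding arrowwise_iso_def
proof (intro conjI ballI)
  show "a \<in> Mor K" by (rule a)
  fix B \<alpha> assume b: "B \<in> Obj K" "\<alpha> \<in> Ar (Hom K B (src K a))"
  then have "is_iso (Hom K B A) \<alpha>" using A a unfolding groupoid_object_def groupoid_def by metis
  then obtain \<beta> where "invertible2 \<alpha> \<beta>" by (auto simp: is_iso_Hom)
  from invertible2_rwhisker[OF this a(1)] show "is_iso (Hom K B (tgt K a)) (\<alpha> \<lhd> a)"
    using b a by (auto simp: is_iso_Hom)
qed

text \<open>Discrete opfibrations reflect invertible 2-cells. This allows the universal element of a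
  morphism out of a groupoid to serve as a stage in the test for power objects.\<close>

lemma groupoid_DOF:
  assumes l: "DOF K l" and A: "groupoid_object K (tgt K l)"
  shows "groupoid_object K (src K l)"
  unfolding groupoid_object_def groupoid_def
proof (intro conjI ballI)
  note [simp] = DOF_Mor[OF l]
  show "src K l \<in> Obj K" by simp
  fix B \<alpha> assume a: "B \<in> Obj K" "\<alpha> \<in> Ar (Hom K B (src K l))"
  then have "\<alpha> \<lhd> l \<in> Ar (Hom K B (tgt K l))" by simp
  then have "is_iso (Hom K B (tgt K l)) (\<alpha> \<lhd> l)"
    using A a(1) unfolding groupoid_object_def groupoid_def by blast
  then show "is_iso (Hom K B (src K l)) \<alpha>"
    using DOF_reflects_invertible[OF l, of \<alpha>] a by (auto simp: is_iso_Hom)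
qed

lemma mono_objectD:
  assumes "mono_object K X M d"
  shows "stable_mono K M X d" "d \<in> Cell K" "src K (dom2 K d) = M" "tgt K (dom2 K d) = X"
  using assms by (auto simp: mono_object_def stable_mono_def)

lemma mono_object_lift:
  assumes "mono_object K X M d" "A \<in> Obj K" "stable_mono K A X m"
  obtains e where "e \<in> Mor K" "src K e = A" "tgt K e = M" "e \<rhd> d = m"
proof -
  have "bij_betw (FO (post_cell K d)) (Ob (Hom K A M)) (Ob (full_subcat (arrow_cat (Hom K A X)) (stable_mono K A X)))"
    using assms by (simp add: mono_object_def cat_isomorphism_def)
  moreover have "m \<in> Ob (full_subcat (arrow_cat (Hom K A X)) (stable_mono K A X))"
    using assms by (simp add: full_subcat_def arrow_cat_def stable_mono_def)
  ultimately obtain e where "e \<in> Ob (Hom K A M)" "FO (post_cell K d) e = m"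
    unfolding bij_betw_ex1 by blast
  then show thesis using that by (auto simp: hom1_iff post_cell_def)
qed

lemma stable_mono_lwhisker:
  assumes "stable_mono K A X m" "h \<in> Mor K" "tgt K h = A"
  shows "stable_mono K (src K h) X (h \<rhd> m)"
  unfolding stable_mono_def
proof (intro conjI ballI)
  have m: "m \<in> Cell K" "src K (dom2 K m) = A" "tgt K (dom2 K m) = X"
    using assms by (auto simp: stable_mono_def)
  then show "h \<rhd> m \<in> Ar (Hom K (src K h) X)" using assms by simp
  fix A' k assume k: "A' \<in> Obj K" "k \<in> hom1 K A' (src K h)"
  then have "k \<cdot> h \<in> hom1 K A' A" "(k \<cdot> h) \<rhd> m = k \<rhd> (h \<rhd> m)"
    using assms m by (simp_all add: hom1_iff)
  then show "is_mono (Hom K A' X) (k \<rhd> (h \<rhd> m))"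
    using assms(1) k(1) unfolding stable_mono_def by metis
qed

text \<open>A commuting square between the two monomorphisms is an arrow of the subcategory onto
  which composing with \<open>d\<close> is an isomorphism; the boundary of its preimage is
  identified by injectivity on objects.\<close>

lemma mono_object_cells_ex1:
  assumes M: "mono_object K X M d" and e: "e \<in> Mor K" "tgt K e = M" "e' \<in> Mor K" "tgt K e' = M"
    and s: "s \<in> cells (e \<cdot> dom2 K d) (e' \<cdot> dom2 K d)" and t: "t \<in> cells (e \<cdot> cod2 K d) (e' \<cdot> cod2 K d)"
    and sq: "(e \<rhd> d) \<odot> t = s \<odot> (e' \<rhd> d)"
  shows "\<exists>!w. w \<in> cells e e' \<and> w \<lhd> dom2 K d = s \<and> w \<lhd> cod2 K d = t"
proof -
  note D = mono_objectD[OF M]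
  let ?A = "src K e"
  have D2: "dom2 K d \<in> Mor K" "cod2 K d \<in> Mor K" "src K (cod2 K d) = M" "tgt K (cod2 K d) = X"
    using D by simp_all
  have se: "src K e' = ?A"
    using cells_Mor[OF s] e D by simp
  have bij: "bij_betw (FO (post_cell K d)) (Ob (Hom K ?A M)) (Ob (full_subcat (arrow_cat (Hom K ?A X)) (stable_mono K ?A X)))"
    "bij_betw (FA (post_cell K d)) (Ar (Hom K ?A M)) (Ar (full_subcat (arrow_cat (Hom K ?A X)) (stable_mono K ?A X)))"
    using M e by (simp_all add: mono_object_def cat_isomorphism_def)
  have st: "stable_mono K ?A X (e \<rhd> d)" "stable_mono K ?A X (e' \<rhd> d)"
    using stable_mono_lwhisker[OF D(1)] e se by metis+
  have "(e \<rhd> d, (s, t), e' \<rhd> d) \<in> Ar (full_subcat (arrow_cat (Hom K ?A X)) (stable_mono K ?A X))"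
    using st sq s t e D D2 se by (auto simp: full_subcat_def arrow_cat_def hom_Hom cells_def)
  then obtain w where w: "w \<in> Ar (Hom K ?A M)" "FA (post_cell K d) w = (e \<rhd> d, (s, t), e' \<rhd> d)"
    using bij(2) unfolding bij_betw_ex1 by blast
  have inj: "b = b'" if "b \<in> hom1 K ?A M" "b' \<in> hom1 K ?A M" "b \<rhd> d = b' \<rhd> d" for b b'
    using bij(1) that unfolding bij_betw_def inj_on_def by (simp add: post_cell_def)
  have "dom2 K w \<rhd> d = e \<rhd> d" "cod2 K w \<rhd> d = e' \<rhd> d" using w by (auto simp: post_cell_def)
  moreover have "dom2 K w \<in> hom1 K ?A M" "cod2 K w \<in> hom1 K ?A M" "e \<in> hom1 K ?A M" "e' \<in> hom1 K ?A M"
    using w(1) e se by (simp_all add: hom1_iff)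
  ultimately have "dom2 K w = e" "cod2 K w = e'"
    using inj by blast+
  then have wc: "w \<in> cells e e'" using w by (simp add: cells_def)
  show ?thesis
  proof (rule ex1I[of _ w])
    show "w \<in> cells e e' \<and> w \<lhd> dom2 K d = s \<and> w \<lhd> cod2 K d = t"
      using wc w by (simp add: post_cell_def)
    fix w' assume w': "w' \<in> cells e e' \<and> w' \<lhd> dom2 K d = s \<and> w' \<lhd> cod2 K d = t"
    then have "FA (post_cell K d) w' = FA (post_cell K d) w" "w' \<in> Ar (Hom K ?A M)"
      using w e by (auto simp: post_cell_def cells_def)
    then show "w' = w" using bij_betw_imp_inj_on[OF bij(2)] w(1) by (metis inj_onD)
  qed
qed

text \<open>The inverses of the two components again form a commuting square, which lifts to a
  candidate inverse; both composites have identity components and are identities by uniqueness of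
  lifts.\<close>

lemma mono_object_cells_invertible:
  assumes M: "mono_object K X M d" and w: "w \<in> cells e e'" "tgt K e = M"
    and s: "invertible2 (w \<lhd> dom2 K d) s'" and t: "invertible2 (w \<lhd> cod2 K d) t'"
  obtains w' where "invertible2 w w'"
proof -
  note D = mono_objectD[OF M] and m = cells_Mor[OF w(1)]
  define d0 d1 where dd: "d0 = dom2 K d" "d1 = cod2 K d"
  have [simp]: "d0 \<in> Mor K" "d1 \<in> Mor K" "src K d0 = M" "src K d1 = M" "d \<in> Cell K" "dom2 K d = d0" "cod2 K d = d1"
    and d: "d \<in> cells d0 d1"
    using D by (simp_all add: dd cells_def)
  have [simp]: "e \<in> Mor K" "e' \<in> Mor K" "tgt K e = M" "tgt K e' = M" "src K e' = src K e"
    "w \<in> Cell K" "dom2 K w = e" "cod2 K w = e'" using m w by (auto simp: cells_def)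
  have ws: "w \<lhd> d0 \<in> cells (e \<cdot> d0) (e' \<cdot> d0)" and wt: "w \<lhd> d1 \<in> cells (e \<cdot> d1) (e' \<cdot> d1)"
    by (rule cells_rwhisker[OF w(1)]; simp)+
  have s': "s' \<in> cells (e' \<cdot> d0) (e \<cdot> d0)" "(w \<lhd> d0) \<odot> s' = id2 K (e \<cdot> d0)" "s' \<odot> (w \<lhd> d0) = id2 K (e' \<cdot> d0)"
    using s by (simp_all add: cells_invertible2[OF ws])
  have t': "t' \<in> cells (e' \<cdot> d1) (e \<cdot> d1)" "(w \<lhd> d1) \<odot> t' = id2 K (e \<cdot> d1)" "t' \<odot> (w \<lhd> d1) = id2 K (e' \<cdot> d1)"
    using t by (simp_all add: cells_invertible2[OF wt])
  have ed: "e \<rhd> d \<in> cells (e \<cdot> d0) (e \<cdot> d1)" "e' \<rhd> d \<in> cells (e' \<cdot> d0) (e' \<cdot> d1)"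
    by (rule cells_lwhisker[OF d]; simp)+
  have int: "(w \<lhd> d0) \<odot> (e' \<rhd> d) = (e \<rhd> d) \<odot> (w \<lhd> d1)"
    using whisker_interchange[of w d] by simp
  \<comment> \<open>The square for the inverses: insert \<open>s'\<close> with its inverse, then
    slide the components of \<open>w\<close> past \<open>d\<close> by interchange.\<close>
  have "(e' \<rhd> d) \<odot> t' = (s' \<odot> (w \<lhd> d0)) \<odot> ((e' \<rhd> d) \<odot> t')"
    by (simp add: s' cells_id2_vcomp[OF cells_vcomp[OF ed(2) t'(1)]])
  also have "\<dots> = s' \<odot> (((w \<lhd> d0) \<odot> (e' \<rhd> d)) \<odot> t')"
    by (simp add: cells_assoc[OF s'(1) ws cells_vcomp[OF ed(2) t'(1)]] cells_assoc[OF ws ed(2) t'(1)])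
  also have "\<dots> = s' \<odot> (e \<rhd> d)"
    unfolding int cells_assoc[OF ed(1) wt t'(1)] t' cells_vcomp_id2[OF ed(1)] ..
  finally obtain w' where w': "w' \<in> cells e' e" "w' \<lhd> d0 = s'" "w' \<lhd> d1 = t'"
    using mono_object_cells_ex1[OF M, of e' e s' t'] s' t' by auto
  have uniq: "v = id2 K b" if "v \<in> cells b b" "v \<lhd> d0 = id2 K (b \<cdot> d0)" "v \<lhd> d1 = id2 K (b \<cdot> d1)"
    "b \<in> Mor K" "tgt K b = M" for v b
  proof -
    have bd: "b \<rhd> d \<in> cells (b \<cdot> d0) (b \<cdot> d1)" by (rule cells_lwhisker[OF d]) (use that in simp_all)
    have "\<exists>!v. v \<in> cells b b \<and> v \<lhd> dom2 K d = id2 K (b \<cdot> d0) \<and> v \<lhd> cod2 K d = id2 K (b \<cdot> d1)"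
      by (rule mono_object_cells_ex1[OF M])
        (use that(4,5) in \<open>simp_all add: cells_id2 cells_id2_vcomp[OF bd] cells_vcomp_id2[OF bd]\<close>)
    moreover have "id2 K b \<in> cells b b" "id2 K b \<lhd> d0 = id2 K (b \<cdot> d0)" "id2 K b \<lhd> d1 = id2 K (b \<cdot> d1)"
      using that(4,5) by (simp_all add: cells_id2)
    ultimately show ?thesis using that(1-3) by auto
  qed
  have [simp]: "w' \<in> Cell K" "dom2 K w' = e'" "cod2 K w' = e" using w' by (auto simp: cells_def)
  have "w \<odot> w' = id2 K e" "w' \<odot> w = id2 K e'"
    by (rule uniq; use w w' s' t' in \<open>simp add: rwhisker_vcomp cells_vcomp\<close>)+
  then show thesis using that[of w'] w' w by (simp add: cells_invertible2)
qed

lemma invertible2_cancel: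
  assumes U: "U \<in> cells f g" "invertible2 U U'" and xy: "x \<in> cells g h" "y \<in> cells g h" "U \<odot> x = U \<odot> y"
  shows "x = y"
proof -
  have U': "U' \<in> cells g f" "U' \<odot> U = id2 K g" using U by (simp_all add: cells_invertible2[OF U(1)])
  have "z = U' \<odot> (U \<odot> z)" if "z \<in> cells g h" for z
    using cells_assoc[OF U'(1) U(1) that] U' cells_id2_vcomp[OF that] by simp
  then show ?thesis using xy by metis
qed

lemma invertible2_cancel_right:
  assumes U: "U \<in> cells g h" "invertible2 U U'" and xy: "x \<in> cells f g" "y \<in> cells f g" "x \<odot> U = y \<odot> U"
  shows "x = y"
proof -
  have U': "U' \<in> cells h g" "U \<odot> U' = id2 K g" using U by (simp_all add: cells_invertible2[OF U(1)])
  have "z = (z \<odot> U) \<odot> U'" if "z \<in> cells f g" for z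
    using cells_assoc[OF that U(1) U'(1)] U' cells_vcomp_id2[OF that] by simp
  then show ?thesis using xy by metis
qed

lemma is_mono_Hom:
  "is_mono (Hom K A X) \<alpha> \<longleftrightarrow> \<alpha> \<in> Cell K \<and> src K (dom2 K \<alpha>) = A \<and> tgt K (dom2 K \<alpha>) = X \<and>
    (\<forall>x. \<forall>u\<in>cells x (dom2 K \<alpha>). \<forall>v\<in>cells x (dom2 K \<alpha>). u \<odot> \<alpha> = v \<odot> \<alpha> \<longrightarrow> u = v)" (is "_ \<longleftrightarrow> ?R")
proof
  assume m: "is_mono (Hom K A X) \<alpha>"
  then have a: "\<alpha> \<in> Cell K" "src K (dom2 K \<alpha>) = A" "tgt K (dom2 K \<alpha>) = X"
    by (auto simp: is_mono_def)
  show ?R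
  proof (intro conjI allI ballI impI)
    fix x u v assume uv: "u \<in> cells x (dom2 K \<alpha>)" "v \<in> cells x (dom2 K \<alpha>)" "u \<odot> \<alpha> = v \<odot> \<alpha>"
    have x: "x \<in> hom1 K A X" using cells_Mor[OF uv(1)] a by (simp add: hom1_iff)
    moreover have "dom2 K \<alpha> \<in> hom1 K A X" using a by (simp add: hom1_iff)
    ultimately have "hom (Hom K A X) x (dom2 K \<alpha>) = cells x (dom2 K \<alpha>)" by (rule hom_Hom_cells)
    then show "u = v" using m uv x unfolding is_mono_def by simp
  qed (use a in simp_all)
next
  assume R: ?R
  then have a: "\<alpha> \<in> Cell K" "src K (dom2 K \<alpha>) = A" "tgt K (dom2 K \<alpha>) = X" by simp_all
  show "is_mono (Hom K A X) \<alpha>" unfolding is_mono_def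
  proof (intro conjI ballI impI)
    show "\<alpha> \<in> Ar (Hom K A X)" using a by simp
    fix x u v assume uv: "x \<in> Ob (Hom K A X)" "u \<in> hom (Hom K A X) x (Dom (Hom K A X) \<alpha>)"
      "v \<in> hom (Hom K A X) x (Dom (Hom K A X) \<alpha>)" "u \<bullet>\<^bsub>Hom K A X\<^esub> \<alpha> = v \<bullet>\<^bsub>Hom K A X\<^esub> \<alpha>"
    then have "u \<in> cells x (dom2 K \<alpha>)" "v \<in> cells x (dom2 K \<alpha>)" "u \<odot> \<alpha> = v \<odot> \<alpha>"
      by (simp_all add: hom_Hom cells_def)
    then show "u = v" using R by blast
  qed
qed

lemma is_mono_vcomp_invertible:
  assumes m: "is_mono (Hom K A X) m" "m \<in> cells f g" and s: "\<sigma> \<in> cells g h" "invertible2 \<sigma> \<sigma>'"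
  shows "is_mono (Hom K A X) (m \<odot> \<sigma>)"
proof -
  have ms: "m \<odot> \<sigma> \<in> cells f h" by (rule cells_vcomp[OF m(2) s(1)])
  have d: "dom2 K m = f" "dom2 K (m \<odot> \<sigma>) = f" using m(2) ms by (simp_all add: cells_def)
  show ?thesis unfolding is_mono_Hom d
  proof (intro conjI allI ballI impI)
    show "m \<odot> \<sigma> \<in> Cell K" using ms by (simp add: cells_def)
    show "src K f = A" "tgt K f = X" using m(1) unfolding is_mono_Hom d by simp_all
    fix x u v assume uv: "u \<in> cells x f" "v \<in> cells x f" "u \<odot> (m \<odot> \<sigma>) = v \<odot> (m \<odot> \<sigma>)"
    have "(u \<odot> m) \<odot> \<sigma> = (v \<odot> m) \<odot> \<sigma>"
      using uv cells_assoc[OF uv(1) m(2) s(1)] cells_assoc[OF uv(2) m(2) s(1)] by simp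
    then have "u \<odot> m = v \<odot> m"
      using invertible2_cancel_right[OF s cells_vcomp[OF uv(1) m(2)] cells_vcomp[OF uv(2) m(2)]] by simp
    then show "u = v" using m(1) uv unfolding is_mono_Hom d by blast
  qed
qed

lemma stable_mono_vcomp_invertible:
  assumes m: "stable_mono K A X m" "m \<in> cells f g" and s: "\<sigma> \<in> cells g h" "invertible2 \<sigma> \<sigma>'"
  shows "stable_mono K A X (m \<odot> \<sigma>)"
  unfolding stable_mono_def
proof (intro conjI ballI)
  have mc: "dom2 K m = f" "src K f = A" "tgt K f = X" "cod2 K m = g" "m \<in> Cell K" using m by (auto simp: stable_mono_def cells_def)
  have g: "g \<in> Mor K" "src K g = A" "tgt K g = X" and f: "f \<in> Mor K" using cells_Mor[OF m(2)] mc by simp_all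
  have sc: "dom2 K \<sigma> = g" "\<sigma> \<in> Cell K" using s by (auto simp: cells_def)
  show "m \<odot> \<sigma> \<in> Ar (Hom K A X)" using cells_vcomp[OF m(2) s(1)] mc by (simp add: cells_def)
  fix A' b assume b: "A' \<in> Obj K" "b \<in> hom1 K A' A"
  then have b': "b \<in> Mor K" "tgt K b = A" by (simp_all add: hom1_iff)
  have "is_mono (Hom K A' X) ((b \<rhd> m) \<odot> (b \<rhd> \<sigma>))"
    by (rule is_mono_vcomp_invertible[OF _ cells_lwhisker[OF m(2)] cells_lwhisker[OF s(1)] invertible2_lwhisker[OF s(2)]])
      (use b b' m(1) mc g sc in \<open>simp_all add: stable_mono_def\<close>)
  moreover have "b \<rhd> (m \<odot> \<sigma>) = (b \<rhd> m) \<odot> (b \<rhd> \<sigma>)"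
    by (rule lwhisker_vcomp) (use b' mc sc in simp_all)
  ultimately show "is_mono (Hom K A' X) (b \<rhd> (m \<odot> \<sigma>))" by simp
qed

lemma vcomp_pre:
  assumes "\<alpha> \<in> cells f g" "\<beta> \<in> cells g h" "\<gamma> \<in> cells h k" "\<beta> \<odot> \<gamma> = \<delta>"
  shows "(\<alpha> \<odot> \<beta>) \<odot> \<gamma> = \<alpha> \<odot> \<delta>"
  using cells_assoc assms by blast

end

section \<open>The universal family of subobjects over a groupoid\<close>

locale plentiful_DOF_classifier = DOF_classifier +
  fixes M :: 'a and d :: 'c and Si :: 'a and i :: 'b and Mi :: 'a and j c f\<^sub>0 k\<^sub>0 :: 'b and \<theta> :: 'c
  assumes Mon: "mono_object K S M d"
    and core_S: "is_core K S Si i"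
    and core_M: "is_core K M Mi j"
    and c_hom1: "c \<in> hom1 K Mi Si" and c_eq: "c \<cdot> i = j \<cdot> cod2 K d"
    and c_small: "bipullback K f\<^sub>0 p c k\<^sub>0 \<theta>"
begin

lemma data_simps [simp]:
  "i \<in> Mor K" "src K i = Si" "tgt K i = S" "j \<in> Mor K" "src K j = Mi" "tgt K j = M"
  "c \<in> Mor K" "src K c = Mi" "tgt K c = Si" "d \<in> Cell K" "src K (dom2 K d) = M" "tgt K (dom2 K d) = S"
  "f\<^sub>0 \<in> Mor K" "src K f\<^sub>0 = Si" "tgt K f\<^sub>0 = S" "k\<^sub>0 \<in> Mor K" "src K k\<^sub>0 = Mi" "tgt K k\<^sub>0 = S\<^sub>p"
  using is_coreD[OF core_S] is_coreD[OF core_M] c_hom1 mono_objectD[OF Mon] bipullbackD[OF c_small]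
  by (simp_all add: hom1_iff)

lemma d_cells: "d \<in> cells (dom2 K d) (cod2 K d)"
  by (simp add: cells_def)

lemma \<theta>_cells: "\<theta> \<in> cells (c \<cdot> f\<^sub>0) (k\<^sub>0 \<cdot> p)"
  using bipullbackD[OF c_small] by simp

text \<open>An element of \<open>P = a\<^sup>^ f\<^sub>0\<close> over \<open>b\<close>, with \<open>a\<^sup>^ : A \<rightarrow> Si\<close> the lift of \<open>a\<close>, is by the bipullback
  the same as an isomorphism class of lifts of \<open>b a\<^sup>^\<close> along \<open>c\<close>, that is, a subobject of \<open>b a\<close>.\<close>

lemma universal_mono:
  assumes A: "groupoid_object K A" and a: "a \<in> hom1 K A S"
  obtains P l t \<mu> n where "P \<in> hom1 K A S" "pb_along K p P l t" "\<mu> \<in> cells n (l \<cdot> a)" "stable_mono K (src K l) S \<mu>"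
    "\<And>B b m x. \<lbrakk>groupoid_object K B; b \<in> hom1 K B A; stable_mono K B S m; m \<in> cells x (b \<cdot> a)\<rbrakk> \<Longrightarrow>
      \<exists>!v. v \<in> Mor K \<and> tgt K v = src K l \<and> v \<cdot> l = b \<and>
        (\<exists>\<sigma> \<sigma>'. \<sigma> \<in> cells (v \<cdot> n) x \<and> invertible2 \<sigma> \<sigma>' \<and> v \<rhd> \<mu> = \<sigma> \<odot> m)"
proof -
  have a' [simp]: "a \<in> Mor K" "src K a = A" "tgt K a = S" using a by (simp_all add: hom1_iff)
  obtain ah where ah [simp]: "ah \<in> Mor K" "src K ah = A" "tgt K ah = Si" "ah \<cdot> i = a"
    using core_lift[OF core_S, of a] groupoid_arrowwise_iso[OF A] a' by metis
  define P where "P = ah \<cdot> f\<^sub>0"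
  have P [simp]: "P \<in> Mor K" "src K P = A" "tgt K P = S" by (simp_all add: P_def)
  obtain l t where pb: "pb_along K p P l t" using pb_exists P by blast
  note pbs [simp] = pb_simps(3-7)[OF pb]
  have lP: "t \<cdot> p = l \<cdot> P" using strict_pullbackD[OF pb] by simp
  \<comment> \<open>The universal element \<open>t\<close> of \<open>P\<close> is fed into the
    bipullback. The result \<open>e\<close> names a monomorphism whose codomain
    \<open>e \<cdot> (c \<cdot> i)\<close> agrees with \<open>l \<cdot> a\<close> only through
    \<open>u\<close>.\<close>
  obtain e u v u' v' where e [simp]: "e \<in> Mor K" "tgt K e = Mi" "src K e = src K l"
    and u: "u \<in> cells (e \<cdot> c) (l \<cdot> ah)" and v: "v \<in> cells (e \<cdot> k\<^sub>0) t"
    and u': "invertible2 u u'" and v': "invertible2 v v'" and sq: "(e \<rhd> \<theta>) \<odot> (v \<lhd> p) = u \<lhd> f\<^sub>0"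
  proof -
    have "l \<cdot> ah \<in> Mor K" "tgt K (l \<cdot> ah) = src K f\<^sub>0" "t \<in> Mor K" "tgt K t = src K p"
      "(l \<cdot> ah) \<cdot> f\<^sub>0 = t \<cdot> p" and sl: "src K (l \<cdot> ah) = src K l"
      using lP by (simp_all add: P_def)
    note ess = bipullback_ess_surj[OF c_small this(1-5), unfolded sl]
    show thesis by (rule ess) (rule that; simp)
  qed
  define d0 d1 where dd: "d0 = dom2 K d" "d1 = cod2 K d"
  have d [simp]: "d0 \<in> Mor K" "d1 \<in> Mor K" "src K d0 = M" "src K d1 = M" "tgt K d0 = S" "tgt K d1 = S"
    by (simp_all add: dd)
  have dc: "d \<in> cells d0 d1" using d_cells by (simp add: dd)
  have cij: "c \<cdot> i = j \<cdot> d1" using c_eq by (simp add: dd)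
  define \<delta> where "\<delta> = (e \<cdot> j) \<rhd> d"
  have \<delta>: "\<delta> \<in> cells (e \<cdot> (j \<cdot> d0)) (e \<cdot> (c \<cdot> i))"
    using cells_lwhisker[OF dc, of "e \<cdot> j"] by (simp add: \<delta>_def cij)
  have ui: "u \<lhd> i \<in> cells (e \<cdot> (c \<cdot> i)) (l \<cdot> a)"
    using cells_rwhisker[OF u, of i] by simp
  have ui': "invertible2 (u \<lhd> i) (u' \<lhd> i)"
    by (rule invertible2_rwhisker[OF u']) (use u in \<open>simp_all add: cells_def\<close>)
  \<comment> \<open>The isomorphism \<open>u \<lhd> i\<close> moves the codomain of \<delta> to
    \<open>l \<cdot> a\<close> on the nose.\<close>
  define \<mu> where "\<mu> = \<delta> \<odot> (u \<lhd> i)"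
  have \<mu>: "\<mu> \<in> cells (e \<cdot> (j \<cdot> d0)) (l \<cdot> a)" unfolding \<mu>_def by (rule cells_vcomp[OF \<delta> ui])
  have "stable_mono K (src K (e \<cdot> j)) S \<delta>"
    unfolding \<delta>_def by (rule stable_mono_lwhisker[OF mono_objectD(1)[OF Mon]]) simp_all
  then have \<delta>m: "stable_mono K (src K l) S \<delta>" by simp
  have \<mu>m: "stable_mono K (src K l) S \<mu>"
    unfolding \<mu>_def by (rule stable_mono_vcomp_invertible[OF \<delta>m \<delta> ui ui'])
  \<comment> \<open>The data restricted to a further stage \<open>w\<close>, recorded once for the
    existence argument and for the two stages compared in the uniqueness argument.\<close>
  have wh: "w \<rhd> \<mu> = (w \<rhd> \<delta>) \<odot> ((w \<rhd> u) \<lhd> i)" "w \<rhd> \<delta> \<in> cells (w \<cdot> (e \<cdot> (j \<cdot> d0))) (w \<cdot> (e \<cdot> (c \<cdot> i)))"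
    "w \<rhd> \<delta> = (w \<cdot> (e \<cdot> j)) \<rhd> d"
    "w \<rhd> u \<in> cells (w \<cdot> (e \<cdot> c)) (w \<cdot> (l \<cdot> ah))" "invertible2 (w \<rhd> u) (w \<rhd> u')"
    "w \<rhd> v \<in> cells (w \<cdot> (e \<cdot> k\<^sub>0)) (w \<cdot> t)" "invertible2 (w \<rhd> v) (w \<rhd> v')"
    "((w \<cdot> e) \<rhd> \<theta>) \<odot> ((w \<rhd> v) \<lhd> p) = (w \<rhd> u) \<lhd> f\<^sub>0"
    "(w \<cdot> e) \<rhd> \<theta> \<in> cells (w \<cdot> (e \<cdot> (c \<cdot> f\<^sub>0))) (w \<cdot> (e \<cdot> (k\<^sub>0 \<cdot> p)))"
    if w: "w \<in> Mor K" "tgt K w = src K l" for w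
  proof -
    have uc: "u \<in> Cell K" "dom2 K u = e \<cdot> c" "cod2 K u = l \<cdot> ah" using u by (auto simp: cells_def)
    have vc: "v \<in> Cell K" "dom2 K v = e \<cdot> k\<^sub>0" "cod2 K v = t" using v by (auto simp: cells_def)
    have \<theta>c: "\<theta> \<in> Cell K" "dom2 K \<theta> = c \<cdot> f\<^sub>0" "cod2 K \<theta> = k\<^sub>0 \<cdot> p" using \<theta>_cells by (auto simp: cells_def)
    have \<delta>c: "\<delta> \<in> Cell K" "dom2 K \<delta> = e \<cdot> (j \<cdot> d0)" "cod2 K \<delta> = e \<cdot> (c \<cdot> i)" using \<delta> by (auto simp: cells_def)
    show "w \<rhd> \<mu> = (w \<rhd> \<delta>) \<odot> ((w \<rhd> u) \<lhd> i)"
      using w \<delta>c uc by (simp add: \<mu>_def lwhisker_vcomp)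
    show "w \<rhd> \<delta> \<in> cells (w \<cdot> (e \<cdot> (j \<cdot> d0))) (w \<cdot> (e \<cdot> (c \<cdot> i)))"
      by (rule cells_lwhisker[OF \<delta>]) (use w in simp_all)
    show "w \<rhd> \<delta> = (w \<cdot> (e \<cdot> j)) \<rhd> d" using w by (simp add: \<delta>_def)
    show "w \<rhd> u \<in> cells (w \<cdot> (e \<cdot> c)) (w \<cdot> (l \<cdot> ah))" by (rule cells_lwhisker[OF u]) (use w in simp_all)
    show "invertible2 (w \<rhd> u) (w \<rhd> u')" by (rule invertible2_lwhisker[OF u']) (use w uc in simp_all)
    show "w \<rhd> v \<in> cells (w \<cdot> (e \<cdot> k\<^sub>0)) (w \<cdot> t)" by (rule cells_lwhisker[OF v]) (use w in simp_all)
    show "invertible2 (w \<rhd> v) (w \<rhd> v')" by (rule invertible2_lwhisker[OF v']) (use w vc in simp_all)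
    have "w \<rhd> ((e \<rhd> \<theta>) \<odot> (v \<lhd> p)) = w \<rhd> (u \<lhd> f\<^sub>0)" by (simp only: sq)
    then show "((w \<cdot> e) \<rhd> \<theta>) \<odot> ((w \<rhd> v) \<lhd> p) = (w \<rhd> u) \<lhd> f\<^sub>0"
      using w uc vc \<theta>c by (simp add: lwhisker_vcomp)
    show "(w \<cdot> e) \<rhd> \<theta> \<in> cells (w \<cdot> (e \<cdot> (c \<cdot> f\<^sub>0))) (w \<cdot> (e \<cdot> (k\<^sub>0 \<cdot> p)))"
      using cells_lwhisker[OF \<theta>_cells, of "w \<cdot> e"] w by simp
  qed
  have ex: "\<exists>w. w \<in> Mor K \<and> tgt K w = src K l \<and> w \<cdot> l = b \<and>
        (\<exists>\<sigma> \<sigma>'. \<sigma> \<in> cells (w \<cdot> (e \<cdot> (j \<cdot> d0))) x \<and> invertible2 \<sigma> \<sigma>' \<and> w \<rhd> \<mu> = \<sigma> \<odot> m)"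
    if B: "groupoid_object K B" and b: "b \<in> hom1 K B A" and m: "stable_mono K B S m" "m \<in> cells x (b \<cdot> a)" for B b m x
  proof -
    have b' [simp]: "b \<in> Mor K" "src K b = B" "tgt K b = A" using b by (simp_all add: hom1_iff)
    have BO: "B \<in> Obj K" using B by (simp add: groupoid_object_def)
    \<comment> \<open>\<open>m\<close> has a name in \<open>M\<close>, and since \<open>B\<close> is
      a groupoid the name factors through the core. The codomain of \<open>m\<close> is
      \<open>b \<cdot> a\<close> strictly, so \<open>em\<close> is a strict lift of
      \<open>b \<cdot> ah\<close> along \<open>c\<close>.\<close>
    obtain em0 where em0 [simp]: "em0 \<in> Mor K" "src K em0 = B" "tgt K em0 = M" and emd: "em0 \<rhd> d = m"
      using mono_object_lift[OF Mon BO m(1)] by blast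
    obtain em where em [simp]: "em \<in> Mor K" "src K em = B" "tgt K em = Mi" and emj: "em \<cdot> j = em0"
      using core_lift[OF core_M, of em0] groupoid_arrowwise_iso[OF B] em0 by metis
    have "em \<cdot> (j \<cdot> d1) = em0 \<cdot> d1" using emj[symmetric] by simp
    also have "\<dots> = b \<cdot> a" using emd m(2) by (auto simp: cells_def dd)
    finally have "(em \<cdot> c) \<cdot> i = (b \<cdot> ah) \<cdot> i" using cij by simp
    then have emc: "em \<cdot> c = b \<cdot> ah" using core_eq[OF core_S, of "em \<cdot> c" "b \<cdot> ah"] by simp
    have em\<theta>: "em \<rhd> \<theta> \<in> cells (b \<cdot> P) (em \<cdot> (k\<^sub>0 \<cdot> p))"
    proof -
      have "em \<cdot> (c \<cdot> f\<^sub>0) = (em \<cdot> c) \<cdot> f\<^sub>0" by simp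
      also have "\<dots> = b \<cdot> P" unfolding emc by (simp add: P_def)
      finally show ?thesis using cells_lwhisker[OF \<theta>_cells, of em] by simp
    qed
    obtain \<theta>' where "invertible2 \<theta> \<theta>'" using bipullbackD[OF c_small] by blast
    then have inv\<theta>: "invertible2 (em \<rhd> \<theta>) (em \<rhd> \<theta>')"
      by (rule invertible2_lwhisker) (use \<theta>_cells in \<open>simp_all add: cells_def\<close>)
    define \<tau> where "\<tau> = em \<rhd> \<theta>'"
    have \<tau>: "\<tau> \<in> cells (em \<cdot> (k\<^sub>0 \<cdot> p)) (b \<cdot> P)" using inv\<theta> by (simp add: \<tau>_def cells_invertible2[OF em\<theta>])
    \<comment> \<open>\<open>em \<cdot> k\<^sub>0\<close> lies over
      \<open>em \<cdot> (k\<^sub>0 \<cdot> p)\<close>, which is only isomorphic to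
      \<open>b \<cdot> P\<close>. Transport along the inverse of \<theta> in the discrete
      opfibration \<open>p\<close> yields a strict element \<open>s\<close> of \<open>P\<close>,
      which determines the required \<open>w\<close>.\<close>
    obtain \<kappa> where \<kappa>: "\<kappa> \<in> Cell K" "dom2 K \<kappa> = em \<cdot> k\<^sub>0" "\<kappa> \<lhd> p = \<tau>"
      using DOF_lift[OF p_DOF, of "em \<cdot> k\<^sub>0" \<tau>] \<tau> by (auto simp: cells_def)
    obtain \<kappa>' where \<kappa>': "invertible2 \<kappa> \<kappa>'"
      using DOF_reflects_invertible[OF p_DOF \<kappa>(1), of "em \<rhd> \<theta>"] \<kappa> invertible2_sym[OF inv\<theta>] by (auto simp: \<tau>_def)
    define s where "s = cod2 K \<kappa>"
    have \<kappa>c: "\<kappa> \<in> cells (em \<cdot> k\<^sub>0) s" using \<kappa> by (simp add: cells_def s_def)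
    have s [simp]: "s \<in> Mor K" "src K s = B" "tgt K s = S\<^sub>p" using cells_Mor[OF \<kappa>c] by simp_all
    have sp: "s \<cdot> p = b \<cdot> P"
      using \<tau> cells_rwhisker[OF \<kappa>c, of p] \<kappa>(3) by (auto simp: cells_def)
    obtain w where w [simp]: "w \<in> Mor K" "tgt K w = src K l" "src K w = B" and wl: "w \<cdot> l = b" and wt: "w \<cdot> t = s"
      using pb_point[OF pb, of b s] ElI[of s "b \<cdot> P"] sp by auto
    note W = wh[OF w(1,2)]
    have wah: "w \<cdot> (l \<cdot> ah) = em \<cdot> c" using emc wl[symmetric] by simp
    have \<kappa>'c: "\<kappa>' \<in> cells s (em \<cdot> k\<^sub>0)" using \<kappa>' by (simp add: cells_invertible2[OF \<kappa>c])
    have \<kappa>'p: "\<kappa>' \<lhd> p = em \<rhd> \<theta>"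
    proof -
      have kp: "\<kappa> \<lhd> p \<in> cells (em \<cdot> (k\<^sub>0 \<cdot> p)) (b \<cdot> P)" using \<tau> \<kappa> by simp
      have "invertible2 (\<kappa> \<lhd> p) (\<kappa>' \<lhd> p)" by (rule invertible2_rwhisker[OF \<kappa>']) (use \<kappa> in simp_all)
      moreover have "invertible2 (\<kappa> \<lhd> p) (em \<rhd> \<theta>)" using invertible2_sym[OF inv\<theta>] \<kappa> by (simp add: \<tau>_def)
      ultimately show ?thesis
        using invertible2_cancel[OF kp, of "\<kappa>' \<lhd> p" "\<kappa>' \<lhd> p" "em \<cdot> (k\<^sub>0 \<cdot> p)" "em \<rhd> \<theta>"]
        by (simp add: cells_invertible2[OF kp])
    qed
    \<comment> \<open>The universal name at \<open>w\<close> and the name \<open>em\<close> are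
      compared leg by leg: \<open>w \<rhd> u\<close> on the side of the core of \<open>S\<close>,
      \<open>v1\<close> on the side of \<open>p\<close>. Compatibility with \<theta> makes this an
      arrow of triples, which fullness lifts to \<omega>.\<close>
    define v1 where "v1 = (w \<rhd> v) \<odot> \<kappa>'"
    have v1: "v1 \<in> cells ((w \<cdot> e) \<cdot> k\<^sub>0) (em \<cdot> k\<^sub>0)"
      using cells_vcomp[OF W(6)] \<kappa>'c by (simp add: v1_def wt)
    have "v1 \<lhd> p = ((w \<rhd> v) \<lhd> p) \<odot> (em \<rhd> \<theta>)"
      using W(6) \<kappa>'c by (simp add: v1_def rwhisker_vcomp \<kappa>'p[symmetric] cells_def wt)
    moreover have "(w \<rhd> v) \<lhd> p \<in> cells (w \<cdot> (e \<cdot> (k\<^sub>0 \<cdot> p))) (b \<cdot> P)"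
    proof -
      have "(w \<cdot> t) \<cdot> p = b \<cdot> P" using sp wt by simp
      then show ?thesis using cells_rwhisker[OF W(6), of p] by simp
    qed
    ultimately have "((w \<cdot> e) \<rhd> \<theta>) \<odot> (v1 \<lhd> p) = ((w \<rhd> u) \<lhd> f\<^sub>0) \<odot> (em \<rhd> \<theta>)"
      using cells_assoc[OF W(9) _ em\<theta>, of "(w \<rhd> v) \<lhd> p"] W(8) by simp
    then obtain \<omega> where \<omega>: "\<omega> \<in> cells (w \<cdot> e) em" "\<omega> \<lhd> c = w \<rhd> u"
      using bipullback_full[OF c_small, of "w \<cdot> e" em "w \<rhd> u" v1] v1 W(4) wah by auto
    obtain \<omega>' where \<omega>': "invertible2 \<omega> \<omega>'" using core_cells_invertible[OF core_M \<omega>(1)] by auto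
    define \<rho> where "\<rho> = \<omega> \<lhd> j"
    have \<rho>: "\<rho> \<in> cells (w \<cdot> (e \<cdot> j)) em0" using cells_rwhisker[OF \<omega>(1), of j] emj by (simp add: \<rho>_def)
    have \<rho>': "invertible2 \<rho> (\<omega>' \<lhd> j)"
      unfolding \<rho>_def by (rule invertible2_rwhisker[OF \<omega>']) (use \<omega> in \<open>simp_all add: cells_def\<close>)
    have wuc: "(w \<rhd> u) \<lhd> i = \<rho> \<lhd> d1"
    proof -
      have "(w \<rhd> u) \<lhd> i = \<omega> \<lhd> (c \<cdot> i)" using \<omega> by (simp add: cells_def)
      then show ?thesis using \<omega>(1) unfolding cij by (simp add: \<rho>_def cells_def)
    qed
    define \<sigma> where "\<sigma> = \<rho> \<lhd> d0"
    have \<sigma>: "\<sigma> \<in> cells (w \<cdot> (e \<cdot> (j \<cdot> d0))) (em0 \<cdot> d0)"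
      using cells_rwhisker[OF \<rho>, of d0] by (simp add: \<sigma>_def)
    have \<sigma>': "invertible2 \<sigma> ((\<omega>' \<lhd> j) \<lhd> d0)"
      unfolding \<sigma>_def by (rule invertible2_rwhisker[OF \<rho>']) (use \<rho> in \<open>simp_all add: cells_def\<close>)
    \<comment> \<open>Interchange of \<rho> with \<open>d\<close> is a square from \<delta> at
      \<open>w\<close> to \<open>m\<close>; its codomain side is the correction
      \<open>u \<lhd> i\<close> that was built into \<mu>.\<close>
    have "w \<rhd> \<mu> = \<sigma> \<odot> m"
      using whisker_interchange[of \<rho> d] \<rho> W(1,3) wuc emd by (simp add: \<sigma>_def cells_def dd)
    moreover have "em0 \<cdot> d0 = x" using emd m(2) by (auto simp: cells_def dd)
    ultimately show ?thesis using \<sigma> \<sigma>' w wl by blast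
  qed
  have uniq: "w1 = w2"
    if w1: "w1 \<in> Mor K" "tgt K w1 = src K l" "w1 \<cdot> l = b"
        "\<sigma>1 \<in> cells (w1 \<cdot> (e \<cdot> (j \<cdot> d0))) x" "invertible2 \<sigma>1 \<sigma>1'" "w1 \<rhd> \<mu> = \<sigma>1 \<odot> m"
      and w2: "w2 \<in> Mor K" "tgt K w2 = src K l" "w2 \<cdot> l = b"
        "\<sigma>2 \<in> cells (w2 \<cdot> (e \<cdot> (j \<cdot> d0))) x" "invertible2 \<sigma>2 \<sigma>2'" "w2 \<rhd> \<mu> = \<sigma>2 \<odot> m"
      and m: "m \<in> cells x (b \<cdot> a)"
    for w1 w2 b m x \<sigma>1 \<sigma>1' \<sigma>2 \<sigma>2'
  proof -
    note W1 = wh[OF w1(1,2)] and W2 = wh[OF w2(1,2)]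
    have src12: "src K w2 = src K w1" using w1 w2 src_comp1[of w1 l] src_comp1[of w2 l] by simp
    have lx: "w1 \<cdot> (l \<cdot> y) = b \<cdot> y" "w2 \<cdot> (l \<cdot> y) = b \<cdot> y" if "y \<in> Mor K" "src K y = A" for y
      using that w1(1,2) w2(1,2) comp1_assoc[of w1 l y] comp1_assoc[of w2 l y]
      unfolding w1(3)[symmetric] w2(3)[unfolded w1(3)[symmetric]] by simp_all
    have \<sigma>2': "\<sigma>2' \<in> cells x (w2 \<cdot> (e \<cdot> (j \<cdot> d0)))" "\<sigma>2' \<odot> \<sigma>2 = id2 K x" "invertible2 \<sigma>2' \<sigma>2"
      using w2(5) invertible2_sym by (auto simp: cells_invertible2[OF w2(4)])
    \<comment> \<open>Both stages present the same subobject, through \<open>m\<close>, so the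
      domains are isomorphic compatibly with \<mu>.\<close>
    define \<sigma> where "\<sigma> = \<sigma>1 \<odot> \<sigma>2'"
    have \<sigma>: "\<sigma> \<in> cells (w1 \<cdot> (e \<cdot> (j \<cdot> d0))) (w2 \<cdot> (e \<cdot> (j \<cdot> d0)))"
      unfolding \<sigma>_def by (rule cells_vcomp[OF w1(4) \<sigma>2'(1)])
    have \<sigma>inv: "invertible2 \<sigma> (\<sigma>2 \<odot> \<sigma>1')"
      unfolding \<sigma>_def by (rule invertible2_vcomp[OF w1(5) \<sigma>2'(3)]) (use w1(4) \<sigma>2'(1) in \<open>simp add: cells_def\<close>)
    have w2\<mu>: "w2 \<rhd> \<mu> \<in> cells (w2 \<cdot> (e \<cdot> (j \<cdot> d0))) (b \<cdot> a)"
      unfolding w2(6) by (rule cells_vcomp[OF w2(4) m])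
    have \<sigma>\<mu>: "\<sigma> \<odot> (w2 \<rhd> \<mu>) = w1 \<rhd> \<mu>"
    proof -
      have "\<sigma> \<odot> (w2 \<rhd> \<mu>) = \<sigma>1 \<odot> (\<sigma>2' \<odot> (\<sigma>2 \<odot> m))"
        unfolding \<sigma>_def w2(6)[symmetric] by (rule cells_assoc[OF w1(4) \<sigma>2'(1) w2\<mu>])
      also have "\<sigma>2' \<odot> (\<sigma>2 \<odot> m) = m"
        using cells_assoc[OF \<sigma>2'(1) w2(4) m] \<sigma>2'(2) cells_id2_vcomp[OF m] by simp
      finally show ?thesis using w1(6) by simp
    qed
    define U1 U2 U2' where U: "U1 = w1 \<rhd> u" "U2 = w2 \<rhd> u" "U2' = w2 \<rhd> u'"
    have U1: "U1 \<in> cells (w1 \<cdot> (e \<cdot> c)) (b \<cdot> ah)" "invertible2 U1 (w1 \<rhd> u')"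
      and U2: "U2 \<in> cells (w2 \<cdot> (e \<cdot> c)) (b \<cdot> ah)" "invertible2 U2 U2'"
      using W1(4,5) W2(4,5) lx[of ah] by (simp_all add: U)
    have U2': "U2' \<in> cells (b \<cdot> ah) (w2 \<cdot> (e \<cdot> c))" "U2' \<odot> U2 = id2 K (b \<cdot> ah)" "invertible2 U2' U2"
      using U2 invertible2_sym by (auto simp: cells_invertible2[OF U2(1)])
    \<comment> \<open>\<open>T\<close> compares the codomains of the two names within the core of
      \<open>S\<close>, by way of \<open>b \<cdot> ah\<close>.\<close>
    define T where "T = U1 \<odot> U2'"
    have T: "T \<in> cells (w1 \<cdot> (e \<cdot> c)) (w2 \<cdot> (e \<cdot> c))" unfolding T_def by (rule cells_vcomp[OF U1(1) U2'(1)])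
    have Tinv: "invertible2 T (U2 \<odot> (w1 \<rhd> u'))"
      unfolding T_def by (rule invertible2_vcomp[OF U1(2) U2'(3)]) (use U1(1) U2'(1) in \<open>simp add: cells_def\<close>)
    have TU2: "T \<odot> U2 = U1"
      unfolding T_def using cells_assoc[OF U1(1) U2'(1) U2(1)] U2'(2) cells_vcomp_id2[OF U1(1)] by simp
    have TU2w: "(T \<lhd> g) \<odot> (U2 \<lhd> g) = U1 \<lhd> g" if "g \<in> Mor K" "src K g = Si" for g
      using TU2 rwhisker_vcomp[of g T U2] T U2(1) that w1(1,2) by (auto simp: cells_def)
    have Ti: "T \<lhd> i \<in> cells (w1 \<cdot> (e \<cdot> (c \<cdot> i))) (w2 \<cdot> (e \<cdot> (c \<cdot> i)))"
      using cells_rwhisker[OF T, of i] w1(1,2) w2(1,2) by simp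
    have U2i: "U2 \<lhd> i \<in> cells (w2 \<cdot> (e \<cdot> (c \<cdot> i))) (b \<cdot> a)" "invertible2 (U2 \<lhd> i) (U2' \<lhd> i)"
    proof -
      have bA: "b \<in> Mor K" "tgt K b = A" using w1(1-3) comp1_Mor[of w1 l] tgt_comp1[of w1 l] by auto
      show "U2 \<lhd> i \<in> cells (w2 \<cdot> (e \<cdot> (c \<cdot> i))) (b \<cdot> a)"
        using cells_rwhisker[OF U2(1), of i] w2(1,2) bA by simp
      show "invertible2 (U2 \<lhd> i) (U2' \<lhd> i)"
        by (rule invertible2_rwhisker[OF U2(2)]) (use U2(1) w2(1,2) in \<open>simp_all add: cells_def\<close>)
    qed
    \<comment> \<open>After composing with the invertible \<open>U2 \<lhd> i\<close> both sides
      become \<open>w1 \<rhd> \<mu>\<close>. So \<sigma> and \<open>T \<lhd> i\<close> form a square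
      between the two copies of \<delta>, which lifts to the monomorphism object and from there to
      its core.\<close>
    have sqT: "(w1 \<rhd> \<delta>) \<odot> (T \<lhd> i) = \<sigma> \<odot> (w2 \<rhd> \<delta>)"
    proof (rule invertible2_cancel_right[OF U2i])
      show "(w1 \<rhd> \<delta>) \<odot> (T \<lhd> i) \<in> cells (w1 \<cdot> (e \<cdot> (j \<cdot> d0))) (w2 \<cdot> (e \<cdot> (c \<cdot> i)))"
        by (rule cells_vcomp[OF W1(2) Ti])
      show "\<sigma> \<odot> (w2 \<rhd> \<delta>) \<in> cells (w1 \<cdot> (e \<cdot> (j \<cdot> d0))) (w2 \<cdot> (e \<cdot> (c \<cdot> i)))"
        by (rule cells_vcomp[OF \<sigma> W2(2)])
      have "((w1 \<rhd> \<delta>) \<odot> (T \<lhd> i)) \<odot> (U2 \<lhd> i) = w1 \<rhd> \<mu>"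
        using cells_assoc[OF W1(2) Ti U2i(1)] TU2w[of i] W1(1) by (simp add: U)
      also have "\<dots> = (\<sigma> \<odot> (w2 \<rhd> \<delta>)) \<odot> (U2 \<lhd> i)"
        using cells_assoc[OF \<sigma> W2(2) U2i(1)] \<sigma>\<mu> W2(1) by (simp add: U)
      finally show "((w1 \<rhd> \<delta>) \<odot> (T \<lhd> i)) \<odot> (U2 \<lhd> i) = (\<sigma> \<odot> (w2 \<rhd> \<delta>)) \<odot> (U2 \<lhd> i)" .
    qed
    have wj: "w1 \<cdot> (e \<cdot> j) \<in> Mor K" "w2 \<cdot> (e \<cdot> j) \<in> Mor K" "tgt K (w1 \<cdot> (e \<cdot> j)) = M" "tgt K (w2 \<cdot> (e \<cdot> j)) = M"
      using w1(1,2) w2(1,2) by simp_all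
    have "\<exists>!w. w \<in> cells (w1 \<cdot> (e \<cdot> j)) (w2 \<cdot> (e \<cdot> j)) \<and> w \<lhd> dom2 K d = \<sigma> \<and> w \<lhd> cod2 K d = T \<lhd> i"
      by (rule mono_object_cells_ex1[OF Mon])
        (use wj \<sigma> Ti sqT w1(1,2) w2(1,2) W1(3) W2(3) in \<open>simp_all add: dd[symmetric] cij\<close>)
    then obtain \<omega>0 where \<omega>0: "\<omega>0 \<in> cells (w1 \<cdot> (e \<cdot> j)) (w2 \<cdot> (e \<cdot> j))" "\<omega>0 \<lhd> dom2 K d = \<sigma>" "\<omega>0 \<lhd> cod2 K d = T \<lhd> i"
      by blast
    have Tiinv: "invertible2 (T \<lhd> i) ((U2 \<odot> (w1 \<rhd> u')) \<lhd> i)"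
      by (rule invertible2_rwhisker[OF Tinv]) (use T w1(1,2) in \<open>simp_all add: cells_def\<close>)
    obtain \<omega>0' where \<omega>0': "invertible2 \<omega>0 \<omega>0'"
      using mono_object_cells_invertible[OF Mon \<omega>0(1) wj(3)] \<sigma>inv Tiinv \<omega>0(2,3) by metis
    obtain \<omega> where \<omega>: "\<omega> \<in> cells (w1 \<cdot> e) (w2 \<cdot> e)" "\<omega> \<lhd> j = \<omega>0"
      using core_cells_lift[OF core_M _ _ _ _ _ \<omega>0', of "w1 \<cdot> e" "w2 \<cdot> e"] \<omega>0(1) w1(1,2) w2(1,2) by auto
    have \<omega>cell: "\<omega> \<in> Cell K" "dom2 K \<omega> = w1 \<cdot> e" "cod2 K \<omega> = w2 \<cdot> e" using \<omega>(1) by (auto simp: cells_def)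
    have \<omega>c: "\<omega> \<lhd> c = T"
    proof (rule core_cells_eq[OF core_S _ T])
      show "\<omega> \<lhd> c \<in> cells (w1 \<cdot> (e \<cdot> c)) (w2 \<cdot> (e \<cdot> c))"
        using cells_rwhisker[OF \<omega>(1), of c] w1(1,2) w2(1,2) by simp
      have "(\<omega> \<lhd> c) \<lhd> i = \<omega> \<lhd> (c \<cdot> i)" using \<omega>cell w1(1,2) by simp
      also have "\<dots> = (\<omega> \<lhd> j) \<lhd> cod2 K d" unfolding c_eq using \<omega>cell w1(1,2) by simp
      finally show "(\<omega> \<lhd> c) \<lhd> i = T \<lhd> i" using \<omega>(2) \<omega>0(3) by simp
      show "tgt K (w1 \<cdot> (e \<cdot> c)) = Si" using w1(1,2) by simp
    qed
    define V1 V2 V1' where V: "V1 = w1 \<rhd> v" "V2 = w2 \<rhd> v" "V1' = w1 \<rhd> v'"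
    have V1: "V1 \<in> cells (w1 \<cdot> (e \<cdot> k\<^sub>0)) (w1 \<cdot> t)" "invertible2 V1 V1'"
      and V2: "V2 \<in> cells (w2 \<cdot> (e \<cdot> k\<^sub>0)) (w2 \<cdot> t)"
      using W1(6,7) W2(6) by (simp_all add: V)
    have V1': "V1' \<in> cells (w1 \<cdot> t) (w1 \<cdot> (e \<cdot> k\<^sub>0))" "V1 \<odot> V1' = id2 K (w1 \<cdot> (e \<cdot> k\<^sub>0))"
      using V1(2) by (auto simp: cells_invertible2[OF V1(1)])
    have wk: "\<omega> \<lhd> k\<^sub>0 \<in> cells (w1 \<cdot> (e \<cdot> k\<^sub>0)) (w2 \<cdot> (e \<cdot> k\<^sub>0))"
      using cells_rwhisker[OF \<omega>(1), of k\<^sub>0] w1(1,2) w2(1,2) by simp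
    \<comment> \<open>Whiskering \<omega> with \<open>k\<^sub>0\<close> and correcting both ends by
      \<open>v\<close> compares the elements \<open>w1 \<cdot> t\<close> and
      \<open>w2 \<cdot> t\<close>. Once \<kappa> is seen to lie over an identity, discreteness of
      \<open>p\<close> makes the two elements equal.\<close>
    define \<kappa> where "\<kappa> = V1' \<odot> ((\<omega> \<lhd> k\<^sub>0) \<odot> V2)"
    have wkV: "(\<omega> \<lhd> k\<^sub>0) \<odot> V2 \<in> cells (w1 \<cdot> (e \<cdot> k\<^sub>0)) (w2 \<cdot> t)" by (rule cells_vcomp[OF wk V2])
    have \<kappa>: "\<kappa> \<in> cells (w1 \<cdot> t) (w2 \<cdot> t)" unfolding \<kappa>_def by (rule cells_vcomp[OF V1'(1) wkV])
    have V\<kappa>: "V1 \<odot> \<kappa> = (\<omega> \<lhd> k\<^sub>0) \<odot> V2"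
      unfolding \<kappa>_def using cells_assoc[OF V1(1) V1'(1) wkV] V1'(2) cells_id2_vcomp[OF wkV] by simp
    have tp: "(w1 \<cdot> t) \<cdot> p = b \<cdot> P" "(w2 \<cdot> t) \<cdot> p = b \<cdot> P"
      using lx[of P] lP w1(1,2) w2(1,2) by simp_all
    have V1p: "V1 \<lhd> p \<in> cells (w1 \<cdot> (e \<cdot> (k\<^sub>0 \<cdot> p))) (b \<cdot> P)"
      using cells_rwhisker[OF V1(1), of p] tp w1(1,2) by simp
    have V2p: "V2 \<lhd> p \<in> cells (w2 \<cdot> (e \<cdot> (k\<^sub>0 \<cdot> p))) (b \<cdot> P)"
      using cells_rwhisker[OF V2, of p] tp w2(1,2) by simp
    have \<kappa>p: "\<kappa> \<lhd> p \<in> cells (b \<cdot> P) (b \<cdot> P)"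
      using cells_rwhisker[OF \<kappa>, of p] tp w1(1,2) by simp
    have wkp: "(\<omega> \<lhd> k\<^sub>0) \<lhd> p \<in> cells (w1 \<cdot> (e \<cdot> (k\<^sub>0 \<cdot> p))) (w2 \<cdot> (e \<cdot> (k\<^sub>0 \<cdot> p)))"
      using cells_rwhisker[OF wk, of p] w1(1,2) w2(1,2) by simp
    have V\<kappa>p: "(V1 \<lhd> p) \<odot> (\<kappa> \<lhd> p) = ((\<omega> \<lhd> k\<^sub>0) \<lhd> p) \<odot> (V2 \<lhd> p)"
    proof -
      have "(V1 \<odot> \<kappa>) \<lhd> p = (V1 \<lhd> p) \<odot> (\<kappa> \<lhd> p)"
        using V1(1) \<kappa> w1(1,2) by (intro rwhisker_vcomp) (auto simp: cells_def)
      moreover have "((\<omega> \<lhd> k\<^sub>0) \<odot> V2) \<lhd> p = ((\<omega> \<lhd> k\<^sub>0) \<lhd> p) \<odot> (V2 \<lhd> p)"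
        using wk V2 w1(1,2) by (intro rwhisker_vcomp) (auto simp: cells_def)
      ultimately show ?thesis using V\<kappa> by simp
    qed
    have int: "((w1 \<cdot> e) \<rhd> \<theta>) \<odot> ((\<omega> \<lhd> k\<^sub>0) \<lhd> p) = (T \<lhd> f\<^sub>0) \<odot> ((w2 \<cdot> e) \<rhd> \<theta>)"
    proof -
      have \<theta>c: "\<theta> \<in> Cell K" "dom2 K \<theta> = c \<cdot> f\<^sub>0" "cod2 K \<theta> = k\<^sub>0 \<cdot> p" using \<theta>_cells by (auto simp: cells_def)
      have "(\<omega> \<lhd> (c \<cdot> f\<^sub>0)) \<odot> ((w2 \<cdot> e) \<rhd> \<theta>) = ((w1 \<cdot> e) \<rhd> \<theta>) \<odot> (\<omega> \<lhd> (k\<^sub>0 \<cdot> p))"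
        using whisker_interchange[of \<omega> \<theta>] \<omega>cell \<theta>c w1(1,2) by simp
      moreover have "\<omega> \<lhd> (c \<cdot> f\<^sub>0) = T \<lhd> f\<^sub>0" "\<omega> \<lhd> (k\<^sub>0 \<cdot> p) = (\<omega> \<lhd> k\<^sub>0) \<lhd> p"
        using \<omega>cell \<omega>c w1(1,2) by simp_all
      ultimately show ?thesis by simp
    qed
    have Tf: "T \<lhd> f\<^sub>0 \<in> cells (w1 \<cdot> (e \<cdot> (c \<cdot> f\<^sub>0))) (w2 \<cdot> (e \<cdot> (c \<cdot> f\<^sub>0)))"
      using cells_rwhisker[OF T, of f\<^sub>0] w1(1,2) w2(1,2) by simp
    have bah: "b \<cdot> ah \<in> Mor K" "b \<in> Mor K" "tgt K b = A" using w1(1-3) comp1_Mor[of w1 l] tgt_comp1[of w1 l] by auto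
    have U1f: "U1 \<lhd> f\<^sub>0 \<in> cells (w1 \<cdot> (e \<cdot> (c \<cdot> f\<^sub>0))) (b \<cdot> P)" "invertible2 (U1 \<lhd> f\<^sub>0) ((w1 \<rhd> u') \<lhd> f\<^sub>0)"
    proof -
      show "U1 \<lhd> f\<^sub>0 \<in> cells (w1 \<cdot> (e \<cdot> (c \<cdot> f\<^sub>0))) (b \<cdot> P)"
        using cells_rwhisker[OF U1(1), of f\<^sub>0] w1(1,2) bah by (simp add: P_def)
      show "invertible2 (U1 \<lhd> f\<^sub>0) ((w1 \<rhd> u') \<lhd> f\<^sub>0)"
        by (rule invertible2_rwhisker[OF U1(2)]) (use U1(1) w1(1,2) in \<open>simp_all add: cells_def\<close>)
    qed
    \<comment> \<open>The compatibility of \<open>u\<close> and \<open>v\<close> with \<theta> is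
      used at \<open>w1\<close>, and again at \<open>w2\<close> after \<theta> has been slid past
      \<omega>; the invertible \<open>U1 \<lhd> f\<^sub>0\<close> is cancelled at the end.\<close>
    have "(U1 \<lhd> f\<^sub>0) \<odot> (\<kappa> \<lhd> p) = (((w1 \<cdot> e) \<rhd> \<theta>) \<odot> (V1 \<lhd> p)) \<odot> (\<kappa> \<lhd> p)"
      using W1(8) by (simp add: U V)
    also have "\<dots> = ((w1 \<cdot> e) \<rhd> \<theta>) \<odot> (((\<omega> \<lhd> k\<^sub>0) \<lhd> p) \<odot> (V2 \<lhd> p))"
      by (rule vcomp_pre[OF W1(9) V1p \<kappa>p V\<kappa>p])
    also have "\<dots> = ((T \<lhd> f\<^sub>0) \<odot> ((w2 \<cdot> e) \<rhd> \<theta>)) \<odot> (V2 \<lhd> p)"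
      using cells_assoc[OF W1(9) wkp V2p] int by simp
    also have "\<dots> = (T \<lhd> f\<^sub>0) \<odot> (U2 \<lhd> f\<^sub>0)"
      by (rule vcomp_pre[OF Tf W2(9) V2p]) (use W2(8) in \<open>simp add: U V\<close>)
    also have "\<dots> = U1 \<lhd> f\<^sub>0" by (rule TU2w) simp_all
    also have "\<dots> = (U1 \<lhd> f\<^sub>0) \<odot> id2 K (b \<cdot> P)" by (rule cells_vcomp_id2[OF U1f(1), symmetric])
    finally have \<kappa>id: "\<kappa> \<lhd> p = id2 K (b \<cdot> P)"
      using invertible2_cancel[OF U1f \<kappa>p] cells_id2[of "b \<cdot> P"] bah by simp
    have w1t: "w1 \<cdot> t \<in> Mor K" "tgt K (w1 \<cdot> t) = S\<^sub>p" using w1(1,2) by simp_all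
    have "\<kappa> = id2 K (w1 \<cdot> t)"
    proof (rule DOF_unique[OF p_DOF])
      show "\<kappa> \<in> Cell K" "tgt K (dom2 K \<kappa>) = src K p" "dom2 K \<kappa> = dom2 K (id2 K (w1 \<cdot> t))" "id2 K (w1 \<cdot> t) \<in> Cell K"
        using \<kappa> w1t by (auto simp: cells_def)
      show "\<kappa> \<lhd> p = id2 K (w1 \<cdot> t) \<lhd> p" unfolding \<kappa>id tp(1)[symmetric] using w1t by simp
    qed
    then have "w2 \<cdot> t = w1 \<cdot> t" using \<kappa> w1t by (auto simp: cells_def)
    then show "w1 = w2" using pb_point_eq[OF pb w1(1) w2(1)] w1(2,3) w2(2,3) by simp
  qed
  show thesis
  proof (rule that[OF _ pb \<mu> \<mu>m])
    show "P \<in> hom1 K A S" by (simp add: hom1_iff)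
    fix B b m x assume as: "groupoid_object K B" "b \<in> hom1 K B A" "stable_mono K B S m" "m \<in> cells x (b \<cdot> a)"
    show "\<exists>!w. w \<in> Mor K \<and> tgt K w = src K l \<and> w \<cdot> l = b \<and>
        (\<exists>\<sigma> \<sigma>'. \<sigma> \<in> cells (w \<cdot> (e \<cdot> (j \<cdot> d0))) x \<and> invertible2 \<sigma> \<sigma>' \<and> w \<rhd> \<mu> = \<sigma> \<odot> m)"
      by (rule ex_ex1I[OF ex[OF as]]) (use uniq as(4) in blast)
  qed
qed

end

context DOF_classifier
begin

section \<open>Finite limits\<close>

lemma is_functor_Hom:
  assumes "is_functor J (Hom K A S) D"
  shows "j \<in> Ob J \<Longrightarrow> FO D j \<in> Mor K" "j \<in> Ob J \<Longrightarrow> src K (FO D j) = A" "j \<in> Ob J \<Longrightarrow> tgt K (FO D j) = S"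
    "k \<in> Ar J \<Longrightarrow> FA D k \<in> cells (FO D (Dom J k)) (FO D (Cod J k))"
  using assms by (auto simp: is_functor_def hom1_iff hom_Hom cells_def)

text \<open>Limits of the subdiagrams with objects \<open>I\<close> and arrows \<open>R\<close>, which need not be subcategories:
  this allows adding objects and arrows one at a time.\<close>

definition pointwise_limit ::
  "'o \<Rightarrow> ('j, 'k) cat \<Rightarrow> ('j, 'k, 'm, 'c) funct \<Rightarrow> 'j set \<Rightarrow> 'k set \<Rightarrow> 'm \<Rightarrow> ('j \<Rightarrow> 'c) \<Rightarrow> bool" where
  "pointwise_limit A J D I R l \<pi> \<longleftrightarrow> l \<in> hom1 K A S \<and> (\<forall>j\<in>I. \<pi> j \<in> cells l (FO D j)) \<and>
    (\<forall>x\<in>Mor K. tgt K x = A \<longrightarrow>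
      (\<forall>t\<in>El (x \<cdot> l). \<forall>k\<in>R. ev x (FA D k) (ev x (\<pi> (Dom J k)) t) = ev x (\<pi> (Cod J k)) t) \<and>
      (\<forall>\<sigma>. (\<forall>j\<in>I. \<sigma> j \<in> El (x \<cdot> FO D j)) \<and> (\<forall>k\<in>R. ev x (FA D k) (\<sigma> (Dom J k)) = \<sigma> (Cod J k)) \<longrightarrow>
        (\<exists>!t. t \<in> El (x \<cdot> l) \<and> (\<forall>j\<in>I. ev x (\<pi> j) t = \<sigma> j))))"

lemma pointwise_limitD:
  assumes "pointwise_limit A J D I R l \<pi>"
  shows "l \<in> Mor K" "src K l = A" "tgt K l = S" "j \<in> I \<Longrightarrow> \<pi> j \<in> cells l (FO D j)"
    "\<lbrakk>x \<in> Mor K; tgt K x = A; t \<in> El (x \<cdot> l); k \<in> R\<rbrakk> \<Longrightarrow>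
      ev x (FA D k) (ev x (\<pi> (Dom J k)) t) = ev x (\<pi> (Cod J k)) t"
    "\<lbrakk>x \<in> Mor K; tgt K x = A; \<And>j. j \<in> I \<Longrightarrow> \<sigma> j \<in> El (x \<cdot> FO D j);
      \<And>k. k \<in> R \<Longrightarrow> ev x (FA D k) (\<sigma> (Dom J k)) = \<sigma> (Cod J k)\<rbrakk> \<Longrightarrow>
      \<exists>!t. t \<in> El (x \<cdot> l) \<and> (\<forall>j\<in>I. ev x (\<pi> j) t = \<sigma> j)"
  using assms unfolding pointwise_limit_def hom1_iff by blast+

lemma pointwise_limitI:
  assumes "l \<in> hom1 K A S" "\<And>j. j \<in> I \<Longrightarrow> \<pi> j \<in> cells l (FO D j)"
    "\<And>x t k. \<lbrakk>x \<in> Mor K; tgt K x = A; t \<in> El (x \<cdot> l); k \<in> R\<rbrakk> \<Longrightarrow>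
      ev x (FA D k) (ev x (\<pi> (Dom J k)) t) = ev x (\<pi> (Cod J k)) t"
    "\<And>x \<sigma>. \<lbrakk>x \<in> Mor K; tgt K x = A; \<And>j. j \<in> I \<Longrightarrow> \<sigma> j \<in> El (x \<cdot> FO D j);
      \<And>k. k \<in> R \<Longrightarrow> ev x (FA D k) (\<sigma> (Dom J k)) = \<sigma> (Cod J k)\<rbrakk> \<Longrightarrow>
      \<exists>!t. t \<in> El (x \<cdot> l) \<and> (\<forall>j\<in>I. ev x (\<pi> j) t = \<sigma> j)"
  shows "pointwise_limit A J D I R l \<pi>"
  using assms unfolding pointwise_limit_def by blast

lemma pointwise_limit_eq:
  assumes L: "pointwise_limit A J D I R l \<pi>" and D: "is_functor J (Hom K A S) D"
    and I: "I \<subseteq> Ob J" "\<And>k. k \<in> R \<Longrightarrow> Dom J k \<in> I \<and> Cod J k \<in> I"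
    and t: "x \<in> Mor K" "tgt K x = A" "t \<in> El (x \<cdot> l)" "t' \<in> El (x \<cdot> l)" "\<And>j. j \<in> I \<Longrightarrow> ev x (\<pi> j) t = ev x (\<pi> j) t'"
  shows "t = t'"
proof -
  note l = pointwise_limitD[OF L]
  have "\<exists>!r. r \<in> El (x \<cdot> l) \<and> (\<forall>j\<in>I. ev x (\<pi> j) r = ev x (\<pi> j) t)"
  proof (rule l(6)[OF t(1,2)])
    show "ev x (\<pi> j) t \<in> El (x \<cdot> FO D j)" if "j \<in> I" for j
      by (rule cells_El[OF l(4)[OF that]]) (use t l in simp_all)
    show "ev x (FA D k) (ev x (\<pi> (Dom J k)) t) = ev x (\<pi> (Cod J k)) t" if "k \<in> R" for k
      by (rule l(5)) (use t that in simp_all)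
  qed
  then show ?thesis using t(3-5) by metis
qed

text \<open>With no arrows imposed this is a finite product, built from the terminal morphism and
  binary products.\<close>

lemma pointwise_limit_objects:
  assumes D: "is_functor J (Hom K A S) D" and A: "A \<in> Obj K" and fin: "finite I" and I: "I \<subseteq> Ob J"
  shows "\<exists>l \<pi>. pointwise_limit A J D I {} l \<pi>"
  using fin I
proof (induction I rule: finite_induct)
  case empty
  obtain f where f: "f \<in> hom1 K A S" "\<And>x. \<lbrakk>x \<in> Mor K; tgt K x = A\<rbrakk> \<Longrightarrow> \<exists>!s. s \<in> El (x \<cdot> f)"
    using pointwise_terminal_exists[OF A] by blast
  \<comment> \<open>There are no objects, so no projection is ever consulted.\<close>
  have "pointwise_limit A J D {} {} f (\<lambda>_. undefined)"
    by (rule pointwise_limitI) (use f in simp_all)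
  then show ?case by blast
next
  case (insert j0 I)
  then obtain l \<pi> where L: "pointwise_limit A J D I {} l \<pi>" by blast
  note l = pointwise_limitD[OF L]
  have j0: "FO D j0 \<in> Mor K" "src K (FO D j0) = A" "tgt K (FO D j0) = S"
    using is_functor_Hom[OF D] insert by auto
  obtain q \<pi>\<^sub>1 \<pi>\<^sub>2 where Q: "pointwise_product l (FO D j0) q \<pi>\<^sub>1 \<pi>\<^sub>2"
    using pointwise_product_exists[OF l(1,3) j0(1) _ j0(3)] l(2) j0(2) by auto
  then have p: "\<pi>\<^sub>1 \<in> cells q l" "\<pi>\<^sub>2 \<in> cells q (FO D j0)" "tgt K q = S"
    and univ: "\<And>x s s'. \<lbrakk>x \<in> Mor K; tgt K x = src K q; s \<in> El (x \<cdot> l); s' \<in> El (x \<cdot> FO D j0)\<rbrakk> \<Longrightarrow>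
      \<exists>!r. r \<in> El (x \<cdot> q) \<and> ev x \<pi>\<^sub>1 r = s \<and> ev x \<pi>\<^sub>2 r = s'"
    by (auto simp: pointwise_product_def)
  have q: "q \<in> Mor K" "src K q = A" using cells_Mor[OF p(1)] l by auto
  let ?\<pi> = "\<lambda>j. if j = j0 then \<pi>\<^sub>2 else \<pi>\<^sub>1 \<odot> \<pi> j"
  have "pointwise_limit A J D (insert j0 I) {} q ?\<pi>"
  proof (rule pointwise_limitI)
    show "q \<in> hom1 K A S" using q p by (simp add: hom1_iff)
    show "?\<pi> j \<in> cells q (FO D j)" if "j \<in> insert j0 I" for j
      using that p cells_vcomp[OF p(1) l(4)] by auto
    fix x \<sigma> assume x: "x \<in> Mor K" "tgt K x = A" "\<And>j. j \<in> insert j0 I \<Longrightarrow> \<sigma> j \<in> El (x \<cdot> FO D j)"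
    have "\<exists>!t. t \<in> El (x \<cdot> l) \<and> (\<forall>j\<in>I. ev x (\<pi> j) t = \<sigma> j)"
      by (rule l(6)[OF x(1,2)]) (simp_all add: x(3))
    then obtain t where t: "t \<in> El (x \<cdot> l)" "\<forall>j\<in>I. ev x (\<pi> j) t = \<sigma> j"
      and tu: "\<And>t'. \<lbrakk>t' \<in> El (x \<cdot> l); \<forall>j\<in>I. ev x (\<pi> j) t' = \<sigma> j\<rbrakk> \<Longrightarrow> t' = t"
      by blast
    have "\<exists>!r. r \<in> El (x \<cdot> q) \<and> ev x \<pi>\<^sub>1 r = t \<and> ev x \<pi>\<^sub>2 r = \<sigma> j0"
      by (rule univ[OF x(1) _ t(1) x(3)]) (simp_all add: x(2) q)
    then obtain r where r: "r \<in> El (x \<cdot> q)" "ev x \<pi>\<^sub>1 r = t" "ev x \<pi>\<^sub>2 r = \<sigma> j0"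
      and ru: "\<And>r'. \<lbrakk>r' \<in> El (x \<cdot> q); ev x \<pi>\<^sub>1 r' = t; ev x \<pi>\<^sub>2 r' = \<sigma> j0\<rbrakk> \<Longrightarrow> r' = r"
      by blast
    have evj: "ev x (?\<pi> j) r' = ev x (\<pi> j) (ev x \<pi>\<^sub>1 r')" if "j \<in> I" "r' \<in> El (x \<cdot> q)" for j r'
      using cells_ev_vcomp[OF p(1) l(4)[OF that(1)] x(1) _ that(2)] x(2) q that insert by auto
    show "\<exists>!t. t \<in> El (x \<cdot> q) \<and> (\<forall>j\<in>insert j0 I. ev x (?\<pi> j) t = \<sigma> j)"
    proof (rule ex1I[of _ r])
      show "r \<in> El (x \<cdot> q) \<and> (\<forall>j\<in>insert j0 I. ev x (?\<pi> j) r = \<sigma> j)"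
        using r t evj by auto
      fix r' assume a: "r' \<in> El (x \<cdot> q) \<and> (\<forall>j\<in>insert j0 I. ev x (?\<pi> j) r' = \<sigma> j)"
      have "ev x \<pi>\<^sub>1 r' = t"
      proof (rule tu)
        show "ev x \<pi>\<^sub>1 r' \<in> El (x \<cdot> l)" by (rule cells_El[OF p(1)]) (use a x q in simp_all)
        show "\<forall>j\<in>I. ev x (\<pi> j) (ev x \<pi>\<^sub>1 r') = \<sigma> j" using a evj by (metis insertCI)
      qed
      then show "r' = r" using ru a by auto
    qed
  qed simp_all
  then show ?case by blast
qed

text \<open>The equation of an arrow \<open>k\<close> compares two 2-cells from the limit so far
  into the value at the codomain of \<open>k\<close>, so imposing it is an elementwise
  equalizer.\<close>

lemma pointwise_limit_exists:
  assumes D: "is_functor J (Hom K A S) D" and A: "A \<in> Obj K" and J: "category J"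
    and fin: "finite (Ob J)" "finite (Ar J)"
  obtains l \<pi> where "pointwise_limit A J D (Ob J) (Ar J) l \<pi>"
proof -
  have "\<exists>l \<pi>. pointwise_limit A J D (Ob J) R l \<pi>" if "finite R" "R \<subseteq> Ar J" for R
    using that
  proof (induction R rule: finite_induct)
    case empty
    then show ?case using pointwise_limit_objects[OF D A fin(1)] by simp
  next
    case (insert k R)
    then obtain l \<pi> where L: "pointwise_limit A J D (Ob J) R l \<pi>" by blast
    note l = pointwise_limitD[OF L]
    have k: "Dom J k \<in> Ob J" "Cod J k \<in> Ob J" "FA D k \<in> cells (FO D (Dom J k)) (FO D (Cod J k))"
      using insert J is_functor_Hom[OF D] by (auto simp: category.dom_in category.cod_in)
    obtain n e where n: "pointwise_mono n" "n \<in> cells e l"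
      and eq: "\<And>x s. \<lbrakk>x \<in> Mor K; tgt K x = A; s \<in> El (x \<cdot> l)\<rbrakk> \<Longrightarrow>
        s \<in> img x n \<longleftrightarrow> ev x (\<pi> (Dom J k) \<odot> FA D k) s = ev x (\<pi> (Cod J k)) s"
      using pointwise_equalizer[OF l(1,3) cells_vcomp[OF l(4)[OF k(1)] k(3)] l(4)[OF k(2)]] l(2) by metis
    have e: "e \<in> Mor K" "src K e = A" "tgt K e = S" using cells_Mor[OF n(2)] l by auto
    have evj: "ev x (n \<odot> \<pi> j) t = ev x (\<pi> j) (ev x n t)" "ev x n t \<in> El (x \<cdot> l)"
      if "j \<in> Ob J" "x \<in> Mor K" "tgt K x = A" "t \<in> El (x \<cdot> e)" for j x t
      using cells_ev_vcomp[OF n(2) l(4)[OF that(1)]] cells_El[OF n(2)] that e by simp_all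
    have evk: "ev x (\<pi> (Dom J k) \<odot> FA D k) s = ev x (FA D k) (ev x (\<pi> (Dom J k)) s)"
      if "x \<in> Mor K" "tgt K x = A" "s \<in> El (x \<cdot> l)" for x s
      using cells_ev_vcomp[OF l(4)[OF k(1)] k(3)] that l by simp
    have JO: "Dom J k' \<in> Ob J" "Cod J k' \<in> Ob J" if "k' \<in> insert k R" for k'
      using insert.prems that J by (auto simp: category.dom_in category.cod_in)
    have "pointwise_limit A J D (Ob J) (insert k R) e (\<lambda>j. n \<odot> \<pi> j)"
    proof (rule pointwise_limitI)
      show "e \<in> hom1 K A S" using e by (simp add: hom1_iff)
      show "n \<odot> \<pi> j \<in> cells e (FO D j)" if "j \<in> Ob J" for j by (rule cells_vcomp[OF n(2) l(4)[OF that]])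
      show "ev x (FA D k') (ev x (n \<odot> \<pi> (Dom J k')) t) = ev x (n \<odot> \<pi> (Cod J k')) t"
        if x: "x \<in> Mor K" "tgt K x = A" "t \<in> El (x \<cdot> e)" and k': "k' \<in> insert k R" for x t k'
      proof (cases "k' = k")
        case True
        have "ev x n t \<in> img x n" using x img_iff[OF n(2)] by blast
        then show ?thesis
          using eq[OF x(1,2) evj(2)[OF k(1) x]] evk[OF x(1,2) evj(2)[OF k(1) x]] evj(1)[OF _ x] k True by simp
      next
        case False
        then show ?thesis using l(5)[OF x(1,2) evj(2)[OF k(1) x], of k'] k' evj(1)[OF _ x] JO[OF k'] by simp
      qed
      fix x \<sigma> assume x: "x \<in> Mor K" "tgt K x = A" "\<And>j. j \<in> Ob J \<Longrightarrow> \<sigma> j \<in> El (x \<cdot> FO D j)"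
        "\<And>k'. k' \<in> insert k R \<Longrightarrow> ev x (FA D k') (\<sigma> (Dom J k')) = \<sigma> (Cod J k')"
      have "\<exists>!t. t \<in> El (x \<cdot> l) \<and> (\<forall>j\<in>Ob J. ev x (\<pi> j) t = \<sigma> j)"
        by (rule l(6)[OF x(1,2)]) (simp_all add: x(3,4))
      then obtain t where t: "t \<in> El (x \<cdot> l)" "\<And>j. j \<in> Ob J \<Longrightarrow> ev x (\<pi> j) t = \<sigma> j"
        and tu: "\<And>t'. \<lbrakk>t' \<in> El (x \<cdot> l); \<forall>j\<in>Ob J. ev x (\<pi> j) t' = \<sigma> j\<rbrakk> \<Longrightarrow> t' = t"
        by blast
      have "t \<in> img x n" using eq[OF x(1,2) t(1)] evk[OF x(1,2) t(1)] t(2) k x(4)[of k] by simp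
      then obtain r where r: "r \<in> El (x \<cdot> e)" "ev x n r = t" using img_iff[OF n(2)] by blast
      show "\<exists>!t. t \<in> El (x \<cdot> e) \<and> (\<forall>j\<in>Ob J. ev x (n \<odot> \<pi> j) t = \<sigma> j)"
      proof (rule ex1I[of _ r])
        show "r \<in> El (x \<cdot> e) \<and> (\<forall>j\<in>Ob J. ev x (n \<odot> \<pi> j) r = \<sigma> j)"
          using r t evj(1)[OF _ x(1,2) r(1)] by simp
        fix r' assume r': "r' \<in> El (x \<cdot> e) \<and> (\<forall>j\<in>Ob J. ev x (n \<odot> \<pi> j) r' = \<sigma> j)"
        then have "ev x n r' = t"
          using tu[OF evj(2)[OF k(1) x(1,2)]] evj(1)[OF _ x(1,2), of _ r'] by simp
        then show "r' = r" using pointwise_mono_eq[OF n x(1), of r' r] x e r r' by simp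
      qed
    qed
    then show ?case by blast
  qed
  from this[OF fin(2)] show thesis using that by auto
qed

lemma is_cone_Hom:
  "is_cone (Hom K A S) J D l \<pi> \<Longrightarrow> is_functor J (Hom K A S) D \<Longrightarrow>
    l \<in> hom1 K A S \<and> (\<forall>j\<in>Ob J. \<pi> j \<in> cells l (FO D j)) \<and> (\<forall>k\<in>Ar J. \<pi> (Dom J k) \<odot> FA D k = \<pi> (Cod J k))"
  by (auto simp: is_cone_def hom_Hom cells_def)

text \<open>The mediating 2-cell sends an element of the vertex to the one element of
  \<open>l\<close> with matching projections. Uniqueness of that element makes the assignment
  natural, hence realised by a 2-cell.\<close>

lemma pointwise_limit_is_limit:
  assumes L: "pointwise_limit A J D (Ob J) (Ar J) l \<pi>" and D: "is_functor J (Hom K A S) D" and J: "category J"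
  shows "is_limit (Hom K A S) J D l \<pi>"
  unfolding is_limit_def
proof (intro conjI allI impI)
  note l = pointwise_limitD[OF L]
  have JO: "Dom J k \<in> Ob J" "Cod J k \<in> Ob J" if "k \<in> Ar J" for k
    using that J by (auto simp: category.dom_in category.cod_in)
  have "\<pi> (Dom J k) \<odot> FA D k = \<pi> (Cod J k)" if k: "k \<in> Ar J" for k
  proof (rule ev_ext[OF cells_vcomp[OF l(4)[OF JO(1)[OF k]] is_functor_Hom(4)[OF D k]] l(4)[OF JO(2)[OF k]] l(3)])
    fix x s assume x: "x \<in> Mor K" "tgt K x = src K l" "s \<in> El (x \<cdot> l)"
    then show "ev x (\<pi> (Dom J k) \<odot> FA D k) s = ev x (\<pi> (Cod J k)) s"
      using cells_ev_vcomp[OF l(4)[OF JO(1)[OF k]] is_functor_Hom(4)[OF D k] x] l(2) l(5)[OF x(1) _ x(3) k] by simp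
  qed
  then show "is_cone (Hom K A S) J D l \<pi>"
    using l(1-4) by (auto simp: is_cone_def hom1_iff hom_Hom cells_def)
  fix c \<mu> assume "is_cone (Hom K A S) J D c \<mu>"
  then have c: "c \<in> Mor K" "src K c = A" "tgt K c = S" and \<mu>: "\<And>j. j \<in> Ob J \<Longrightarrow> \<mu> j \<in> cells c (FO D j)"
    and cone: "\<And>k. k \<in> Ar J \<Longrightarrow> \<mu> (Dom J k) \<odot> FA D k = \<mu> (Cod J k)"
    using is_cone_Hom[OF _ D] by (auto simp: hom1_iff)
  define \<phi> where "\<phi> x s = (THE t. t \<in> El (x \<cdot> l) \<and> (\<forall>j\<in>Ob J. ev x (\<pi> j) t = ev x (\<mu> j) s))" for x s
  have \<phi>: "\<phi> x s \<in> El (x \<cdot> l)" "\<And>j. j \<in> Ob J \<Longrightarrow> ev x (\<pi> j) (\<phi> x s) = ev x (\<mu> j) s"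
    if x: "x \<in> Mor K" "tgt K x = A" "s \<in> El (x \<cdot> c)" for x s
  proof -
    have "\<exists>!t. t \<in> El (x \<cdot> l) \<and> (\<forall>j\<in>Ob J. ev x (\<pi> j) t = ev x (\<mu> j) s)"
    proof (rule l(6)[OF x(1,2)])
      show "ev x (\<mu> j) s \<in> El (x \<cdot> FO D j)" if "j \<in> Ob J" for j
        by (rule cells_El[OF \<mu>[OF that]]) (use x c in simp_all)
      show "ev x (FA D k) (ev x (\<mu> (Dom J k)) s) = ev x (\<mu> (Cod J k)) s" if k: "k \<in> Ar J" for k
        using cells_ev_vcomp[OF \<mu>[OF JO(1)[OF k]] is_functor_Hom(4)[OF D k], of x s] x c cone[OF k] by simp
    qed
    from theI'[OF this] show "\<phi> x s \<in> El (x \<cdot> l)" "\<And>j. j \<in> Ob J \<Longrightarrow> ev x (\<pi> j) (\<phi> x s) = ev x (\<mu> j) s"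
      by (auto simp: \<phi>_def)
  qed
  have \<phi>_nat: "\<phi> (y \<cdot> x) (y \<cdot> s) = y \<cdot> \<phi> x s"
    if x: "x \<in> Mor K" "tgt K x = src K c" "s \<in> El (x \<cdot> c)" and y: "y \<in> Mor K" "tgt K y = src K x" for x s y
  proof (rule pointwise_limit_eq[OF L D subset_refl])
    have xA: "tgt K x = A" using x c by simp
    show "y \<cdot> x \<in> Mor K" "tgt K (y \<cdot> x) = A" using x y c by simp_all
    have ys: "y \<cdot> s \<in> El ((y \<cdot> x) \<cdot> c)" using El_comp1'[OF x(3) y(1) x(1) c(1)] x y c by simp
    show "\<phi> (y \<cdot> x) (y \<cdot> s) \<in> El ((y \<cdot> x) \<cdot> l)" by (rule \<phi>(1)) (use x y c ys in simp_all)
    show "y \<cdot> \<phi> x s \<in> El ((y \<cdot> x) \<cdot> l)"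
      using El_comp1'[OF \<phi>(1)[OF x(1) xA x(3)] y(1) x(1) l(1)] x y c l by simp
    show "ev (y \<cdot> x) (\<pi> j) (\<phi> (y \<cdot> x) (y \<cdot> s)) = ev (y \<cdot> x) (\<pi> j) (y \<cdot> \<phi> x s)" if j: "j \<in> Ob J" for j
    proof -
      have "ev (y \<cdot> x) (\<pi> j) (\<phi> (y \<cdot> x) (y \<cdot> s)) = ev (y \<cdot> x) (\<mu> j) (y \<cdot> s)"
        by (rule \<phi>(2)) (use x y c ys j in simp_all)
      also have "\<dots> = y \<cdot> ev x (\<mu> j) s" by (rule cells_ev_comp1[OF \<mu>[OF j] x y])
      also have "\<dots> = y \<cdot> ev x (\<pi> j) (\<phi> x s)" using \<phi>(2)[OF x(1) xA x(3) j] by simp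
      also have "\<dots> = ev (y \<cdot> x) (\<pi> j) (y \<cdot> \<phi> x s)"
        using cells_ev_comp1[OF l(4)[OF j] x(1) _ \<phi>(1)[OF x(1) xA x(3)] y] xA l by simp
      finally show ?thesis .
    qed
  qed (use JO in auto)
  obtain u where u: "u \<in> cells c l" "\<And>x s. \<lbrakk>x \<in> Mor K; tgt K x = src K c; s \<in> El (x \<cdot> c)\<rbrakk> \<Longrightarrow> ev x u s = \<phi> x s"
    by (rule ev_exists[of c l \<phi>]) (use c l \<phi>(1) \<phi>_nat in auto)
  have evu: "ev x (u' \<odot> \<pi> j) s = ev x (\<pi> j) (ev x u' s)" "ev x u' s \<in> El (x \<cdot> l)"
    if "u' \<in> cells c l" "j \<in> Ob J" "x \<in> Mor K" "tgt K x = src K c" "s \<in> El (x \<cdot> c)" for u' j x s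
    using cells_ev_vcomp[OF that(1) l(4)[OF that(2)] that(3-5)] cells_El[OF that(1,3-5)] by simp_all
  have hom: "hom (Hom K A S) c l = cells c l" by (rule hom_Hom_cells) (use c l in \<open>simp_all add: hom1_iff\<close>)
  show "\<exists>!u. u \<in> hom (Hom K A S) c l \<and> (\<forall>j\<in>Ob J. u \<bullet>\<^bsub>Hom K A S\<^esub> \<pi> j = \<mu> j)"
    unfolding hom
  proof (rule ex1I[of _ u])
    have "u \<odot> \<pi> j = \<mu> j" if j: "j \<in> Ob J" for j
      by (rule ev_ext[OF cells_vcomp[OF u(1) l(4)[OF j]] \<mu>[OF j] c(3)]) (use evu u j \<phi>(2) c in simp_all)
    then show "u \<in> cells c l \<and> (\<forall>j\<in>Ob J. u \<bullet>\<^bsub>Hom K A S\<^esub> \<pi> j = \<mu> j)" using u by simp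
    fix u' assume u': "u' \<in> cells c l \<and> (\<forall>j\<in>Ob J. u' \<bullet>\<^bsub>Hom K A S\<^esub> \<pi> j = \<mu> j)"
    show "u' = u"
    proof (rule ev_ext[OF _ u(1) c(3)])
      show "u' \<in> cells c l" using u' by simp
      fix x s assume x: "x \<in> Mor K" "tgt K x = src K c" "s \<in> El (x \<cdot> c)"
      show "ev x u' s = ev x u s"
      proof (rule pointwise_limit_eq[OF L D subset_refl])
        show "ev x (\<pi> j) (ev x u' s) = ev x (\<pi> j) (ev x u s)" if "j \<in> Ob J" for j
          using evu(1)[of u' j x s] evu(1)[of u j x s] x u u' that \<open>\<And>j. j \<in> Ob J \<Longrightarrow> u \<odot> \<pi> j = \<mu> j\<close> by simp
        show "ev x u' s \<in> El (x \<cdot> l)" "ev x u s \<in> El (x \<cdot> l)"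
          by (rule cells_El[of _ c]; use u u' x in simp)+
      qed (use x c JO in auto)
    qed
  qed
qed

text \<open>The stages \<open>x\<close> over \<open>A'\<close> become the stages
  \<open>x \<cdot> f\<close> over \<open>A\<close>, where the universal property is already
  known.\<close>

lemma pointwise_limit_pre:
  assumes L: "pointwise_limit A J D (Ob J) (Ar J) l \<pi>" and D: "is_functor J (Hom K A S) D" and J: "category J"
    and f: "f \<in> hom1 K A' A"
  shows "pointwise_limit A' J (comp_funct D (pre K f)) (Ob J) (Ar J) (f \<cdot> l) (\<lambda>j. f \<rhd> \<pi> j)"
proof (rule pointwise_limitI)
  note l = pointwise_limitD[OF L]
  note DD = is_functor_Hom[OF D]
  have f' [simp]: "f \<in> Mor K" "src K f = A'" "tgt K f = A" using f by (simp_all add: hom1_iff)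
  have JO: "Dom J k \<in> Ob J" "Cod J k \<in> Ob J" if "k \<in> Ar J" for k
    using that J by (auto simp: category.dom_in category.cod_in)
  have FO: "FO (comp_funct D (pre K f)) j = f \<cdot> FO D j" "FA (comp_funct D (pre K f)) k = f \<rhd> FA D k" for j k
    by (simp_all add: comp_funct_def pre_def)
  show "f \<cdot> l \<in> hom1 K A' S" using l by (simp add: hom1_iff)
  show "f \<rhd> \<pi> j \<in> cells (f \<cdot> l) (FO (comp_funct D (pre K f)) j)" if "j \<in> Ob J" for j
    unfolding FO by (rule cells_lwhisker[OF l(4)[OF that]]) (use l in simp_all)
  have ev\<pi>: "ev x (f \<rhd> \<pi> j) t = ev (x \<cdot> f) (\<pi> j) t" if "x \<in> Mor K" "tgt K x = A'" "j \<in> Ob J" for x t j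
    by (rule cells_ev_lwhisker[OF l(4)[OF that(3)]]) (use l that in simp_all)
  have evk: "ev x (f \<rhd> FA D k) t = ev (x \<cdot> f) (FA D k) t" if "x \<in> Mor K" "tgt K x = A'" "k \<in> Ar J" for x t k
    by (rule cells_ev_lwhisker[OF DD(4)[OF that(3)]]) (use DD(2) JO that in simp_all)
  show "ev x (FA (comp_funct D (pre K f)) k) (ev x (f \<rhd> \<pi> (Dom J k)) t) = ev x (f \<rhd> \<pi> (Cod J k)) t"
    if x: "x \<in> Mor K" "tgt K x = A'" "t \<in> El (x \<cdot> (f \<cdot> l))" "k \<in> Ar J" for x t k
    unfolding FO using l(5)[of "x \<cdot> f" t k] x ev\<pi> evk JO l by simp
  fix x \<sigma> assume x: "x \<in> Mor K" "tgt K x = A'"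
    "\<And>j. j \<in> Ob J \<Longrightarrow> \<sigma> j \<in> El (x \<cdot> FO (comp_funct D (pre K f)) j)"
    "\<And>k. k \<in> Ar J \<Longrightarrow> ev x (FA (comp_funct D (pre K f)) k) (\<sigma> (Dom J k)) = \<sigma> (Cod J k)"
  have "\<exists>!t. t \<in> El ((x \<cdot> f) \<cdot> l) \<and> (\<forall>j\<in>Ob J. ev (x \<cdot> f) (\<pi> j) t = \<sigma> j)"
  proof (rule l(6))
    show "\<sigma> j \<in> El ((x \<cdot> f) \<cdot> FO D j)" if "j \<in> Ob J" for j using x(1,2) x(3)[OF that] DD(1-3)[of j] that by (simp add: FO)
    show "ev (x \<cdot> f) (FA D k) (\<sigma> (Dom J k)) = \<sigma> (Cod J k)" if "k \<in> Ar J" for k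
      using x(4)[OF that] evk[OF x(1,2) that] by (simp add: FO)
  qed (use x in simp_all)
  then show "\<exists>!t. t \<in> El (x \<cdot> (f \<cdot> l)) \<and> (\<forall>j\<in>Ob J. ev x (f \<rhd> \<pi> j) t = \<sigma> j)"
    using x(1,2) l(1,2) ev\<pi>[OF x(1,2)] by (simp cong: ball_cong)
qed

text \<open>Comparison with an elementwise limit \<open>l0\<close> gives \<open>u\<close> and
  \<open>u0\<close> with \<open>u \<odot> u0\<close> an identity. This retraction suffices: matching
  elements are found through \<open>u0\<close>, and their uniqueness is checked through
  \<open>u\<close>.\<close>

lemma is_limit_pointwise:
  assumes lim: "is_limit (Hom K A S) J D l \<pi>" and D: "is_functor J (Hom K A S) D"
    and A: "A \<in> Obj K" and J: "category J" "finite (Ob J)" "finite (Ar J)"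
  shows "pointwise_limit A J D (Ob J) (Ar J) l \<pi>"
proof -
  have JO: "Dom J k \<in> Ob J" "Cod J k \<in> Ob J" if "k \<in> Ar J" for k
    using that J(1) by (auto simp: category.dom_in category.cod_in)
  obtain l0 \<pi>0 where L0: "pointwise_limit A J D (Ob J) (Ar J) l0 \<pi>0"
    using pointwise_limit_exists[OF D A J] by blast
  note l0 = pointwise_limitD[OF L0]
  have lim0: "is_limit (Hom K A S) J D l0 \<pi>0" by (rule pointwise_limit_is_limit[OF L0 D J(1)])
  have c: "is_cone (Hom K A S) J D l \<pi>" "is_cone (Hom K A S) J D l0 \<pi>0"
    using lim lim0 by (auto simp: is_limit_def)
  have l: "l \<in> hom1 K A S" and \<pi>: "\<And>j. j \<in> Ob J \<Longrightarrow> \<pi> j \<in> cells l (FO D j)"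
    and cone: "\<And>k. k \<in> Ar J \<Longrightarrow> \<pi> (Dom J k) \<odot> FA D k = \<pi> (Cod J k)"
    using is_cone_Hom[OF c(1) D] by auto
  have l' [simp]: "l \<in> Mor K" "src K l = A" "tgt K l = S" using l by (simp_all add: hom1_iff)
  have l0h: "l0 \<in> hom1 K A S" using l0 by (simp add: hom1_iff)
  note hom = hom_Hom_cells[OF l l0h] hom_Hom_cells[OF l0h l] hom_Hom_cells[OF l l]
  have univ: "\<exists>!u. u \<in> hom (Hom K A S) b l' \<and> (\<forall>j\<in>Ob J. u \<odot> \<pi>' j = \<mu> j)"
    if "is_limit (Hom K A S) J D l' \<pi>'" "is_cone (Hom K A S) J D b \<mu>" for l' \<pi>' b \<mu>
    using that unfolding is_limit_def Hom_simps by blast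
  obtain u where u: "u \<in> cells l l0" "\<And>j. j \<in> Ob J \<Longrightarrow> u \<odot> \<pi>0 j = \<pi> j"
    using univ[OF lim0 c(1), unfolded hom] by blast
  obtain u0 where u0: "u0 \<in> cells l0 l" "\<And>j. j \<in> Ob J \<Longrightarrow> u0 \<odot> \<pi> j = \<pi>0 j"
    using univ[OF lim c(2), unfolded hom] by blast
  have uu: "u \<odot> u0 = id2 K l"
  proof -
    have "\<exists>!v. v \<in> cells l l \<and> (\<forall>j\<in>Ob J. v \<odot> \<pi> j = \<pi> j)"
      using univ[OF lim c(1), unfolded hom] by blast
    moreover have "u \<odot> u0 \<in> cells l l" "id2 K l \<in> cells l l" by (auto intro: cells_vcomp[OF u(1) u0(1)] cells_id2)
    moreover have "(u \<odot> u0) \<odot> \<pi> j = \<pi> j" "id2 K l \<odot> \<pi> j = \<pi> j" if "j \<in> Ob J" for j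
      using cells_assoc[OF u(1) u0(1) \<pi>[OF that]] u u0 that cells_id2_vcomp[OF \<pi>[OF that]] by simp_all
    ultimately show ?thesis by blast
  qed
  show ?thesis
  proof (rule pointwise_limitI[OF l \<pi>])
    show "ev x (FA D k) (ev x (\<pi> (Dom J k)) t) = ev x (\<pi> (Cod J k)) t"
      if x: "x \<in> Mor K" "tgt K x = A" "t \<in> El (x \<cdot> l)" and k: "k \<in> Ar J" for x t k
      using cells_ev_vcomp[OF \<pi>[OF JO(1)[OF k]] is_functor_Hom(4)[OF D k] x(1) _ x(3)] x(2) cone[OF k] by simp
    fix x \<sigma> assume x: "x \<in> Mor K" "tgt K x = A" "\<And>j. j \<in> Ob J \<Longrightarrow> \<sigma> j \<in> El (x \<cdot> FO D j)"
      "\<And>k. k \<in> Ar J \<Longrightarrow> ev x (FA D k) (\<sigma> (Dom J k)) = \<sigma> (Cod J k)"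
    have "\<exists>!t. t \<in> El (x \<cdot> l0) \<and> (\<forall>j\<in>Ob J. ev x (\<pi>0 j) t = \<sigma> j)"
      by (rule l0(6)[OF x(1,2)]) (simp_all add: x(3,4))
    then obtain t where t: "t \<in> El (x \<cdot> l0)" "\<And>j. j \<in> Ob J \<Longrightarrow> ev x (\<pi>0 j) t = \<sigma> j"
      and tu: "\<And>t'. \<lbrakk>t' \<in> El (x \<cdot> l0); \<forall>j\<in>Ob J. ev x (\<pi>0 j) t' = \<sigma> j\<rbrakk> \<Longrightarrow> t' = t"
      by blast
    show "\<exists>!t. t \<in> El (x \<cdot> l) \<and> (\<forall>j\<in>Ob J. ev x (\<pi> j) t = \<sigma> j)"
    proof (rule ex1I[of _ "ev x u0 t"])
      show "ev x u0 t \<in> El (x \<cdot> l) \<and> (\<forall>j\<in>Ob J. ev x (\<pi> j) (ev x u0 t) = \<sigma> j)"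
        using cells_El[OF u0(1) x(1) _ t(1)] cells_ev_vcomp[OF u0(1) \<pi> x(1) _ t(1), symmetric] x(2) l0(2) u0(2) t(2)
        by simp
      fix t' assume t': "t' \<in> El (x \<cdot> l) \<and> (\<forall>j\<in>Ob J. ev x (\<pi> j) t' = \<sigma> j)"
      then have t'l: "t' \<in> El (x \<cdot> l)" by blast
      have "ev x u t' = t"
        by (rule tu) (use cells_El[OF u(1) x(1) _ t'l] cells_ev_vcomp[OF u(1) l0(4) x(1) _ t'l, symmetric] x(2) u(2) t' in simp_all)
      then show "t' = ev x u0 t"
        using cells_ev_vcomp[OF u(1) u0(1) x(1) _ t'l] uu ev_id2[of l x t'] x t'l by simp
    qed
  qed
qed

lemma finite_limits: "internal_finite_limits K S"
proof -
  have lim: "\<exists>l \<pi>. is_limit (Hom K A S) J D l \<pi>"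
    if "A \<in> Obj K" "finite_category J" "is_functor J (Hom K A S) D" for A J D
    using pointwise_limit_exists[of J A D] pointwise_limit_is_limit that unfolding finite_category_def by metis
  have pres: "preserves_finite_limits (Hom K A S) (Hom K A' S) (pre K f)"
    if "A \<in> Obj K" "A' \<in> Obj K" "f \<in> hom1 K A' A" for A A' f
    unfolding preserves_finite_limits_def
  proof (intro allI impI, elim conjE)
    fix J :: "(nat, nat) cat" and D l \<pi>
    assume a: "finite_category J" "is_functor J (Hom K A S) D" "is_limit (Hom K A S) J D l \<pi>"
    then have J: "category J" "finite (Ob J)" "finite (Ar J)" by (auto simp: finite_category_def)
    show "is_limit (Hom K A' S) J (comp_funct D (pre K f)) (FO (pre K f) l) (\<lambda>j. FA (pre K f) (\<pi> j))"
      using pointwise_limit_is_limit[OF pointwise_limit_pre[OF is_limit_pointwise[OF a(3,2) that(1) J] a(2) J(1) that(3)]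
          is_functor_comp[OF a(2) is_functor_pre[OF that(3)]] J(1)]
      by (simp add: pre_def)
  qed
  have "S \<in> Obj K" using tgt_Obj[OF p_Mor] by simp
  then show ?thesis using lim pres unfolding internal_finite_limits_def has_finite_limits_def by blast
qed

section \<open>Pointwise characterisations of monomorphisms, products and pullbacks\<close>

lemma pointwise_monoD:
  assumes "pointwise_mono n" "n \<in> cells x f"
  shows "x \<in> Mor K" "f \<in> Mor K" "src K x = src K f" "tgt K x = S" "tgt K f = S" "dom2 K n = x" "cod2 K n = f" "n \<in> Cell K"
  using cells_Mor[OF assms(2)] assms by (auto simp: pointwise_mono_def cells_def)

lemma pointwise_mono_cancel:
  assumes n: "pointwise_mono n" "n \<in> cells x f" and u: "u \<in> cells y x" "v \<in> cells y x" "u \<odot> n = v \<odot> n"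
  shows "u = v"
proof (rule ev_ext[OF u(1,2)])
  note N = pointwise_monoD[OF n] and Y = cells_Mor[OF u(1)]
  show "tgt K y = S" using N Y by simp
  fix z s assume z: "z \<in> Mor K" "tgt K z = src K y" "s \<in> El (z \<cdot> y)"
  show "ev z u s = ev z v s"
    using pointwise_mono_eq[OF n z(1) _ cells_El[OF u(1) z] cells_El[OF u(2) z]]
      cells_ev_vcomp[OF u(1) n(2) z] cells_ev_vcomp[OF u(2) n(2) z] u(3) z N Y by simp
qed

lemma pointwise_mono_is_mono:
  assumes n: "pointwise_mono n" "n \<in> cells x f"
  shows "is_mono (Hom K (src K f) S) n"
  using pointwise_mono_cancel[OF n] pointwise_monoD[OF n] unfolding is_mono_Hom by metis

text \<open>With \<open>is_mono_pointwise\<close> this makes every monomorphism between morphisms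
  into \<open>S\<close> stable, so the monomorphism object of \<open>S\<close> names all of
  them.\<close>

lemma pointwise_mono_stable:
  assumes n: "pointwise_mono n" "n \<in> cells x f"
  shows "stable_mono K (src K f) S n"
  unfolding stable_mono_def
proof (intro conjI ballI)
  note N = pointwise_monoD[OF n]
  show "n \<in> Ar (Hom K (src K f) S)" using N by simp
  fix A' b assume b: "A' \<in> Obj K" "b \<in> hom1 K A' (src K f)"
  then have b': "b \<in> Mor K" "src K b = A'" "tgt K b = src K x" using N by (simp_all add: hom1_iff)
  have "is_mono (Hom K (src K (b \<cdot> f)) S) (b \<rhd> n)"
    by (rule pointwise_mono_is_mono[OF pointwise_mono_lwhisker[OF n b'(1,3)] cells_lwhisker[OF n(2) b'(1,3)]])
  then show "is_mono (Hom K A' S) (b \<rhd> n)" using N b' by simp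
qed

text \<open>The kernel pair of \<open>m\<close> exists pointwise, so \<open>m\<close> cannot identify distinct elements.\<close>

lemma is_mono_pointwise:
  assumes m: "is_mono (Hom K A S) m"
  shows "pointwise_mono m"
proof -
  define w f where wf: "w = dom2 K m" "f = cod2 K m"
  have mc: "m \<in> cells w f" and w: "w \<in> Mor K" "src K w = A" "tgt K w = S"
    and canc: "\<And>x u v. \<lbrakk>u \<in> cells x w; v \<in> cells x w; u \<odot> m = v \<odot> m\<rbrakk> \<Longrightarrow> u = v"
    using m unfolding is_mono_Hom by (auto simp: wf cells_def)
  obtain q \<pi>\<^sub>1 \<pi>\<^sub>2 where "pointwise_product w w q \<pi>\<^sub>1 \<pi>\<^sub>2"
    using pointwise_product_exists[OF w(1,3) w(1) refl w(3)] by blast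
  then have \<pi>: "\<pi>\<^sub>1 \<in> cells q w" "\<pi>\<^sub>2 \<in> cells q w" and tq: "tgt K q = S"
    and univ: "\<And>x s s'. \<lbrakk>x \<in> Mor K; tgt K x = src K q; s \<in> El (x \<cdot> w); s' \<in> El (x \<cdot> w)\<rbrakk> \<Longrightarrow>
      \<exists>!r. r \<in> El (x \<cdot> q) \<and> ev x \<pi>\<^sub>1 r = s \<and> ev x \<pi>\<^sub>2 r = s'"
    by (auto simp: pointwise_product_def)
  have q: "q \<in> Mor K" "src K q = A" using cells_Mor[OF \<pi>(1)] w by auto
  obtain n e where n: "pointwise_mono n" "n \<in> cells e q"
    and eq: "\<And>x s. \<lbrakk>x \<in> Mor K; tgt K x = src K q; s \<in> El (x \<cdot> q)\<rbrakk> \<Longrightarrow>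
      s \<in> img x n \<longleftrightarrow> ev x (\<pi>\<^sub>1 \<odot> m) s = ev x (\<pi>\<^sub>2 \<odot> m) s"
    using pointwise_equalizer[OF q(1) tq cells_vcomp[OF \<pi>(1) mc] cells_vcomp[OF \<pi>(2) mc]] by blast
  note N = pointwise_monoD[OF n]
  have "(n \<odot> \<pi>\<^sub>1) \<odot> m = (n \<odot> \<pi>\<^sub>2) \<odot> m"
    unfolding cells_assoc[OF n(2) \<pi>(1) mc] cells_assoc[OF n(2) \<pi>(2) mc]
  proof (rule ev_ext[OF cells_vcomp[OF n(2) cells_vcomp[OF \<pi>(1) mc]] cells_vcomp[OF n(2) cells_vcomp[OF \<pi>(2) mc]] N(4)])
    fix x s assume x: "x \<in> Mor K" "tgt K x = src K e" "s \<in> El (x \<cdot> e)"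
    have "ev x n s \<in> img x n" using x img_iff[OF n(2)] by blast
    then show "ev x (n \<odot> (\<pi>\<^sub>1 \<odot> m)) s = ev x (n \<odot> (\<pi>\<^sub>2 \<odot> m)) s"
      using eq[OF x(1) _ cells_El[OF n(2) x]] cells_ev_vcomp[OF n(2) cells_vcomp[OF \<pi>(1) mc] x]
        cells_ev_vcomp[OF n(2) cells_vcomp[OF \<pi>(2) mc] x] x(2) N(3) by simp
  qed
  then have n12: "n \<odot> \<pi>\<^sub>1 = n \<odot> \<pi>\<^sub>2"
    by (rule canc[OF cells_vcomp[OF n(2) \<pi>(1)] cells_vcomp[OF n(2) \<pi>(2)]])
  show ?thesis
  proof (rule pointwise_monoI[OF mc w(3)])
    fix x s s' assume x: "x \<in> Mor K" "tgt K x = src K w" "s \<in> El (x \<cdot> w)" "s' \<in> El (x \<cdot> w)" "ev x m s = ev x m s'"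
    then have xq: "tgt K x = src K q" using w q by simp
    then obtain r where r: "r \<in> El (x \<cdot> q)" "ev x \<pi>\<^sub>1 r = s" "ev x \<pi>\<^sub>2 r = s'"
      using univ[OF x(1) _ x(3,4)] by blast
    then have "r \<in> img x n"
      using eq[OF x(1) xq r(1)] cells_ev_vcomp[OF \<pi>(1) mc x(1) xq r(1)] cells_ev_vcomp[OF \<pi>(2) mc x(1) xq r(1)] x(5) by simp
    then obtain r' where r': "r' \<in> El (x \<cdot> e)" "ev x n r' = r" using img_iff[OF n(2)] by blast
    have "s = ev x (n \<odot> \<pi>\<^sub>1) r'" "s' = ev x (n \<odot> \<pi>\<^sub>2) r'"
      using cells_ev_vcomp[OF n(2) \<pi>(1) x(1) _ r'(1)] cells_ev_vcomp[OF n(2) \<pi>(2) x(1) _ r'(1)] r r' N xq by simp_all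
    then show "s = s'" using n12 by simp
  qed
qed

lemma stable_mono_pointwise:
  assumes "stable_mono K A S m"
  shows "pointwise_mono m"
proof -
  have m: "m \<in> Cell K" "src K (dom2 K m) = A" using assms by (auto simp: stable_mono_def)
  then have A: "A \<in> Obj K" by auto
  then have "id1 K A \<in> hom1 K A A" by (simp add: hom1_iff)
  then have "is_mono (Hom K A S) (id1 K A \<rhd> m)" using assms A unfolding stable_mono_def by blast
  then show ?thesis using m by (simp add: is_mono_pointwise)
qed

text \<open>Preimages under \<open>n\<close> are unique by injectivity, so choosing them gives a
  natural family, which genericity realises.\<close>

lemma factor_through_subobject:
  assumes n: "pointwise_mono n" "n \<in> cells x f" and g: "\<gamma> \<in> cells y f"
    and sub: "\<And>z. \<lbrakk>z \<in> Mor K; tgt K z = src K f\<rbrakk> \<Longrightarrow> img z \<gamma> \<subseteq> img z n"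
  obtains \<sigma> where "\<sigma> \<in> cells y x" "\<sigma> \<odot> n = \<gamma>"
proof -
  note N = pointwise_monoD[OF n]
  have y: "y \<in> Mor K" "src K y = src K f" "tgt K y = S" using cells_Mor[OF g] N by auto
  define \<phi> where "\<phi> z s = (SOME r. r \<in> El (z \<cdot> x) \<and> ev z n r = ev z \<gamma> s)" for z s
  have \<phi>: "\<phi> z s \<in> El (z \<cdot> x) \<and> ev z n (\<phi> z s) = ev z \<gamma> s"
    if z: "z \<in> Mor K" "tgt K z = src K y" "s \<in> El (z \<cdot> y)" for z s
  proof -
    have "img z \<gamma> \<subseteq> img z n" by (rule sub) (use z y in simp_all)
    moreover have "ev z \<gamma> s \<in> img z \<gamma>" using img_iff[OF g] z by blast
    ultimately have "\<exists>r. r \<in> El (z \<cdot> x) \<and> ev z n r = ev z \<gamma> s"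
      using img_iff[OF n(2)] by blast
    then show ?thesis unfolding \<phi>_def by (rule someI_ex)
  qed
  have nat: "\<phi> (z' \<cdot> z) (z' \<cdot> s) = z' \<cdot> \<phi> z s"
    if z: "z \<in> Mor K" "tgt K z = src K y" "s \<in> El (z \<cdot> y)" and z': "z' \<in> Mor K" "tgt K z' = src K z" for z s z'
  proof (rule pointwise_mono_eq[OF n, of "z' \<cdot> z"])
    have zx: "tgt K z = src K x" using z y N by simp
    show "z' \<cdot> z \<in> Mor K" "tgt K (z' \<cdot> z) = src K x" using z z' zx by simp_all
    have zs: "z' \<cdot> s \<in> El ((z' \<cdot> z) \<cdot> y)" using El_comp1'[OF z(3) z'(1) z(1) y(1)] z z' y by simp
    have P: "\<phi> (z' \<cdot> z) (z' \<cdot> s) \<in> El ((z' \<cdot> z) \<cdot> x) \<and>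
        ev (z' \<cdot> z) n (\<phi> (z' \<cdot> z) (z' \<cdot> s)) = ev (z' \<cdot> z) \<gamma> (z' \<cdot> s)"
      by (rule \<phi>) (use z z' zs in simp_all)
    then show "\<phi> (z' \<cdot> z) (z' \<cdot> s) \<in> El ((z' \<cdot> z) \<cdot> x)" by blast
    have Q: "\<phi> z s \<in> El (z \<cdot> x)" "ev z n (\<phi> z s) = ev z \<gamma> s" using \<phi>[OF z] by auto
    show "z' \<cdot> \<phi> z s \<in> El ((z' \<cdot> z) \<cdot> x)"
      using El_comp1'[OF Q(1) z'(1) z(1) N(1) zx z'(2)] z z' zx N(1) by simp
    show "ev (z' \<cdot> z) n (\<phi> (z' \<cdot> z) (z' \<cdot> s)) = ev (z' \<cdot> z) n (z' \<cdot> \<phi> z s)"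
      using P cells_ev_comp1[OF n(2) z(1) zx Q(1) z'] cells_ev_comp1[OF g z z'] Q(2) by simp
  qed
  obtain \<sigma> where \<sigma>: "\<sigma> \<in> cells y x" "\<And>z s. \<lbrakk>z \<in> Mor K; tgt K z = src K y; s \<in> El (z \<cdot> y)\<rbrakk> \<Longrightarrow> ev z \<sigma> s = \<phi> z s"
    by (rule ev_exists[of y x \<phi>]) (use y N \<phi> nat in auto)
  have "\<sigma> \<odot> n = \<gamma>"
    by (rule ev_ext[OF cells_vcomp[OF \<sigma>(1) n(2)] g y(3)]) (use cells_ev_vcomp[OF \<sigma>(1) n(2)] \<sigma>(2) \<phi> in simp)
  with \<sigma> show thesis by (intro that)
qed

text \<open>Equal images give factorizations both ways, inverse to each other because monomorphisms
  cancel. Hence subobjects can be compared by their elements.\<close>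

lemma isomorphic_iff_same_img:
  assumes m: "pointwise_mono m" "m \<in> cells x f" and n: "pointwise_mono n" "n \<in> cells y f"
  shows "(\<exists>\<sigma> \<sigma>'. \<sigma> \<in> cells y x \<and> invertible2 \<sigma> \<sigma>' \<and> n = \<sigma> \<odot> m) \<longleftrightarrow>
    (\<forall>z\<in>Mor K. tgt K z = src K f \<longrightarrow> img z n = img z m)"
proof -
  note M = pointwise_monoD[OF m] and N = pointwise_monoD[OF n]
  have sub: "img z n \<subseteq> img z m"
    if \<sigma>: "\<sigma> \<in> cells y x" "n = \<sigma> \<odot> m" and m: "m \<in> cells x f" and n: "n \<in> cells y f"
      and z: "z \<in> Mor K" "tgt K z = src K y" for \<sigma> z x y m n
  proof
    fix s assume "s \<in> img z n"
    then obtain s' where s': "s' \<in> El (z \<cdot> y)" "ev z n s' = s" using img_iff[OF n] by blast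
    then have "ev z m (ev z \<sigma> s') = s" using cells_ev_vcomp[OF \<sigma>(1) m z s'(1)] \<sigma>(2) by simp
    then show "s \<in> img z m" using img_iff[OF m] cells_El[OF \<sigma>(1) z s'(1)] by blast
  qed
  show ?thesis
  proof
    assume "\<exists>\<sigma> \<sigma>'. \<sigma> \<in> cells y x \<and> invertible2 \<sigma> \<sigma>' \<and> n = \<sigma> \<odot> m"
    then obtain \<sigma> \<sigma>' where \<sigma>: "\<sigma> \<in> cells y x" "invertible2 \<sigma> \<sigma>'" "n = \<sigma> \<odot> m" by blast
    then have \<sigma>': "\<sigma>' \<in> cells x y" "\<sigma>' \<odot> \<sigma> = id2 K x" by (simp_all add: cells_invertible2[OF \<sigma>(1)])
    have mn: "m = \<sigma>' \<odot> n"
      using \<sigma>(3) cells_assoc[OF \<sigma>'(1) \<sigma>(1) m(2)] \<sigma>'(2) cells_id2_vcomp[OF m(2)] by simp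
    show "\<forall>z\<in>Mor K. tgt K z = src K f \<longrightarrow> img z n = img z m"
    proof (intro ballI impI equalityI)
      fix z assume z: "z \<in> Mor K" "tgt K z = src K f"
      show "img z n \<subseteq> img z m" by (rule sub[OF \<sigma>(1,3) m(2) n(2) z(1)]) (use z N in simp)
      show "img z m \<subseteq> img z n" by (rule sub[OF \<sigma>'(1) mn n(2) m(2) z(1)]) (use z M in simp)
    qed
  next
    assume eq: "\<forall>z\<in>Mor K. tgt K z = src K f \<longrightarrow> img z n = img z m"
    obtain \<sigma> where \<sigma>: "\<sigma> \<in> cells y x" "\<sigma> \<odot> m = n" using factor_through_subobject[OF m n(2)] eq by blast
    obtain \<sigma>' where \<sigma>': "\<sigma>' \<in> cells x y" "\<sigma>' \<odot> n = m" using factor_through_subobject[OF n m(2)] eq by blast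
    have "\<sigma> \<odot> \<sigma>' = id2 K y"
      by (rule pointwise_mono_cancel[OF n cells_vcomp[OF \<sigma>(1) \<sigma>'(1)] cells_id2[OF N(1)]])
        (use cells_assoc[OF \<sigma>(1) \<sigma>'(1) n(2)] \<sigma>(2) \<sigma>'(2) cells_id2_vcomp[OF n(2)] in simp)
    moreover have "\<sigma>' \<odot> \<sigma> = id2 K x"
      by (rule pointwise_mono_cancel[OF m cells_vcomp[OF \<sigma>'(1) \<sigma>(1)] cells_id2[OF M(1)]])
        (use cells_assoc[OF \<sigma>'(1) \<sigma>(1) m(2)] \<sigma>(2) \<sigma>'(2) cells_id2_vcomp[OF m(2)] in simp)
    ultimately have "invertible2 \<sigma> \<sigma>'" using \<sigma>' by (simp add: cells_invertible2[OF \<sigma>(1)])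
    then show "\<exists>\<sigma> \<sigma>'. \<sigma> \<in> cells y x \<and> invertible2 \<sigma> \<sigma>' \<and> n = \<sigma> \<odot> m" using \<sigma> by blast
  qed
qed

lemma pointwise_productD:
  assumes "pointwise_product f h q \<pi>\<^sub>1 \<pi>\<^sub>2"
  shows "\<pi>\<^sub>1 \<in> cells q f" "\<pi>\<^sub>2 \<in> cells q h" "q \<in> Mor K" "tgt K q = S"
    "f \<in> Mor K" "h \<in> Mor K" "src K f = src K q" "src K h = src K q" "tgt K f = S" "tgt K h = S"
proof -
  show p: "\<pi>\<^sub>1 \<in> cells q f" "\<pi>\<^sub>2 \<in> cells q h" "tgt K q = S" using assms by (auto simp: pointwise_product_def)
  show "q \<in> Mor K" "f \<in> Mor K" "h \<in> Mor K" "src K f = src K q" "src K h = src K q" "tgt K f = S" "tgt K h = S"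
    using cells_Mor[OF p(1)] cells_Mor[OF p(2)] p(3) by simp_all
qed

lemma pointwise_product_pair:
  assumes "pointwise_product f h q \<pi>\<^sub>1 \<pi>\<^sub>2" "x \<in> Mor K" "tgt K x = src K q" "s \<in> El (x \<cdot> f)" "s' \<in> El (x \<cdot> h)"
  obtains r where "r \<in> El (x \<cdot> q)" "ev x \<pi>\<^sub>1 r = s" "ev x \<pi>\<^sub>2 r = s'"
  using assms unfolding pointwise_product_def by blast

lemma pointwise_product_eq:
  assumes P: "pointwise_product f h q \<pi>\<^sub>1 \<pi>\<^sub>2" and x: "x \<in> Mor K" "tgt K x = src K q"
    and r: "r \<in> El (x \<cdot> q)" "r' \<in> El (x \<cdot> q)" "ev x \<pi>\<^sub>1 r = ev x \<pi>\<^sub>1 r'" "ev x \<pi>\<^sub>2 r = ev x \<pi>\<^sub>2 r'"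
  shows "r = r'"
proof -
  note D = pointwise_productD[OF P]
  have "\<exists>!y. y \<in> El (x \<cdot> q) \<and> ev x \<pi>\<^sub>1 y = ev x \<pi>\<^sub>1 r \<and> ev x \<pi>\<^sub>2 y = ev x \<pi>\<^sub>2 r"
    using P x cells_El[OF D(1) x r(1)] cells_El[OF D(2) x r(1)] unfolding pointwise_product_def by blast
  then show ?thesis using r by metis
qed

lemma pointwise_product_cells_eq:
  assumes P: "pointwise_product f h q \<pi>\<^sub>1 \<pi>\<^sub>2" and u: "u \<in> cells c q" "v \<in> cells c q"
    "u \<odot> \<pi>\<^sub>1 = v \<odot> \<pi>\<^sub>1" "u \<odot> \<pi>\<^sub>2 = v \<odot> \<pi>\<^sub>2"
  shows "u = v"
proof -
  note D = pointwise_productD[OF P] and C = cells_Mor[OF u(1)]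
  have sc: "src K c = src K q" "tgt K c = S" using C D by simp_all
  show ?thesis
  proof (rule ev_ext[OF u(1,2) sc(2)])
    fix x s assume x: "x \<in> Mor K" "tgt K x = src K c" "s \<in> El (x \<cdot> c)"
    show "ev x u s = ev x v s"
    proof (rule pointwise_product_eq[OF P x(1) _ cells_El[OF u(1) x] cells_El[OF u(2) x]])
      show "tgt K x = src K q" using x sc by simp
      show "ev x \<pi>\<^sub>1 (ev x u s) = ev x \<pi>\<^sub>1 (ev x v s)"
        using cells_ev_vcomp[OF u(1) D(1) x] cells_ev_vcomp[OF u(2) D(1) x] u(3) by simp
      show "ev x \<pi>\<^sub>2 (ev x u s) = ev x \<pi>\<^sub>2 (ev x v s)"
        using cells_ev_vcomp[OF u(1) D(2) x] cells_ev_vcomp[OF u(2) D(2) x] u(4) by simp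
    qed
  qed
qed

lemma pointwise_product_tuple:
  assumes P: "pointwise_product f h q \<pi>\<^sub>1 \<pi>\<^sub>2" and g: "\<gamma> \<in> cells c f" "\<delta> \<in> cells c h"
  obtains u where "u \<in> cells c q" "u \<odot> \<pi>\<^sub>1 = \<gamma>" "u \<odot> \<pi>\<^sub>2 = \<delta>"
proof -
  note D = pointwise_productD[OF P]
  have c: "c \<in> Mor K" "src K c = src K q" "tgt K c = S" using cells_Mor[OF g(1)] D by auto
  define \<phi> where "\<phi> x s = (SOME r. r \<in> El (x \<cdot> q) \<and> ev x \<pi>\<^sub>1 r = ev x \<gamma> s \<and> ev x \<pi>\<^sub>2 r = ev x \<delta> s)" for x s
  have \<phi>: "\<phi> x s \<in> El (x \<cdot> q) \<and> ev x \<pi>\<^sub>1 (\<phi> x s) = ev x \<gamma> s \<and> ev x \<pi>\<^sub>2 (\<phi> x s) = ev x \<delta> s"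
    if x: "x \<in> Mor K" "tgt K x = src K c" "s \<in> El (x \<cdot> c)" for x s
  proof -
    have xq: "tgt K x = src K q" using x c by simp
    have "\<exists>r. r \<in> El (x \<cdot> q) \<and> ev x \<pi>\<^sub>1 r = ev x \<gamma> s \<and> ev x \<pi>\<^sub>2 r = ev x \<delta> s"
      using pointwise_product_pair[OF P x(1) xq cells_El[OF g(1) x] cells_El[OF g(2) x]] by blast
    then show ?thesis unfolding \<phi>_def by (rule someI_ex)
  qed
  have nat: "\<phi> (y \<cdot> x) (y \<cdot> s) = y \<cdot> \<phi> x s"
    if x: "x \<in> Mor K" "tgt K x = src K c" "s \<in> El (x \<cdot> c)" and y: "y \<in> Mor K" "tgt K y = src K x" for x s y
  proof -
    have xq: "tgt K x = src K q" using x c by simp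
    have ys: "y \<cdot> s \<in> El ((y \<cdot> x) \<cdot> c)" using El_comp1'[OF x(3) y(1) x(1) c(1)] x y c by simp
    have 1: "\<phi> (y \<cdot> x) (y \<cdot> s) \<in> El ((y \<cdot> x) \<cdot> q) \<and> ev (y \<cdot> x) \<pi>\<^sub>1 (\<phi> (y \<cdot> x) (y \<cdot> s)) = ev (y \<cdot> x) \<gamma> (y \<cdot> s)
      \<and> ev (y \<cdot> x) \<pi>\<^sub>2 (\<phi> (y \<cdot> x) (y \<cdot> s)) = ev (y \<cdot> x) \<delta> (y \<cdot> s)"
      by (rule \<phi>) (use x y c ys in simp_all)
    have 2: "\<phi> x s \<in> El (x \<cdot> q)" "ev x \<pi>\<^sub>1 (\<phi> x s) = ev x \<gamma> s" "ev x \<pi>\<^sub>2 (\<phi> x s) = ev x \<delta> s" using \<phi>[OF x] by auto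
    have 3: "y \<cdot> \<phi> x s \<in> El ((y \<cdot> x) \<cdot> q)" using El_comp1'[OF 2(1) y(1) x(1) D(3) xq y(2)] x y xq D by simp
    show ?thesis
      by (rule pointwise_product_eq[OF P _ _ _ 3])
        (use 1 x y xq in \<open>simp_all add: cells_ev_comp1[OF D(1) x(1) xq 2(1) y] cells_ev_comp1[OF D(2) x(1) xq 2(1) y]
          cells_ev_comp1[OF g(1) x y] cells_ev_comp1[OF g(2) x y] 2(2,3)\<close>)
  qed
  obtain u where u: "u \<in> cells c q" "\<And>x s. \<lbrakk>x \<in> Mor K; tgt K x = src K c; s \<in> El (x \<cdot> c)\<rbrakk> \<Longrightarrow> ev x u s = \<phi> x s"
    by (rule ev_exists[of c q \<phi>]) (use c D \<phi> nat in auto)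
  have "u \<odot> \<pi>\<^sub>1 = \<gamma>"
    by (rule ev_ext[OF cells_vcomp[OF u(1) D(1)] g(1) c(3)]) (use cells_ev_vcomp[OF u(1) D(1)] u(2) \<phi> in simp)
  moreover have "u \<odot> \<pi>\<^sub>2 = \<delta>"
    by (rule ev_ext[OF cells_vcomp[OF u(1) D(2)] g(2) c(3)]) (use cells_ev_vcomp[OF u(1) D(2)] u(2) \<phi> in simp)
  ultimately show thesis using u by (intro that)
qed

lemma pointwise_product_is_product:
  assumes P: "pointwise_product f h q \<pi>\<^sub>1 \<pi>\<^sub>2" and A: "src K q = A"
  shows "is_product (Hom K A S) f h q \<pi>\<^sub>1 \<pi>\<^sub>2"
proof -
  note D = pointwise_productD[OF P]
  have ob: "f \<in> hom1 K A S" "h \<in> hom1 K A S" "q \<in> hom1 K A S" using D A by (simp_all add: hom1_iff)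
  have "\<exists>!w. w \<in> hom (Hom K A S) x q \<and> w \<bullet>\<^bsub>Hom K A S\<^esub> \<pi>\<^sub>1 = u \<and> w \<bullet>\<^bsub>Hom K A S\<^esub> \<pi>\<^sub>2 = v"
    if x: "x \<in> hom1 K A S" and uv: "u \<in> hom (Hom K A S) x f" "v \<in> hom (Hom K A S) x h" for x u v
  proof -
    have uv': "u \<in> cells x f" "v \<in> cells x h" using uv hom_Hom_cells[OF x] ob by simp_all
    obtain w where w: "w \<in> cells x q" "w \<odot> \<pi>\<^sub>1 = u" "w \<odot> \<pi>\<^sub>2 = v" using pointwise_product_tuple[OF P uv'] by blast
    show ?thesis
      unfolding hom_Hom_cells[OF x ob(3)] Hom_simps
      by (rule ex1I[of _ w]) (use w pointwise_product_cells_eq[OF P] in auto)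
  qed
  then show ?thesis using ob D by (simp add: is_product_def hom_Hom_cells[OF ob(3)])
qed

text \<open>\<open>is_product\<close> has no index category, so the retract argument used for limits
  is carried out again for pairs.\<close>

lemma is_product_pointwise:
  assumes P: "is_product (Hom K A S) f h q \<pi>\<^sub>1 \<pi>\<^sub>2"
  shows "pointwise_product f h q \<pi>\<^sub>1 \<pi>\<^sub>2"
proof -
  have ob: "f \<in> hom1 K A S" "h \<in> hom1 K A S" "q \<in> hom1 K A S"
    using P by (simp_all add: is_product_def)
  then have ob': "f \<in> Mor K" "src K f = A" "tgt K f = S" "h \<in> Mor K" "src K h = A" "tgt K h = S"
    "q \<in> Mor K" "src K q = A" "tgt K q = S" by (simp_all add: hom1_iff)
  have \<pi>: "\<pi>\<^sub>1 \<in> cells q f" "\<pi>\<^sub>2 \<in> cells q h"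
    using P by (simp_all add: is_product_def hom_Hom_cells[OF ob(3)] ob)
  have univ: "\<exists>!w. w \<in> cells x q \<and> w \<odot> \<pi>\<^sub>1 = u \<and> w \<odot> \<pi>\<^sub>2 = v"
    if x: "x \<in> hom1 K A S" and uv: "u \<in> cells x f" "v \<in> cells x h" for x u v
  proof -
    have "u \<in> hom (Hom K A S) x f" "v \<in> hom (Hom K A S) x h"
      using uv hom_Hom_cells[OF x] ob by simp_all
    then have "\<exists>!w. w \<in> hom (Hom K A S) x q \<and> w \<odot> \<pi>\<^sub>1 = u \<and> w \<odot> \<pi>\<^sub>2 = v"
      using P x unfolding is_product_def Hom_simps by blast
    then show ?thesis unfolding hom_Hom_cells[OF x ob(3)] .
  qed
  obtain q0 \<pi>1 \<pi>2 where P0: "pointwise_product f h q0 \<pi>1 \<pi>2"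
    using pointwise_product_exists[OF ob'(1,3) ob'(4) _ ob'(6)] ob' by auto
  note D0 = pointwise_productD[OF P0]
  have q0: "q0 \<in> hom1 K A S" "src K q0 = A" using D0 ob' by (simp_all add: hom1_iff)
  obtain u where u: "u \<in> cells q q0" "u \<odot> \<pi>1 = \<pi>\<^sub>1" "u \<odot> \<pi>2 = \<pi>\<^sub>2" using pointwise_product_tuple[OF P0 \<pi>] by blast
  obtain u0 where u0: "u0 \<in> cells q0 q" "u0 \<odot> \<pi>\<^sub>1 = \<pi>1" "u0 \<odot> \<pi>\<^sub>2 = \<pi>2" using univ[OF q0(1) D0(1,2)] by blast
  have uu: "u \<odot> u0 = id2 K q"
  proof -
    have "\<exists>!w. w \<in> cells q q \<and> w \<odot> \<pi>\<^sub>1 = \<pi>\<^sub>1 \<and> w \<odot> \<pi>\<^sub>2 = \<pi>\<^sub>2" by (rule univ[OF ob(3) \<pi>])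
    moreover have "(u \<odot> u0) \<odot> \<pi>\<^sub>1 = \<pi>\<^sub>1" "(u \<odot> u0) \<odot> \<pi>\<^sub>2 = \<pi>\<^sub>2"
      using cells_assoc[OF u(1) u0(1) \<pi>(1)] cells_assoc[OF u(1) u0(1) \<pi>(2)] u u0 by simp_all
    moreover have "id2 K q \<odot> \<pi>\<^sub>1 = \<pi>\<^sub>1" "id2 K q \<odot> \<pi>\<^sub>2 = \<pi>\<^sub>2" by (rule cells_id2_vcomp[OF \<pi>(1)] cells_id2_vcomp[OF \<pi>(2)])+
    ultimately show ?thesis using cells_vcomp[OF u(1) u0(1)] cells_id2[OF ob'(7)] by metis
  qed
  show ?thesis unfolding pointwise_product_def
  proof (intro conjI ballI impI)
    fix x s s' assume x: "x \<in> Mor K" "tgt K x = src K q" "s \<in> El (x \<cdot> f)" "s' \<in> El (x \<cdot> h)"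
    have x0: "tgt K x = src K q0" using x q0 ob' by simp
    obtain r where r: "r \<in> El (x \<cdot> q0)" "ev x \<pi>1 r = s" "ev x \<pi>2 r = s'"
      using pointwise_product_pair[OF P0 x(1) x0 x(3,4)] by blast
    show "\<exists>!r. r \<in> El (x \<cdot> q) \<and> ev x \<pi>\<^sub>1 r = s \<and> ev x \<pi>\<^sub>2 r = s'"
    proof (rule ex1I[of _ "ev x u0 r"])
      show "ev x u0 r \<in> El (x \<cdot> q) \<and> ev x \<pi>\<^sub>1 (ev x u0 r) = s \<and> ev x \<pi>\<^sub>2 (ev x u0 r) = s'"
        using cells_El[OF u0(1) x(1) x0 r(1)] cells_ev_vcomp[OF u0(1) \<pi>(1) x(1) x0 r(1)]
          cells_ev_vcomp[OF u0(1) \<pi>(2) x(1) x0 r(1)] u0 r by simp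
      fix r' assume r': "r' \<in> El (x \<cdot> q) \<and> ev x \<pi>\<^sub>1 r' = s \<and> ev x \<pi>\<^sub>2 r' = s'"
      then have r'q: "r' \<in> El (x \<cdot> q)" by blast
      have "ev x u r' = r"
        by (rule pointwise_product_eq[OF P0 x(1) x0 cells_El[OF u(1) x(1,2) r'q] r(1)])
          (use cells_ev_vcomp[OF u(1) D0(1) x(1,2) r'q] cells_ev_vcomp[OF u(1) D0(2) x(1,2) r'q] u r r' in simp_all)
      then show "r' = ev x u0 r"
        using cells_ev_vcomp[OF u(1) u0(1) x(1,2) r'q] uu ev_id2[OF ob'(7) x(1,2) r'q] by simp
    qed
  qed (use \<pi> ob' in simp_all)
qed

text \<open>A pullback in one hom category tests only morphisms with source \<open>src K w\<close>,
  whereas the right-hand side concerns all stages. Comprehension bridges this: the elementwise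
  inverse image of \<open>e\<close> along \<open>s\<close> is itself a subobject of \<open>w\<close>
  and can be tested against the pullback.\<close>

lemma is_pullback_mono_iff:
  assumes s: "s \<in> cells w q" and e: "pointwise_mono e" "e \<in> cells \<epsilon> q" and m: "pointwise_mono m" "m \<in> cells \<mu> w"
  shows "(\<exists>t. is_pullback (Hom K (src K w) S) s e m t) \<longleftrightarrow>
    (\<forall>x\<in>Mor K. tgt K x = src K w \<longrightarrow> (\<forall>z\<in>El (x \<cdot> w). z \<in> img x m \<longleftrightarrow> ev x s z \<in> img x e))"
proof -
  let ?A = "src K w"
  let ?C = "Hom K ?A S"
  note E = pointwise_monoD[OF e] and M = pointwise_monoD[OF m]
  have sw: "src K q = ?A" "s \<in> Cell K" "dom2 K s = w" "cod2 K s = q" using cells_Mor[OF s] s by (auto simp: cells_def)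
  have ob: "w \<in> hom1 K ?A S" "\<epsilon> \<in> hom1 K ?A S" "\<mu> \<in> hom1 K ?A S" using E M sw by (simp_all add: hom1_iff)
  have img_sub: "img x (a \<odot> b) \<subseteq> img x b" if ab: "a \<in> cells f g" "b \<in> cells g h" "x \<in> Mor K" "tgt K x = src K f" for a b f g h x
  proof
    fix y assume "y \<in> img x (a \<odot> b)"
    then obtain r where r: "r \<in> El (x \<cdot> f)" "ev x (a \<odot> b) r = y"
      using img_iff[OF cells_vcomp[OF ab(1,2)]] by blast
    then show "y \<in> img x b"
      using cells_ev_vcomp[OF ab r(1)] cells_El[OF ab(1,3,4) r(1)] img_iff[OF ab(2)] by metis
  qed
  show ?thesis
  proof
    assume "\<exists>t. is_pullback ?C s e m t"
    then obtain t where t: "is_pullback ?C s e m t" by blast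
    have tc: "t \<in> cells \<mu> \<epsilon>"
    proof -
      have "cod2 K t = dom2 K e" "dom2 K m = dom2 K t" "t \<in> Cell K" using t by (simp_all add: is_pullback_def)
      then show ?thesis using E M by (simp add: cells_def)
    qed
    have sq: "m \<odot> s = t \<odot> e" using t by (simp add: is_pullback_def)
    have univ: "\<exists>v. v \<in> cells x \<mu> \<and> v \<odot> m = u \<and> v \<odot> t = u'"
      if u: "u \<in> cells x w" "u' \<in> cells x \<epsilon>" "u \<odot> s = u' \<odot> e" for x u u'
    proof -
      have x: "x \<in> hom1 K ?A S" using cells_Mor[OF u(1)] M by (simp add: hom1_iff)
      have "\<forall>x\<in>hom1 K ?A S. \<forall>u\<in>hom ?C x w. \<forall>v\<in>hom ?C x \<epsilon>. u \<odot> s = v \<odot> e \<longrightarrow>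
        (\<exists>!v'. v' \<in> hom ?C x \<mu> \<and> v' \<odot> m = u \<and> v' \<odot> t = v)"
        using t unfolding is_pullback_def Hom_simps sw(3) E(6) M(6) by blast
      moreover have "u \<in> hom ?C x w" "u' \<in> hom ?C x \<epsilon>" using u hom_Hom_cells[OF x] ob by simp_all
      ultimately have "\<exists>!v. v \<in> hom ?C x \<mu> \<and> v \<odot> m = u \<and> v \<odot> t = u'" using x u(3) by blast
      then show ?thesis using hom_Hom_cells[OF x ob(3)] by auto
    qed
    obtain l T where P: "pb_along K p w l T" using pb_exists[of w] M by auto
    note L = pb_simps[OF P]
    have "ev l s T \<in> El (l \<cdot> q)" by (rule cells_El[OF s]) (use L in simp_all)
    then obtain m' \<mu>' where m': "pointwise_mono m'" "m' \<in> cells \<mu>' w"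
      "\<And>v. \<lbrakk>v \<in> Mor K; tgt K v = src K l\<rbrakk> \<Longrightarrow> v \<cdot> T \<in> img (v \<cdot> l) m' \<longleftrightarrow> v \<cdot> ev l s T \<in> img (v \<cdot> l) e"
      using comprehension[OF P e, of l "ev l s T"] L sw by auto
    note M' = pointwise_monoD[OF m'(1,2)]
    have m'_iff: "z \<in> img x m' \<longleftrightarrow> ev x s z \<in> img x e" if x: "x \<in> Mor K" "tgt K x = ?A" "z \<in> El (x \<cdot> w)" for x z
    proof -
      obtain v where v: "v \<in> Mor K" "tgt K v = src K l" "v \<cdot> l = x" "v \<cdot> T = z" using pb_point[OF P x] by blast
      then show ?thesis using m'(3)[OF v(1,2)] cells_ev_comp1[OF s L(3,5) L(8) v(1,2)] by simp
    qed
    have sub: "img x (m' \<odot> s) \<subseteq> img x e" if x: "x \<in> Mor K" "tgt K x = src K q" for x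
    proof
      have x': "tgt K x = src K \<mu>'" "tgt K x = ?A" using x M' sw by simp_all
      fix y assume "y \<in> img x (m' \<odot> s)"
      then obtain r where r: "r \<in> El (x \<cdot> \<mu>')" "ev x (m' \<odot> s) r = y" using img_iff[OF cells_vcomp[OF m'(2) s]] by blast
      have "ev x m' r \<in> img x m'" using r img_iff[OF m'(2)] by blast
      then have "ev x s (ev x m' r) \<in> img x e" using m'_iff[OF x(1) x'(2) cells_El[OF m'(2) x(1) x'(1) r(1)]] by simp
      then show "y \<in> img x e" using cells_ev_vcomp[OF m'(2) s x(1) x'(1) r(1)] r by simp
    qed
    obtain t' where t': "t' \<in> cells \<mu>' \<epsilon>" "t' \<odot> e = m' \<odot> s"
      by (rule factor_through_subobject[OF e cells_vcomp[OF m'(2) s] sub])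
    \<comment> \<open>The pullback property makes the elementwise inverse image \<open>m'\<close>
      factor through \<open>m\<close>, so all its elements lie in the image of
      \<open>m\<close>.\<close>
    obtain v where v: "v \<in> cells \<mu>' \<mu>" "v \<odot> m = m'" using univ[OF m'(2) t'(1)] t'(2) by auto
    show "\<forall>x\<in>Mor K. tgt K x = ?A \<longrightarrow> (\<forall>z\<in>El (x \<cdot> w). z \<in> img x m \<longleftrightarrow> ev x s z \<in> img x e)"
    proof (intro ballI impI iffI)
      fix x z assume x: "x \<in> Mor K" "tgt K x = ?A" "z \<in> El (x \<cdot> w)"
      show "z \<in> img x m" if "ev x s z \<in> img x e"
        using m'_iff[OF x] that img_sub[OF v(1) m(2) x(1)] v(2) x(2) M' by auto
      assume "z \<in> img x m"
      then obtain r where r: "r \<in> El (x \<cdot> \<mu>)" "ev x m r = z" using img_iff[OF m(2)] by blast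
      have x': "tgt K x = src K \<mu>" using x M by simp
      have "ev x s z = ev x (t \<odot> e) r" using cells_ev_vcomp[OF m(2) s x(1) x' r(1)] r sq by simp
      also have "\<dots> = ev x e (ev x t r)" by (rule cells_ev_vcomp[OF tc e(2) x(1) x' r(1)])
      finally show "ev x s z \<in> img x e" using img_iff[OF e(2)] cells_El[OF tc x(1) x' r(1)] by auto
    qed
  next
    assume iff: "\<forall>x\<in>Mor K. tgt K x = ?A \<longrightarrow> (\<forall>z\<in>El (x \<cdot> w). z \<in> img x m \<longleftrightarrow> ev x s z \<in> img x e)"
    have sub: "img x (m \<odot> s) \<subseteq> img x e" if x: "x \<in> Mor K" "tgt K x = src K q" for x
    proof
      have x': "tgt K x = src K \<mu>" "tgt K x = ?A" using x M sw by simp_all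
      fix y assume "y \<in> img x (m \<odot> s)"
      then obtain r where r: "r \<in> El (x \<cdot> \<mu>)" "ev x (m \<odot> s) r = y" using img_iff[OF cells_vcomp[OF m(2) s]] by blast
      have "ev x m r \<in> img x m" using r img_iff[OF m(2)] by blast
      then have "ev x s (ev x m r) \<in> img x e" using iff x(1) x'(2) cells_El[OF m(2) x(1) x'(1) r(1)] by blast
      then show "y \<in> img x e" using cells_ev_vcomp[OF m(2) s x(1) x'(1) r(1)] r by simp
    qed
    obtain t where t: "t \<in> cells \<mu> \<epsilon>" "t \<odot> e = m \<odot> s"
      by (rule factor_through_subobject[OF e cells_vcomp[OF m(2) s] sub])
    have univ: "\<exists>!v. v \<in> hom ?C x \<mu> \<and> v \<odot> m = u \<and> v \<odot> t = u'"
      if x: "x \<in> hom1 K ?A S" and u: "u \<in> hom ?C x w" "u' \<in> hom ?C x \<epsilon>" "u \<odot> s = u' \<odot> e" for x u u'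
    proof -
      have uc: "u \<in> cells x w" "u' \<in> cells x \<epsilon>" using u hom_Hom_cells[OF x] ob by simp_all
      have "img y u \<subseteq> img y m" if y: "y \<in> Mor K" "tgt K y = ?A" for y
      proof
        fix z assume "z \<in> img y u"
        then obtain r where r: "r \<in> El (y \<cdot> x)" "ev y u r = z" using img_iff[OF uc(1)] by blast
        have y': "tgt K y = src K x" using y x by (simp add: hom1_iff)
        have "ev y s z = ev y e (ev y u' r)"
          using cells_ev_vcomp[OF uc(1) s y(1) y' r(1)] cells_ev_vcomp[OF uc(2) e(2) y(1) y' r(1)] u(3) r by simp
        then have "ev y s z \<in> img y e" unfolding img_iff[OF e(2)] using cells_El[OF uc(2) y(1) y' r(1)] by metis
        moreover have "z \<in> El (y \<cdot> w)" using cells_El[OF uc(1) y(1) y' r(1)] r by simp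
        ultimately show "z \<in> img y m" using iff y by blast
      qed
      then obtain v where v: "v \<in> cells x \<mu>" "v \<odot> m = u" using factor_through_subobject[OF m uc(1)] by blast
      have "(v \<odot> t) \<odot> e = u' \<odot> e"
        using cells_assoc[OF v(1) t(1) e(2)] cells_assoc[OF v(1) m(2) s] t(2) v(2) u(3) by simp
      then have "v \<odot> t = u'" by (rule pointwise_mono_cancel[OF e cells_vcomp[OF v(1) t(1)] uc(2)])
      then show ?thesis
        unfolding hom_Hom_cells[OF x ob(3)]
        by (intro ex1I[of _ v]) (use v pointwise_mono_cancel[OF m] in auto)
    qed
    have tt: "t \<in> Cell K" "dom2 K t = \<mu>" "cod2 K t = \<epsilon>" using t by (auto simp: cells_def)
    have "is_pullback ?C s e m t"
      unfolding is_pullback_def Hom_simps sw(3,4) E(6,7) M(6,7) tt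
    proof (intro conjI ballI impI)
      show "s \<in> Ar ?C" "e \<in> Ar ?C" "m \<in> Ar ?C" "t \<in> Ar ?C" "m \<odot> s = t \<odot> e"
        using sw E M tt t(2) by simp_all
    qed (use univ in simp_all)
    then show "\<exists>t. is_pullback ?C s e m t" by blast
  qed
qed

section \<open>Power objects\<close>

text \<open>Reads \<open>u \<in> v\<close> at stage \<open>x\<close>, with \<open>e\<close> viewed
  as a relation between elements of the two factors.\<close>

definition member :: "'c \<Rightarrow> 'c \<Rightarrow> 'c \<Rightarrow> 'm \<Rightarrow> 'm \<Rightarrow> 'm \<Rightarrow> bool" where
  "member \<pi>\<^sub>1 \<pi>\<^sub>2 e x u v \<longleftrightarrow> (\<exists>t\<in>img x e. ev x \<pi>\<^sub>1 t = u \<and> ev x \<pi>\<^sub>2 t = v)"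

lemma member_iff:
  assumes Q: "pointwise_product a P q \<pi>\<^sub>1 \<pi>\<^sub>2" and e: "e \<in> cells \<epsilon> q"
    and x: "x \<in> Mor K" "tgt K x = src K q" and z: "z \<in> El (x \<cdot> q)"
  shows "member \<pi>\<^sub>1 \<pi>\<^sub>2 e x (ev x \<pi>\<^sub>1 z) (ev x \<pi>\<^sub>2 z) \<longleftrightarrow> z \<in> img x e"
proof
  assume "member \<pi>\<^sub>1 \<pi>\<^sub>2 e x (ev x \<pi>\<^sub>1 z) (ev x \<pi>\<^sub>2 z)"
  then obtain t where t: "t \<in> img x e" "ev x \<pi>\<^sub>1 t = ev x \<pi>\<^sub>1 z" "ev x \<pi>\<^sub>2 t = ev x \<pi>\<^sub>2 z"
    by (auto simp: member_def)
  have xe: "tgt K x = src K \<epsilon>" using cells_Mor[OF e] x by simp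
  obtain s where s: "s \<in> El (x \<cdot> \<epsilon>)" "ev x e s = t" using t(1) unfolding img_iff[OF e] by blast
  have "t \<in> El (x \<cdot> q)" using cells_El[OF e x(1) xe s(1)] s(2) by simp
  then have "t = z" using pointwise_product_eq[OF Q x _ z t(2,3)] by blast
  then show "z \<in> img x e" using t by simp
next
  assume "z \<in> img x e"
  then show "member \<pi>\<^sub>1 \<pi>\<^sub>2 e x (ev x \<pi>\<^sub>1 z) (ev x \<pi>\<^sub>2 z)" unfolding member_def by blast
qed

text \<open>Elementwise form of the condition that \<open>m\<close> is the pullback of
  \<open>e\<close> along \<open>id \<times> r\<close>: the pairs in \<open>m\<close> are those whose
  first component is a member of the value of \<open>r\<close> at the second.\<close>

definition classifies :: "'c \<Rightarrow> 'c \<Rightarrow> 'c \<Rightarrow> 'c \<Rightarrow> 'c \<Rightarrow> 'c \<Rightarrow> 'm \<Rightarrow> 'c \<Rightarrow> bool" where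
  "classifies \<pi>\<^sub>1 \<pi>\<^sub>2 e \<rho>\<^sub>1 \<rho>\<^sub>2 m w r \<longleftrightarrow> (\<forall>x\<in>Mor K. tgt K x = src K w \<longrightarrow>
    (\<forall>z\<in>El (x \<cdot> w). z \<in> img x m \<longleftrightarrow> member \<pi>\<^sub>1 \<pi>\<^sub>2 e x (ev x \<rho>\<^sub>1 z) (ev x r (ev x \<rho>\<^sub>2 z))))"

text \<open>The two projection equations determine \<open>s\<close>, so the existential concerns a
  single arrow, for which being a pullback is an elementwise condition.\<close>

lemma classifies_iff:
  assumes Q: "pointwise_product a P q \<pi>\<^sub>1 \<pi>\<^sub>2" and e: "pointwise_mono e" "e \<in> cells \<epsilon> q"
    and W: "pointwise_product a y w \<rho>\<^sub>1 \<rho>\<^sub>2" and m: "pointwise_mono m" "m \<in> cells \<mu> w" and r: "r \<in> cells y P"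
    and A: "src K q = A"
  shows "(\<exists>s \<in> hom (Hom K A S) w q. s \<odot> \<pi>\<^sub>1 = \<rho>\<^sub>1 \<and> s \<odot> \<pi>\<^sub>2 = \<rho>\<^sub>2 \<odot> r \<and> (\<exists>t. is_pullback (Hom K A S) s e m t))
    \<longleftrightarrow> classifies \<pi>\<^sub>1 \<pi>\<^sub>2 e \<rho>\<^sub>1 \<rho>\<^sub>2 m w r"
proof -
  note D = pointwise_productD[OF Q] and F = pointwise_productD[OF W]
  have wA: "src K w = A" using D F A by simp
  have ob: "w \<in> hom1 K A S" "q \<in> hom1 K A S" using D F A wA by (simp_all add: hom1_iff)
  obtain s where s: "s \<in> cells w q" "s \<odot> \<pi>\<^sub>1 = \<rho>\<^sub>1" "s \<odot> \<pi>\<^sub>2 = \<rho>\<^sub>2 \<odot> r"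
    using pointwise_product_tuple[OF Q F(1) cells_vcomp[OF F(2) r]] by blast
  have "member \<pi>\<^sub>1 \<pi>\<^sub>2 e x (ev x \<rho>\<^sub>1 z) (ev x r (ev x \<rho>\<^sub>2 z)) \<longleftrightarrow> ev x s z \<in> img x e"
    if x: "x \<in> Mor K" "tgt K x = src K w" "z \<in> El (x \<cdot> w)" for x z
    using member_iff[OF Q e(2) x(1) _ cells_El[OF s(1) x]] cells_ev_vcomp[OF s(1) D(1) x]
      cells_ev_vcomp[OF s(1) D(2) x] cells_ev_vcomp[OF F(2) r x] s x wA A by simp
  then have "classifies \<pi>\<^sub>1 \<pi>\<^sub>2 e \<rho>\<^sub>1 \<rho>\<^sub>2 m w r \<longleftrightarrow> (\<exists>t. is_pullback (Hom K (src K w) S) s e m t)"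
    unfolding is_pullback_mono_iff[OF s(1) e m] classifies_def by blast
  then show ?thesis
    unfolding hom_Hom_cells[OF ob] wA using s pointwise_product_cells_eq[OF Q] by metis
qed

lemma is_power_object_iff:
  assumes Q: "pointwise_product a P q \<pi>\<^sub>1 \<pi>\<^sub>2" and e: "pointwise_mono e" "e \<in> cells \<epsilon> q" and A: "src K q = A"
  shows "is_power_object (Hom K A S) a P q \<pi>\<^sub>1 \<pi>\<^sub>2 e \<longleftrightarrow>
    (\<forall>y w \<rho>\<^sub>1 \<rho>\<^sub>2 m. pointwise_product a y w \<rho>\<^sub>1 \<rho>\<^sub>2 \<and> pointwise_mono m \<and> cod2 K m = w \<longrightarrow>
      (\<exists>!r. r \<in> cells y P \<and> classifies \<pi>\<^sub>1 \<pi>\<^sub>2 e \<rho>\<^sub>1 \<rho>\<^sub>2 m w r))"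
proof -
  note D = pointwise_productD[OF Q] and E = pointwise_monoD[OF e]
  have eq: "(r \<in> hom (Hom K A S) y P \<and>
        (\<exists>s \<in> hom (Hom K A S) w q. s \<bullet>\<^bsub>Hom K A S\<^esub> \<pi>\<^sub>1 = \<rho>\<^sub>1 \<and> s \<bullet>\<^bsub>Hom K A S\<^esub> \<pi>\<^sub>2 = \<rho>\<^sub>2 \<bullet>\<^bsub>Hom K A S\<^esub> r \<and>
          (\<exists>t. is_pullback (Hom K A S) s e m t)))
      \<longleftrightarrow> (r \<in> cells y P \<and> classifies \<pi>\<^sub>1 \<pi>\<^sub>2 e \<rho>\<^sub>1 \<rho>\<^sub>2 m w r)"
    if W: "pointwise_product a y w \<rho>\<^sub>1 \<rho>\<^sub>2" and m: "pointwise_mono m" "cod2 K m = w" for y w \<rho>\<^sub>1 \<rho>\<^sub>2 m r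
  proof -
    note F = pointwise_productD[OF W]
    have ob: "y \<in> hom1 K A S" "P \<in> hom1 K A S" using D F A by (simp_all add: hom1_iff)
    have mc: "m \<in> cells (dom2 K m) w" using m by (simp add: pointwise_mono_def cells_def)
    show ?thesis
      unfolding hom_Hom_cells[OF ob] Hom_simps using classifies_iff[OF Q e W m(1) mc _ A] by blast
  qed
  have prod: "is_product (Hom K A S) a y w \<rho>\<^sub>1 \<rho>\<^sub>2 \<and> is_mono (Hom K A S) m \<and> Cod (Hom K A S) m = w
      \<longleftrightarrow> pointwise_product a y w \<rho>\<^sub>1 \<rho>\<^sub>2 \<and> pointwise_mono m \<and> cod2 K m = w" for y w \<rho>\<^sub>1 \<rho>\<^sub>2 m
  proof
    assume "is_product (Hom K A S) a y w \<rho>\<^sub>1 \<rho>\<^sub>2 \<and> is_mono (Hom K A S) m \<and> Cod (Hom K A S) m = w"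
    then show "pointwise_product a y w \<rho>\<^sub>1 \<rho>\<^sub>2 \<and> pointwise_mono m \<and> cod2 K m = w"
      using is_product_pointwise[of A a y w \<rho>\<^sub>1 \<rho>\<^sub>2] is_mono_pointwise[of A m] by simp
  next
    assume a: "pointwise_product a y w \<rho>\<^sub>1 \<rho>\<^sub>2 \<and> pointwise_mono m \<and> cod2 K m = w"
    then have W: "pointwise_product a y w \<rho>\<^sub>1 \<rho>\<^sub>2" by simp
    have wA: "src K w = A" using pointwise_productD[OF W] D A by simp
    have "m \<in> cells (dom2 K m) w" using a by (simp add: pointwise_mono_def cells_def)
    then have "is_mono (Hom K A S) m" using pointwise_mono_is_mono[of m "dom2 K m" w] a wA by simp
    then show "is_product (Hom K A S) a y w \<rho>\<^sub>1 \<rho>\<^sub>2 \<and> is_mono (Hom K A S) m \<and> Cod (Hom K A S) m = w"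
      using pointwise_product_is_product[OF W wA] a by simp
  qed
  have pre: "is_product (Hom K A S) a P q \<pi>\<^sub>1 \<pi>\<^sub>2" "is_mono (Hom K A S) e" "Cod (Hom K A S) e = q"
    using pointwise_product_is_product[OF Q A] pointwise_mono_is_mono[OF e] A E by simp_all
  show ?thesis
    unfolding is_power_object_def prod
    by (simp only: pre simp_thms) (intro iff_allI imp_cong refl; simp only: eq)
qed

text \<open>\<open>s\<close> is the name of the subobject \<open>m\<close> of
  \<open>b \<cdot> a\<close>. The test runs over all later stages \<open>y\<close>, since a
  subobject is determined by its elements there and not by those over \<open>b\<close>
  alone.\<close>

definition names :: "'m \<Rightarrow> 'm \<Rightarrow> 'c \<Rightarrow> 'c \<Rightarrow> 'c \<Rightarrow> 'm \<Rightarrow> 'c \<Rightarrow> 'm \<Rightarrow> bool" where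
  "names a P \<pi>\<^sub>1 \<pi>\<^sub>2 e b m s \<longleftrightarrow> s \<in> El (b \<cdot> P) \<and>
    (\<forall>y\<in>Mor K. tgt K y = src K b \<longrightarrow> (\<forall>\<rho>\<in>El (y \<cdot> (b \<cdot> a)).
      \<rho> \<in> img y m \<longleftrightarrow> member \<pi>\<^sub>1 \<pi>\<^sub>2 e (y \<cdot> b) \<rho> (y \<cdot> s)))"

text \<open>The elements of \<open>P\<close> over any \<open>b : B \<rightarrow> A\<close>, \<open>B\<close> a groupoid, are the subobjects of \<open>b a\<close>.
  Quantifying over all such \<open>b\<close> makes this visibly stable under base change, while only \<open>b\<close> equal to
  the pullback of \<open>p\<close> along some \<open>y : A \<rightarrow> S\<close> is needed for power objects in the category of
  morphisms \<open>A \<rightarrow> S\<close>.\<close>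

definition pointwise_power_object :: "'m \<Rightarrow> 'm \<Rightarrow> 'm \<Rightarrow> 'c \<Rightarrow> 'c \<Rightarrow> 'c \<Rightarrow> bool" where
  "pointwise_power_object a P q \<pi>\<^sub>1 \<pi>\<^sub>2 e \<longleftrightarrow>
    pointwise_product a P q \<pi>\<^sub>1 \<pi>\<^sub>2 \<and> pointwise_mono e \<and> cod2 K e = q \<and>
    (\<forall>b m. b \<in> Mor K \<and> tgt K b = src K a \<and> groupoid_object K (src K b) \<and> pointwise_mono m \<and> cod2 K m = b \<cdot> a \<longrightarrow>
      (\<exists>!s. names a P \<pi>\<^sub>1 \<pi>\<^sub>2 e b m s))"

text \<open>A relation \<open>m\<close> between \<open>a\<close> and \<open>y\<close> is turned into
  a subobject \<open>n\<close> of \<open>l \<cdot> a\<close>, with \<open>l\<close> the stage of the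
  universal element of \<open>y\<close>. Its name is an element of \<open>P\<close> at
  \<open>l\<close>, and by genericity such elements are the 2-cells from \<open>y\<close> to
  \<open>P\<close>.\<close>

lemma pointwise_power_object_is_power_object:
  assumes PP: "pointwise_power_object a P q \<pi>\<^sub>1 \<pi>\<^sub>2 e" and A: "groupoid_object K A" "src K q = A"
  shows "is_power_object (Hom K A S) a P q \<pi>\<^sub>1 \<pi>\<^sub>2 e"
proof -
  have Q: "pointwise_product a P q \<pi>\<^sub>1 \<pi>\<^sub>2" and e: "pointwise_mono e" "e \<in> cells (dom2 K e) q"
    using PP by (auto simp: pointwise_power_object_def pointwise_mono_def cells_def)
  note D = pointwise_productD[OF Q]
  show ?thesis
    unfolding is_power_object_iff[OF Q e A(2)]
  proof (intro allI impI, elim conjE)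
    fix y w \<rho>\<^sub>1 \<rho>\<^sub>2 m assume W: "pointwise_product a y w \<rho>\<^sub>1 \<rho>\<^sub>2" and m: "pointwise_mono m" "cod2 K m = w"
    note F = pointwise_productD[OF W]
    have src [simp]: "src K w = A" "src K y = A" "src K a = A" "src K P = A" using D F A by simp_all
    have mor [simp]: "w \<in> Mor K" "y \<in> Mor K" "a \<in> Mor K" "P \<in> Mor K" "tgt K w = S" "tgt K y = S" "tgt K a = S" "tgt K P = S"
      using D F by simp_all
    have mc: "m \<in> cells (dom2 K m) w" using m by (simp add: pointwise_mono_def cells_def)
    obtain l t where Y: "pb_along K p y l t" using pb_exists[of y] by auto
    note L [simp] = pb_simps(3-7)[OF Y]
    have tl: "tgt K l = A" by simp
    have B: "groupoid_object K (src K l)" by (rule groupoid_DOF[OF pb_DOF[OF Y]]) (simp add: A(1))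
    obtain l' t' where W': "pb_along K p (l \<cdot> a) l' t'" using pb_exists[of "l \<cdot> a"] by auto
    note L' = pb_simps[OF W']
    have l' [simp]: "l' \<in> Mor K" "tgt K l' = src K l" "t' \<in> Mor K" "src K t' = src K l'" using L' by simp_all
    have t': "t' \<in> El ((l' \<cdot> l) \<cdot> a)" using L'(8) by simp
    have l't: "l' \<cdot> t \<in> El ((l' \<cdot> l) \<cdot> y)" using pb_El[OF Y, of l'] by simp
    \<comment> \<open>The source of \<open>l'\<close> carries a universal pair: \<open>t'\<close> is
      an element of \<open>a\<close> and \<open>l' \<cdot> t\<close> one of \<open>y\<close>, both
      over \<open>l' \<cdot> l\<close>. The pair, as an element of the product \<open>w\<close>, is
      \<open>z\<close>.\<close>
    obtain z where z: "z \<in> El ((l' \<cdot> l) \<cdot> w)" "ev (l' \<cdot> l) \<rho>\<^sub>1 z = t'" "ev (l' \<cdot> l) \<rho>\<^sub>2 z = l' \<cdot> t"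
      using pointwise_product_pair[OF W _ _ t' l't] by auto
    \<comment> \<open>\<open>n\<close> collects the elements of \<open>a\<close> that
      \<open>m\<close> relates to the universal element \<open>t\<close>.\<close>
    obtain n x where n: "pointwise_mono n" "n \<in> cells x (l \<cdot> a)"
      and n_iff: "\<And>v. \<lbrakk>v \<in> Mor K; tgt K v = src K l'\<rbrakk> \<Longrightarrow> v \<cdot> t' \<in> img (v \<cdot> l') n \<longleftrightarrow> v \<cdot> z \<in> img (v \<cdot> (l' \<cdot> l)) m"
      using comprehension[OF W' m(1) mc, of "l' \<cdot> l" z] z(1) by auto
    have "cod2 K n = l \<cdot> a" using n by (simp add: cells_def)
    then have ex1: "\<exists>!s. names a P \<pi>\<^sub>1 \<pi>\<^sub>2 e l n s"
      using PP n(1) B unfolding pointwise_power_object_def by simp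
    \<comment> \<open>The common form of \<open>names\<close> and \<open>classifies\<close>: either
      condition, evaluated at the universal pair restricted along \<open>v\<close>.\<close>
    define Q where "Q s v \<longleftrightarrow> (v \<cdot> z \<in> img (v \<cdot> (l' \<cdot> l)) m \<longleftrightarrow>
      member \<pi>\<^sub>1 \<pi>\<^sub>2 e (v \<cdot> (l' \<cdot> l)) (v \<cdot> t') (v \<cdot> (l' \<cdot> s)))" for s v
    have names_iff: "names a P \<pi>\<^sub>1 \<pi>\<^sub>2 e l n s \<longleftrightarrow> (\<forall>v\<in>Mor K. tgt K v = src K l' \<longrightarrow> Q s v)"
      if s: "s \<in> El (l \<cdot> P)" for s
    proof -
      have ss: "s \<in> Mor K" "src K s = src K l" using s src_El[OF s] by simp_all
      show ?thesis
      proof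
        assume N: "names a P \<pi>\<^sub>1 \<pi>\<^sub>2 e l n s"
        show "\<forall>v\<in>Mor K. tgt K v = src K l' \<longrightarrow> Q s v"
        proof (intro ballI impI)
          fix v assume v: "v \<in> Mor K" "tgt K v = src K l'"
          have "v \<cdot> t' \<in> El ((v \<cdot> l') \<cdot> (l \<cdot> a))" by (rule pb_El[OF W' v])
          moreover have "v \<cdot> l' \<in> Mor K" "tgt K (v \<cdot> l') = src K l" using v by simp_all
          ultimately have "v \<cdot> t' \<in> img (v \<cdot> l') n \<longleftrightarrow> member \<pi>\<^sub>1 \<pi>\<^sub>2 e ((v \<cdot> l') \<cdot> l) (v \<cdot> t') ((v \<cdot> l') \<cdot> s)"
            using N unfolding names_def by blast
          then show "Q s v" using n_iff[OF v] v ss by (simp add: Q_def)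
        qed
      next
        assume Qs: "\<forall>v\<in>Mor K. tgt K v = src K l' \<longrightarrow> Q s v"
        show "names a P \<pi>\<^sub>1 \<pi>\<^sub>2 e l n s" unfolding names_def
        proof (intro conjI ballI impI)
          show "s \<in> El (l \<cdot> P)" by (rule s)
          fix y' \<rho> assume y': "y' \<in> Mor K" "tgt K y' = src K l" "\<rho> \<in> El (y' \<cdot> (l \<cdot> a))"
          obtain v where v: "v \<in> Mor K" "tgt K v = src K l'" "v \<cdot> l' = y'" "v \<cdot> t' = \<rho>"
            using pb_point[OF W' y'(1) _ y'(3)] y'(2) by auto
          have "v \<cdot> (l' \<cdot> l) = (v \<cdot> l') \<cdot> l" "v \<cdot> (l' \<cdot> s) = (v \<cdot> l') \<cdot> s" using v(1,2) ss by simp_all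
          then have "v \<cdot> (l' \<cdot> l) = y' \<cdot> l" "v \<cdot> (l' \<cdot> s) = y' \<cdot> s" using v(3) by simp_all
          moreover have "Q s v" using Qs v by blast
          ultimately show "\<rho> \<in> img y' n \<longleftrightarrow> member \<pi>\<^sub>1 \<pi>\<^sub>2 e (y' \<cdot> l) \<rho> (y' \<cdot> s)"
            using n_iff[OF v(1,2)] v(3,4) unfolding Q_def by simp
        qed
      qed
    qed
    have evz: "ev (v \<cdot> (l' \<cdot> l)) \<rho>\<^sub>1 (v \<cdot> z) = v \<cdot> t'" "ev (v \<cdot> (l' \<cdot> l)) \<rho>\<^sub>2 (v \<cdot> z) = v \<cdot> (l' \<cdot> t)"
      "v \<cdot> z \<in> El ((v \<cdot> (l' \<cdot> l)) \<cdot> w)" if v: "v \<in> Mor K" "tgt K v = src K l'" for v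
      using cells_ev_comp1[OF F(1) _ _ z(1), of v] cells_ev_comp1[OF F(2) _ _ z(1), of v]
        El_comp1'[OF z(1) v(1)] z v by simp_all
    have classifies_iff': "classifies \<pi>\<^sub>1 \<pi>\<^sub>2 e \<rho>\<^sub>1 \<rho>\<^sub>2 m w r \<longleftrightarrow> (\<forall>v\<in>Mor K. tgt K v = src K l' \<longrightarrow> Q (ev l r t) v)"
      if r: "r \<in> cells y P" for r
    proof -
      define s where "s = ev l r t"
      have s: "s \<in> El (l \<cdot> P)" unfolding s_def by (rule cells_El[OF r]) (use pb_simps(8)[OF Y] in simp_all)
      have ss: "s \<in> Mor K" "src K s = src K l" using s src_El[OF s] by simp_all
      have evr: "ev (y' \<cdot> l) r (y' \<cdot> t) = y' \<cdot> s" if "y' \<in> Mor K" "tgt K y' = src K l" for y'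
        unfolding s_def by (rule cells_ev_comp1[OF r]) (use pb_simps(8)[OF Y] that in simp_all)
      have evr': "ev (v \<cdot> (l' \<cdot> l)) r (v \<cdot> (l' \<cdot> t)) = v \<cdot> (l' \<cdot> s)" if "v \<in> Mor K" "tgt K v = src K l'" for v
        using evr[of "v \<cdot> l'"] that ss by simp
      show ?thesis
        unfolding s_def[symmetric]
      proof
        assume C: "classifies \<pi>\<^sub>1 \<pi>\<^sub>2 e \<rho>\<^sub>1 \<rho>\<^sub>2 m w r"
        show "\<forall>v\<in>Mor K. tgt K v = src K l' \<longrightarrow> Q s v"
        proof (intro ballI impI)
          fix v assume v: "v \<in> Mor K" "tgt K v = src K l'"
          have "v \<cdot> (l' \<cdot> l) \<in> Mor K" "tgt K (v \<cdot> (l' \<cdot> l)) = src K w" using v by simp_all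
          then have "v \<cdot> z \<in> img (v \<cdot> (l' \<cdot> l)) m \<longleftrightarrow> member \<pi>\<^sub>1 \<pi>\<^sub>2 e (v \<cdot> (l' \<cdot> l))
              (ev (v \<cdot> (l' \<cdot> l)) \<rho>\<^sub>1 (v \<cdot> z)) (ev (v \<cdot> (l' \<cdot> l)) r (ev (v \<cdot> (l' \<cdot> l)) \<rho>\<^sub>2 (v \<cdot> z)))"
            using C evz(3)[OF v] unfolding classifies_def by blast
          then show "Q s v" unfolding Q_def evz(1,2)[OF v] evr'[OF v] .
        qed
      next
        assume Qs: "\<forall>v\<in>Mor K. tgt K v = src K l' \<longrightarrow> Q s v"
        show "classifies \<pi>\<^sub>1 \<pi>\<^sub>2 e \<rho>\<^sub>1 \<rho>\<^sub>2 m w r" unfolding classifies_def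
        proof (intro ballI impI)
          fix x z' assume x: "x \<in> Mor K" "tgt K x = src K w" "z' \<in> El (x \<cdot> w)"
          have xA: "tgt K x = A" using x by simp
          obtain y' where y': "y' \<in> Mor K" "tgt K y' = src K l" "y' \<cdot> l = x" "y' \<cdot> t = ev x \<rho>\<^sub>2 z'"
            using pb_point[OF Y x(1) _ cells_El[OF F(2) x]] xA by auto
          have "y' \<cdot> (l \<cdot> a) = (y' \<cdot> l) \<cdot> a" using y'(1,2) by simp
          then have "ev x \<rho>\<^sub>1 z' \<in> El (y' \<cdot> (l \<cdot> a))" using cells_El[OF F(1) x] y'(3) by simp
          then obtain v where v: "v \<in> Mor K" "tgt K v = src K l'" "v \<cdot> l' = y'" "v \<cdot> t' = ev x \<rho>\<^sub>1 z'"
            using pb_point[OF W' y'(1)] y'(2) by auto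
          have vv: "v \<cdot> (l' \<cdot> l) = (v \<cdot> l') \<cdot> l" "v \<cdot> (l' \<cdot> t) = (v \<cdot> l') \<cdot> t" using v(1,2) by simp_all
          then have vx: "v \<cdot> (l' \<cdot> l) = x" "v \<cdot> (l' \<cdot> t) = ev x \<rho>\<^sub>2 z'" using v(3) y'(3,4) by simp_all
          have vz: "v \<cdot> z = z'"
            by (rule pointwise_product_eq[OF W x(1,2) _ x(3)])
              (use evz[OF v(1,2)] vx v(4) in simp_all)
          have "Q s v" using Qs v by blast
          then show "z' \<in> img x m \<longleftrightarrow> member \<pi>\<^sub>1 \<pi>\<^sub>2 e x (ev x \<rho>\<^sub>1 z') (ev x r (ev x \<rho>\<^sub>2 z'))"
            using evr'[OF v(1,2)] unfolding Q_def vx vz v(4) by simp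
        qed
      qed
    qed
    show "\<exists>!r. r \<in> cells y P \<and> classifies \<pi>\<^sub>1 \<pi>\<^sub>2 e \<rho>\<^sub>1 \<rho>\<^sub>2 m w r"
    proof -
      obtain s where s: "names a P \<pi>\<^sub>1 \<pi>\<^sub>2 e l n s" and su: "\<And>s'. names a P \<pi>\<^sub>1 \<pi>\<^sub>2 e l n s' \<Longrightarrow> s' = s"
        using ex1 by blast
      have sE: "s \<in> El (l \<cdot> P)" using s by (simp add: names_def)
      have ex1r: "\<exists>!r. r \<in> cells y P \<and> ev l r t = s" by (rule generic_iff[OF Y _ _ _ sE]) simp_all
      then obtain r where r: "r \<in> cells y P" "ev l r t = s" by blast
      show ?thesis
      proof (rule ex1I[of _ r])
        show "r \<in> cells y P \<and> classifies \<pi>\<^sub>1 \<pi>\<^sub>2 e \<rho>\<^sub>1 \<rho>\<^sub>2 m w r"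
          using classifies_iff'[OF r(1)] names_iff[OF sE] s r by simp
        fix r' assume r': "r' \<in> cells y P \<and> classifies \<pi>\<^sub>1 \<pi>\<^sub>2 e \<rho>\<^sub>1 \<rho>\<^sub>2 m w r'"
        have "ev l r' t \<in> El (l \<cdot> P)" by (rule cells_El[of r' y]) (use r' pb_simps(8)[OF Y] in simp_all)
        then have "ev l r' t = s" using su names_iff classifies_iff' r' by blast
        then show "r' = r" using ex1r r r' by blast
      qed
    qed
  qed
qed

text \<open>A name over \<open>b\<close> for the restricted data is a name over
  \<open>b \<cdot> f\<close> for the original data, and the groupoid condition concerns the same
  source in both cases.\<close>

lemma pointwise_power_object_base_change:
  assumes PP: "pointwise_power_object a P q \<pi>\<^sub>1 \<pi>\<^sub>2 e" and f: "f \<in> Mor K" "tgt K f = src K q"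
  shows "pointwise_power_object (f \<cdot> a) (f \<cdot> P) (f \<cdot> q) (f \<rhd> \<pi>\<^sub>1) (f \<rhd> \<pi>\<^sub>2) (f \<rhd> e)"
proof -
  have Q: "pointwise_product a P q \<pi>\<^sub>1 \<pi>\<^sub>2" and e: "pointwise_mono e" "e \<in> cells (dom2 K e) q"
    using PP by (auto simp: pointwise_power_object_def pointwise_mono_def cells_def)
  note D = pointwise_productD[OF Q] and E = pointwise_monoD[OF e]
  have f': "f \<in> Mor K" "tgt K f = src K a" "tgt K f = src K P" "tgt K f = src K q" "tgt K f = src K (dom2 K e)"
    using f D E by simp_all
  have [simp]: "f \<in> Mor K" "a \<in> Mor K" "P \<in> Mor K" "q \<in> Mor K" "src K a = tgt K f" "src K P = tgt K f" "src K q = tgt K f"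
    "src K (dom2 K e) = tgt K f"
    using D f' by simp_all
  have ev\<pi>: "ev x (f \<rhd> \<pi>\<^sub>1) s = ev (x \<cdot> f) \<pi>\<^sub>1 s" "ev x (f \<rhd> \<pi>\<^sub>2) s = ev (x \<cdot> f) \<pi>\<^sub>2 s" "img x (f \<rhd> e) = img (x \<cdot> f) e"
    if "x \<in> Mor K" "tgt K x = src K f" for x s
    using cells_ev_lwhisker[OF D(1) f(1) that f'(4)] cells_ev_lwhisker[OF D(2) f(1) that f'(4)]
      img_lwhisker[OF e(2) f(1) that f'(5)] by simp_all
  have mem: "member (f \<rhd> \<pi>\<^sub>1) (f \<rhd> \<pi>\<^sub>2) (f \<rhd> e) x u v = member \<pi>\<^sub>1 \<pi>\<^sub>2 e (x \<cdot> f) u v"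
    if "x \<in> Mor K" "tgt K x = src K f" for x u v
    unfolding member_def ev\<pi>(3)[OF that] using ev\<pi>(1,2)[OF that] by simp
  have "pointwise_product (f \<cdot> a) (f \<cdot> P) (f \<cdot> q) (f \<rhd> \<pi>\<^sub>1) (f \<rhd> \<pi>\<^sub>2)"
    unfolding pointwise_product_def
  proof (intro conjI ballI impI)
    show "f \<rhd> \<pi>\<^sub>1 \<in> cells (f \<cdot> q) (f \<cdot> a)" "f \<rhd> \<pi>\<^sub>2 \<in> cells (f \<cdot> q) (f \<cdot> P)"
      by (rule cells_lwhisker[OF D(1)] cells_lwhisker[OF D(2)]; simp)+
    show "tgt K (f \<cdot> q) = S" using D(4) by simp
    fix x s s' assume x: "x \<in> Mor K" "tgt K x = src K (f \<cdot> q)" "s \<in> El (x \<cdot> (f \<cdot> a))" "s' \<in> El (x \<cdot> (f \<cdot> P))"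
    then have xf: "tgt K x = src K f" by simp
    have "x \<cdot> f \<in> Mor K" "tgt K (x \<cdot> f) = src K q" "s \<in> El ((x \<cdot> f) \<cdot> a)" "s' \<in> El ((x \<cdot> f) \<cdot> P)"
      using x xf by simp_all
    then have "\<exists>!r. r \<in> El ((x \<cdot> f) \<cdot> q) \<and> ev (x \<cdot> f) \<pi>\<^sub>1 r = s \<and> ev (x \<cdot> f) \<pi>\<^sub>2 r = s'"
      using Q unfolding pointwise_product_def by blast
    then show "\<exists>!r. r \<in> El (x \<cdot> (f \<cdot> q)) \<and> ev x (f \<rhd> \<pi>\<^sub>1) r = s \<and> ev x (f \<rhd> \<pi>\<^sub>2) r = s'"
      using x(1) xf ev\<pi>(1,2)[OF x(1) xf] by simp
  qed
  moreover have "pointwise_mono (f \<rhd> e)" by (rule pointwise_mono_lwhisker[OF e f'(1,5)])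
  moreover have "cod2 K (f \<rhd> e) = f \<cdot> q" using E by simp
  moreover have "\<exists>!s. names (f \<cdot> a) (f \<cdot> P) (f \<rhd> \<pi>\<^sub>1) (f \<rhd> \<pi>\<^sub>2) (f \<rhd> e) b m s"
    if b: "b \<in> Mor K" "tgt K b = src K (f \<cdot> a)" "groupoid_object K (src K b)"
      and m: "pointwise_mono m" "cod2 K m = b \<cdot> (f \<cdot> a)" for b m
  proof -
    have bf: "tgt K b = src K f" using b by simp
    have "names (f \<cdot> a) (f \<cdot> P) (f \<rhd> \<pi>\<^sub>1) (f \<rhd> \<pi>\<^sub>2) (f \<rhd> e) b m s \<longleftrightarrow> names a P \<pi>\<^sub>1 \<pi>\<^sub>2 e (b \<cdot> f) m s" for s
      using b(1) bf mem by (simp add: names_def)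
    moreover have "\<exists>!s. names a P \<pi>\<^sub>1 \<pi>\<^sub>2 e (b \<cdot> f) m s"
    proof -
      have "b \<cdot> f \<in> Mor K" "tgt K (b \<cdot> f) = src K a" "groupoid_object K (src K (b \<cdot> f))" "cod2 K m = (b \<cdot> f) \<cdot> a"
        using b bf m by simp_all
      then show ?thesis using PP m(1) unfolding pointwise_power_object_def by blast
    qed
    ultimately show ?thesis by simp
  qed
  ultimately show ?thesis unfolding pointwise_power_object_def by blast
qed

text \<open>Transport along the isomorphism \<open>P \<cong> P0\<close> between two power objects of \<open>a\<close>.\<close>

lemma is_power_object_pointwise:
  assumes PO: "is_power_object (Hom K A S) a P q \<pi>\<^sub>1 \<pi>\<^sub>2 e" and A: "groupoid_object K A"
    and PP0: "pointwise_power_object a P0 q0 \<pi>1 \<pi>2 e0"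
  shows "pointwise_power_object a P q \<pi>\<^sub>1 \<pi>\<^sub>2 e"
proof -
  have Q: "pointwise_product a P q \<pi>\<^sub>1 \<pi>\<^sub>2" and e: "pointwise_mono e" "cod2 K e = q" and qA: "src K q = A"
    using PO is_product_pointwise is_mono_pointwise by (auto simp: is_power_object_def is_product_def hom1_iff)
  then have ec: "e \<in> cells (dom2 K e) q" by (simp add: pointwise_mono_def cells_def)
  have Q0: "pointwise_product a P0 q0 \<pi>1 \<pi>2" and e0: "pointwise_mono e0" "cod2 K e0 = q0" "e0 \<in> cells (dom2 K e0) q0"
    using PP0 by (auto simp: pointwise_power_object_def pointwise_mono_def cells_def)
  note D = pointwise_productD[OF Q] and D0 = pointwise_productD[OF Q0]
  have q0A: "src K q0 = A" using D D0 qA by simp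
  have [simp]: "src K a = A" "src K P = A" "src K P0 = A" using D D0 qA q0A by simp_all
  note pow = is_power_object_iff[OF Q e(1) ec qA, THEN iffD1, OF PO, rule_format]
  note pow0 = is_power_object_iff[OF Q0 e0(1,3) q0A, THEN iffD1,
      OF pointwise_power_object_is_power_object[OF PP0 A q0A], rule_format]
  obtain r where r: "r \<in> cells P P0" "classifies \<pi>1 \<pi>2 e0 \<pi>\<^sub>1 \<pi>\<^sub>2 e q r" using pow0[of P q \<pi>\<^sub>1 \<pi>\<^sub>2 e] Q e by blast
  obtain r0 where r0: "r0 \<in> cells P0 P" "classifies \<pi>\<^sub>1 \<pi>\<^sub>2 e \<pi>1 \<pi>2 e0 q0 r0" using pow[of P0 q0 \<pi>1 \<pi>2 e0] Q0 e0 by blast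
  have mem: "member \<pi>\<^sub>1 \<pi>\<^sub>2 e x u v \<longleftrightarrow> member \<pi>1 \<pi>2 e0 x u (ev x r v)"
    if x: "x \<in> Mor K" "tgt K x = A" "u \<in> El (x \<cdot> a)" "v \<in> El (x \<cdot> P)" for x u v
  proof -
    have xq: "tgt K x = src K q" using x qA by simp
    obtain z where z: "z \<in> El (x \<cdot> q)" "ev x \<pi>\<^sub>1 z = u" "ev x \<pi>\<^sub>2 z = v" by (rule pointwise_product_pair[OF Q x(1) xq x(3,4)])
    have "z \<in> img x e \<longleftrightarrow> member \<pi>1 \<pi>2 e0 x u (ev x r v)"
      using r(2) x(1) xq z unfolding classifies_def by blast
    then show ?thesis using member_iff[OF Q ec x(1) xq z(1)] z by simp
  qed
  have mem0: "member \<pi>1 \<pi>2 e0 x u v \<longleftrightarrow> member \<pi>\<^sub>1 \<pi>\<^sub>2 e x u (ev x r0 v)"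
    if x: "x \<in> Mor K" "tgt K x = A" "u \<in> El (x \<cdot> a)" "v \<in> El (x \<cdot> P0)" for x u v
  proof -
    have xq: "tgt K x = src K q0" using x q0A by simp
    obtain z where z: "z \<in> El (x \<cdot> q0)" "ev x \<pi>1 z = u" "ev x \<pi>2 z = v" by (rule pointwise_product_pair[OF Q0 x(1) xq x(3,4)])
    have "z \<in> img x e0 \<longleftrightarrow> member \<pi>\<^sub>1 \<pi>\<^sub>2 e x u (ev x r0 v)"
      using r0(2) x(1) xq z unfolding classifies_def by blast
    then show ?thesis using member_iff[OF Q0 e0(3) x(1) xq z(1)] z by simp
  qed
  have rE: "ev x r v \<in> El (x \<cdot> P0)" if "x \<in> Mor K" "tgt K x = A" "v \<in> El (x \<cdot> P)" for x v
    by (rule cells_El[OF r(1)]) (use that in simp_all)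
  have r0E: "ev x r0 v \<in> El (x \<cdot> P)" if "x \<in> Mor K" "tgt K x = A" "v \<in> El (x \<cdot> P0)" for x v
    by (rule cells_El[OF r0(1)]) (use that in simp_all)
  \<comment> \<open>Both sides classify \<open>e\<close> itself. The retraction is enough to
    transport names: existence goes through \<open>r0\<close> and uniqueness through
    \<open>r\<close>.\<close>
  have "r \<odot> r0 = id2 K P"
  proof -
    have "classifies \<pi>\<^sub>1 \<pi>\<^sub>2 e \<pi>\<^sub>1 \<pi>\<^sub>2 e q (r \<odot> r0)" "classifies \<pi>\<^sub>1 \<pi>\<^sub>2 e \<pi>\<^sub>1 \<pi>\<^sub>2 e q (id2 K P)"
      unfolding classifies_def
    proof (safe del: iffI)
      fix x z assume x: "x \<in> Mor K" "tgt K x = src K q" "z \<in> El (x \<cdot> q)"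
      have xA: "tgt K x = A" using x qA by simp
      have z: "ev x \<pi>\<^sub>1 z \<in> El (x \<cdot> a)" "ev x \<pi>\<^sub>2 z \<in> El (x \<cdot> P)" using cells_El[OF D(1) x] cells_El[OF D(2) x] .
      have xP: "tgt K x = src K P" using xA by simp
      show "z \<in> img x e \<longleftrightarrow> member \<pi>\<^sub>1 \<pi>\<^sub>2 e x (ev x \<pi>\<^sub>1 z) (ev x (r \<odot> r0) (ev x \<pi>\<^sub>2 z))"
        using member_iff[OF Q ec x] mem[OF x(1) xA z] mem0[OF x(1) xA z(1) rE[OF x(1) xA z(2)]]
          cells_ev_vcomp[OF r(1) r0(1) x(1) xP z(2)] by simp
      show "z \<in> img x e \<longleftrightarrow> member \<pi>\<^sub>1 \<pi>\<^sub>2 e x (ev x \<pi>\<^sub>1 z) (ev x (id2 K P) (ev x \<pi>\<^sub>2 z))"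
        using member_iff[OF Q ec x] ev_id2[OF D(6) x(1) xP z(2)] by simp
    qed
    then show ?thesis using pow[of P q \<pi>\<^sub>1 \<pi>\<^sub>2 e] Q e cells_vcomp[OF r(1) r0(1)] cells_id2[OF D(6)] by blast
  qed
  then have rr0: "ev x r0 (ev x r v) = v" if "x \<in> Mor K" "tgt K x = A" "v \<in> El (x \<cdot> P)" for x v
    using cells_ev_vcomp[OF r(1) r0(1) that(1) _ that(3)] ev_id2[OF D(6) that(1) _ that(3)] that by simp
  have "\<exists>!s. names a P \<pi>\<^sub>1 \<pi>\<^sub>2 e b m s"
    if b: "b \<in> Mor K" "tgt K b = src K a" "groupoid_object K (src K b)" and m: "pointwise_mono m" "cod2 K m = b \<cdot> a" for b m
  proof -
    have bA: "tgt K b = A" "tgt K b = src K P" "tgt K b = src K P0" using b by simp_all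
    have names: "names a P \<pi>\<^sub>1 \<pi>\<^sub>2 e b m (ev b r0 s)" if N: "names a P0 \<pi>1 \<pi>2 e0 b m s" for s
      unfolding names_def
    proof (intro conjI ballI impI)
      have s: "s \<in> El (b \<cdot> P0)" using N by (simp add: names_def)
      show "ev b r0 s \<in> El (b \<cdot> P)" by (rule r0E[OF b(1) bA(1) s])
      fix y \<rho> assume y: "y \<in> Mor K" "tgt K y = src K b" "\<rho> \<in> El (y \<cdot> (b \<cdot> a))"
      have yb: "y \<cdot> b \<in> Mor K" "tgt K (y \<cdot> b) = A" "\<rho> \<in> El ((y \<cdot> b) \<cdot> a)" "y \<cdot> s \<in> El ((y \<cdot> b) \<cdot> P0)"
        using y b(1) bA D D0 El_comp1'[OF s y(1) b(1) D0(6) bA(3) y(2)] by simp_all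
      have "\<rho> \<in> img y m \<longleftrightarrow> member \<pi>1 \<pi>2 e0 (y \<cdot> b) \<rho> (y \<cdot> s)" using N y unfolding names_def by blast
      then show "\<rho> \<in> img y m \<longleftrightarrow> member \<pi>\<^sub>1 \<pi>\<^sub>2 e (y \<cdot> b) \<rho> (y \<cdot> ev b r0 s)"
        using mem0[OF yb] cells_ev_comp1[OF r0(1) b(1) bA(3) s y(1,2)] by simp
    qed
    have names0: "names a P0 \<pi>1 \<pi>2 e0 b m (ev b r s)" if N: "names a P \<pi>\<^sub>1 \<pi>\<^sub>2 e b m s" for s
      unfolding names_def
    proof (intro conjI ballI impI)
      have s: "s \<in> El (b \<cdot> P)" using N by (simp add: names_def)
      show "ev b r s \<in> El (b \<cdot> P0)" by (rule rE[OF b(1) bA(1) s])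
      fix y \<rho> assume y: "y \<in> Mor K" "tgt K y = src K b" "\<rho> \<in> El (y \<cdot> (b \<cdot> a))"
      have yb: "y \<cdot> b \<in> Mor K" "tgt K (y \<cdot> b) = A" "\<rho> \<in> El ((y \<cdot> b) \<cdot> a)" "y \<cdot> s \<in> El ((y \<cdot> b) \<cdot> P)"
        using y b(1) bA D El_comp1'[OF s y(1) b(1) D(6) bA(2) y(2)] by simp_all
      have "\<rho> \<in> img y m \<longleftrightarrow> member \<pi>\<^sub>1 \<pi>\<^sub>2 e (y \<cdot> b) \<rho> (y \<cdot> s)" using N y unfolding names_def by blast
      then show "\<rho> \<in> img y m \<longleftrightarrow> member \<pi>1 \<pi>2 e0 (y \<cdot> b) \<rho> (y \<cdot> ev b r s)"
        using mem[OF yb] cells_ev_comp1[OF r(1) b(1) bA(2) s y(1,2)] by simp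
    qed
    have "\<exists>!s. names a P0 \<pi>1 \<pi>2 e0 b m s" using PP0 b m unfolding pointwise_power_object_def by blast
    then obtain s0 where s0: "names a P0 \<pi>1 \<pi>2 e0 b m s0" "\<And>s. names a P0 \<pi>1 \<pi>2 e0 b m s \<Longrightarrow> s = s0" by blast
    show ?thesis
    proof (rule ex1I[of _ "ev b r0 s0"])
      show "names a P \<pi>\<^sub>1 \<pi>\<^sub>2 e b m (ev b r0 s0)" by (rule names[OF s0(1)])
      fix s assume s: "names a P \<pi>\<^sub>1 \<pi>\<^sub>2 e b m s"
      then have "ev b r s = s0" using s0(2) names0 by blast
      moreover have "s \<in> El (b \<cdot> P)" using s by (simp add: names_def)
      ultimately show "s = ev b r0 s0" using rr0[OF b(1) bA(1)] by metis
    qed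
  qed
  then show ?thesis using Q e unfolding pointwise_power_object_def by blast
qed

end

section \<open>Existence of power objects and the topos structure\<close>

context plentiful_DOF_classifier
begin

text \<open>Membership \<open>e\<close> consists of the pairs whose first component lies in the
  subobject named by the second. The name is a point of the pullback \<open>l\<close>, so the
  condition is membership in \<mu> restricted along that point, and comprehension makes it a
  subobject of the product.\<close>

lemma pointwise_power_object_exists:
  assumes A: "groupoid_object K A" and a: "a \<in> hom1 K A S"
  obtains P q \<pi>\<^sub>1 \<pi>\<^sub>2 e where "pointwise_power_object a P q \<pi>\<^sub>1 \<pi>\<^sub>2 e"
proof -
  have a' [simp]: "a \<in> Mor K" "src K a = A" "tgt K a = S" using a by (simp_all add: hom1_iff)
  obtain P l t \<mu> n where P: "P \<in> hom1 K A S" and pb: "pb_along K p P l t" and \<mu>: "\<mu> \<in> cells n (l \<cdot> a)"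
    and \<mu>s: "stable_mono K (src K l) S \<mu>"
    and univ: "\<And>B b m x. \<lbrakk>groupoid_object K B; b \<in> hom1 K B A; stable_mono K B S m; m \<in> cells x (b \<cdot> a)\<rbrakk> \<Longrightarrow>
      \<exists>!v. v \<in> Mor K \<and> tgt K v = src K l \<and> v \<cdot> l = b \<and>
        (\<exists>\<sigma> \<sigma>'. \<sigma> \<in> cells (v \<cdot> n) x \<and> invertible2 \<sigma> \<sigma>' \<and> v \<rhd> \<mu> = \<sigma> \<odot> m)"
    using universal_mono[OF A a] by blast
  have P' [simp]: "P \<in> Mor K" "src K P = A" "tgt K P = S" using P by (simp_all add: hom1_iff)
  have \<mu>p: "pointwise_mono \<mu>" by (rule stable_mono_pointwise[OF \<mu>s])
  note L [simp] = pb_simps(3-7)[OF pb]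
  note n = pointwise_monoD[OF \<mu>p \<mu>]
  obtain q \<pi>\<^sub>1 \<pi>\<^sub>2 where Q: "pointwise_product a P q \<pi>\<^sub>1 \<pi>\<^sub>2"
    using pointwise_product_exists[OF a'(1,3) P'(1) _ P'(3)] by auto
  note D = pointwise_productD[OF Q]
  have q [simp]: "q \<in> Mor K" "src K q = A" "tgt K q = S" using D by simp_all
  obtain l' u where pq: "pb_along K p q l' u" using pb_exists[of q] by auto
  note L' = pb_simps[OF pq]
  have l' [simp]: "l' \<in> Mor K" "tgt K l' = A" "u \<in> Mor K" "src K u = src K l'" using L' by simp_all
  have u: "u \<in> El (l' \<cdot> q)" by (rule L'(8))
  define z where "z = ev l' \<pi>\<^sub>1 u"
  have z: "z \<in> El (l' \<cdot> a)" unfolding z_def by (rule cells_El[OF D(1) _ _ u]) simp_all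
  have u2: "ev l' \<pi>\<^sub>2 u \<in> El (l' \<cdot> P)" by (rule cells_El[OF D(2) _ _ u]) simp_all
  obtain b where b: "b \<in> Mor K" "tgt K b = src K l" "src K b = src K l'" "b \<cdot> l = l'" "b \<cdot> t = ev l' \<pi>\<^sub>2 u"
    using pb_point[OF pb _ _ u2] by auto
  have zb: "z \<in> El (b \<cdot> (l \<cdot> a))"
  proof -
    have "b \<cdot> (l \<cdot> a) = (b \<cdot> l) \<cdot> a" using b(1,2) by simp
    then show ?thesis using z b(4) by simp
  qed
  have tb: "tgt K b = src K (l \<cdot> a)" using b by simp
  obtain e x where e: "pointwise_mono e" "e \<in> cells x q"
    and e_iff: "\<And>v. \<lbrakk>v \<in> Mor K; tgt K v = src K l'\<rbrakk> \<Longrightarrow> v \<cdot> u \<in> img (v \<cdot> l') e \<longleftrightarrow> v \<cdot> z \<in> img (v \<cdot> b) \<mu>"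
    using comprehension[OF pq \<mu>p \<mu> b(1,3) tb zb] by blast
  \<comment> \<open>A pair with second component \<open>w \<cdot> t\<close> comes from a map
    \<open>v\<close> into the stage of the universal pair, and \<open>v \<cdot> b = w\<close>
    because a point of the pullback is determined by its two components.\<close>
  have key: "member \<pi>\<^sub>1 \<pi>\<^sub>2 e (w \<cdot> l) \<rho> (w \<cdot> t) \<longleftrightarrow> \<rho> \<in> img w \<mu>"
    if w: "w \<in> Mor K" "tgt K w = src K l" and \<rho>: "\<rho> \<in> El (w \<cdot> (l \<cdot> a))" for w \<rho>
  proof -
    have wl: "w \<cdot> l \<in> Mor K" "tgt K (w \<cdot> l) = A" "\<rho> \<in> El ((w \<cdot> l) \<cdot> a)" using w \<rho> by simp_all
    have wlq: "tgt K (w \<cdot> l) = src K q" using wl by simp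
    obtain r where r: "r \<in> El ((w \<cdot> l) \<cdot> q)" "ev (w \<cdot> l) \<pi>\<^sub>1 r = \<rho>" "ev (w \<cdot> l) \<pi>\<^sub>2 r = w \<cdot> t"
      by (rule pointwise_product_pair[OF Q wl(1) wlq wl(3) pb_El[OF pb w]])
    obtain v where v: "v \<in> Mor K" "tgt K v = src K l'" "v \<cdot> l' = w \<cdot> l" "v \<cdot> u = r"
      by (rule pb_point[OF pq wl(1) wlq r(1)])
    have vz: "v \<cdot> z = \<rho>" "v \<cdot> ev l' \<pi>\<^sub>2 u = w \<cdot> t"
      using cells_ev_comp1[OF D(1) _ _ u v(1,2)] cells_ev_comp1[OF D(2) _ _ u v(1,2)] v(3,4) r(2,3) by (simp_all add: z_def)
    have "(v \<cdot> b) \<cdot> l = w \<cdot> l" "(v \<cdot> b) \<cdot> t = w \<cdot> t" using v(1-3) b vz(2) by simp_all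
    then have "v \<cdot> b = w" using pb_point_eq[OF pb, of "v \<cdot> b" w] v(1,2) b(1-3) w by simp
    then show ?thesis
      using e_iff[OF v(1,2)] member_iff[OF Q e(2) wl(1) wlq r(1)] v(3,4) vz(1) r(2,3) by simp
  qed
  have "\<exists>!s. names a P \<pi>\<^sub>1 \<pi>\<^sub>2 e b m s"
    if b: "b \<in> Mor K" "tgt K b = src K a" "groupoid_object K (src K b)" and m: "pointwise_mono m" "cod2 K m = b \<cdot> a" for b m
  proof -
    have bA: "tgt K b = A" "b \<in> hom1 K (src K b) A" using b by (simp_all add: hom1_iff)
    have mc: "m \<in> cells (dom2 K m) (b \<cdot> a)" using m by (simp add: pointwise_mono_def cells_def)
    have sba: "src K (b \<cdot> a) = src K b" using b by simp
    have ms: "stable_mono K (src K b) S m" using pointwise_mono_stable[OF m(1) mc] sba by simp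
    \<comment> \<open>The universal property of \<mu> is stated up to isomorphism of monomorphisms
      into \<open>b \<cdot> a\<close>; equality of images converts it into the elementwise condition
      \<open>names\<close>.\<close>
    have iff: "(\<exists>\<sigma> \<sigma>'. \<sigma> \<in> cells (v \<cdot> n) (dom2 K m) \<and> invertible2 \<sigma> \<sigma>' \<and> v \<rhd> \<mu> = \<sigma> \<odot> m) \<longleftrightarrow>
        names a P \<pi>\<^sub>1 \<pi>\<^sub>2 e b m (v \<cdot> t)" if v: "v \<in> Mor K" "tgt K v = src K l" "v \<cdot> l = b" for v
    proof -
      have vn: "tgt K v = src K n" using v n by simp
      have sv: "src K v = src K b" using v(1,2) unfolding v(3)[symmetric] by simp
      have va: "v \<cdot> (l \<cdot> a) = b \<cdot> a" using v(1,2) unfolding v(3)[symmetric] by simp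
      have v\<mu>: "pointwise_mono (v \<rhd> \<mu>)" "v \<rhd> \<mu> \<in> cells (v \<cdot> n) (b \<cdot> a)"
        using pointwise_mono_lwhisker[OF \<mu>p \<mu> v(1) vn] cells_lwhisker[OF \<mu> v(1) vn] va by simp_all
      have img: "\<rho> \<in> img y (v \<rhd> \<mu>) \<longleftrightarrow> member \<pi>\<^sub>1 \<pi>\<^sub>2 e (y \<cdot> b) \<rho> (y \<cdot> (v \<cdot> t))"
        if y: "y \<in> Mor K" "tgt K y = src K b" "\<rho> \<in> El (y \<cdot> (b \<cdot> a))" for y \<rho>
      proof -
        have yv: "tgt K y = src K v" using y sv by simp
        have "(y \<cdot> v) \<cdot> (l \<cdot> a) = y \<cdot> (b \<cdot> a)" "(y \<cdot> v) \<cdot> l = y \<cdot> b" "(y \<cdot> v) \<cdot> t = y \<cdot> (v \<cdot> t)"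
          using y(1) yv v(1,2) unfolding v(3)[symmetric] by simp_all
        then show ?thesis
          using key[of "y \<cdot> v" \<rho>] img_lwhisker[OF \<mu> v(1) y(1) yv vn] y yv v(1,2) by simp
      qed
      have vt: "v \<cdot> t \<in> El (b \<cdot> P)" using pb_El[OF pb v(1,2)] v(3) by simp
      have sub: "img y k \<subseteq> El (y \<cdot> (b \<cdot> a))" if k: "k \<in> cells c (b \<cdot> a)" "y \<in> Mor K" "tgt K y = src K b" for y k c
      proof
        fix \<rho> assume "\<rho> \<in> img y k"
        then obtain s where s: "s \<in> El (y \<cdot> c)" "ev y k s = \<rho>" unfolding img_iff[OF k(1)] by blast
        have "tgt K y = src K c" using cells_Mor[OF k(1)] k(3) sba by simp
        then show "\<rho> \<in> El (y \<cdot> (b \<cdot> a))" using cells_El[OF k(1,2) _ s(1)] s(2) by simp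
      qed
      have "(\<forall>y\<in>Mor K. tgt K y = src K b \<longrightarrow> img y (v \<rhd> \<mu>) = img y m) \<longleftrightarrow> names a P \<pi>\<^sub>1 \<pi>\<^sub>2 e b m (v \<cdot> t)"
      proof
        assume eq: "\<forall>y\<in>Mor K. tgt K y = src K b \<longrightarrow> img y (v \<rhd> \<mu>) = img y m"
        show "names a P \<pi>\<^sub>1 \<pi>\<^sub>2 e b m (v \<cdot> t)"
          unfolding names_def using vt eq img by blast
      next
        assume N: "names a P \<pi>\<^sub>1 \<pi>\<^sub>2 e b m (v \<cdot> t)"
        show "\<forall>y\<in>Mor K. tgt K y = src K b \<longrightarrow> img y (v \<rhd> \<mu>) = img y m"
        proof (intro ballI impI)
          fix y assume y: "y \<in> Mor K" "tgt K y = src K b"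
          have "\<rho> \<in> img y (v \<rhd> \<mu>) \<longleftrightarrow> \<rho> \<in> img y m" if "\<rho> \<in> El (y \<cdot> (b \<cdot> a))" for \<rho>
            using N img[OF y that] y that unfolding names_def by blast
          then show "img y (v \<rhd> \<mu>) = img y m" using sub[OF v\<mu>(2) y] sub[OF mc y] by blast
        qed
      qed
      then show ?thesis using isomorphic_iff_same_img[OF m(1) mc v\<mu>] sba by simp
    qed
    have ex1: "\<exists>!v. v \<in> Mor K \<and> tgt K v = src K l \<and> v \<cdot> l = b \<and>
        (\<exists>\<sigma> \<sigma>'. \<sigma> \<in> cells (v \<cdot> n) (dom2 K m) \<and> invertible2 \<sigma> \<sigma>' \<and> v \<rhd> \<mu> = \<sigma> \<odot> m)"
      by (rule univ[OF b(3) bA(2) ms mc])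
    then obtain v where v: "v \<in> Mor K" "tgt K v = src K l" "v \<cdot> l = b" "names a P \<pi>\<^sub>1 \<pi>\<^sub>2 e b m (v \<cdot> t)"
      using iff by blast
    show ?thesis
    proof (rule ex1I[of _ "v \<cdot> t"])
      show "names a P \<pi>\<^sub>1 \<pi>\<^sub>2 e b m (v \<cdot> t)" by (rule v)
      fix s assume s: "names a P \<pi>\<^sub>1 \<pi>\<^sub>2 e b m s"
      then have sE: "s \<in> El (b \<cdot> P)" by (simp add: names_def)
      have bP: "tgt K b = src K P" using bA by simp
      obtain v' where v': "v' \<in> Mor K" "tgt K v' = src K l" "v' \<cdot> l = b" "v' \<cdot> t = s"
        by (rule pb_point[OF pb b(1) bP sE])
      then have "v' = v" using ex1 v iff s by blast
      then show "s = v \<cdot> t" using v' by simp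
    qed
  qed
  moreover have "cod2 K e = q" using e by (simp add: cells_def)
  ultimately have "pointwise_power_object a P q \<pi>\<^sub>1 \<pi>\<^sub>2 e"
    unfolding pointwise_power_object_def using Q e(1) by blast
  then show thesis by (rule that)
qed

lemma elementary_topos: "internal_elementary_topos K S"
proof -
  have S: "S \<in> Obj K" using tgt_Obj[OF p_Mor] by simp
  have pow: "\<exists>P q \<pi>\<^sub>1 \<pi>\<^sub>2 e. is_power_object (Hom K A S) a P q \<pi>\<^sub>1 \<pi>\<^sub>2 e"
    if A: "groupoid_object K A" and a: "a \<in> hom1 K A S" for A a
  proof -
    obtain P q \<pi>\<^sub>1 \<pi>\<^sub>2 e where PP: "pointwise_power_object a P q \<pi>\<^sub>1 \<pi>\<^sub>2 e"
      using pointwise_power_object_exists[OF A a] by blast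
    have "pointwise_product a P q \<pi>\<^sub>1 \<pi>\<^sub>2" using PP by (simp add: pointwise_power_object_def)
    then have "src K q = A" using pointwise_productD(7)[of a P q] a by (simp add: hom1_iff)
    then show ?thesis using pointwise_power_object_is_power_object[OF PP A] by blast
  qed
  have pres: "preserves_power_objects (Hom K A S) (Hom K A' S) (pre K f)"
    if A: "groupoid_object K A" "groupoid_object K A'" and f: "f \<in> hom1 K A' A" for A A' f
    unfolding preserves_power_objects_def
  proof (intro allI impI)
    fix a P q \<pi>\<^sub>1 \<pi>\<^sub>2 e assume PO: "is_power_object (Hom K A S) a P q \<pi>\<^sub>1 \<pi>\<^sub>2 e"
    have a: "a \<in> hom1 K A S" and q: "q \<in> hom1 K A S"
      using PO by (simp_all add: is_power_object_def is_product_def)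
    obtain P0 q0 \<pi>1 \<pi>2 e0 where PP0: "pointwise_power_object a P0 q0 \<pi>1 \<pi>2 e0"
      using pointwise_power_object_exists[OF A(1) a] by blast
    have f': "f \<in> Mor K" "tgt K f = src K q" "src K (f \<cdot> q) = A'" using f q by (simp_all add: hom1_iff)
    have "is_power_object (Hom K A' S) (f \<cdot> a) (f \<cdot> P) (f \<cdot> q) (f \<rhd> \<pi>\<^sub>1) (f \<rhd> \<pi>\<^sub>2) (f \<rhd> e)"
      by (rule pointwise_power_object_is_power_object[OF
            pointwise_power_object_base_change[OF is_power_object_pointwise[OF PO A(1) PP0] f'(1,2)] A(2) f'(3)])
    then show "is_power_object (Hom K A' S) (FO (pre K f) a) (FO (pre K f) P) (FO (pre K f) q)
        (FA (pre K f) \<pi>\<^sub>1) (FA (pre K f) \<pi>\<^sub>2) (FA (pre K f) e)"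
      by (simp add: pre_def)
  qed
  have O: "A \<in> Obj K" if "groupoid_object K A" for A using that by (simp add: groupoid_object_def)
  have fin: "preserves_finite_limits (Hom K A S) (Hom K A' S) (pre K f)"
    if "groupoid_object K A" "groupoid_object K A'" "f \<in> hom1 K A' A" for A A' f
    using finite_limits O that unfolding internal_finite_limits_def by blast
  show ?thesis
    unfolding internal_elementary_topos_def has_power_objects_def Hom_simps
    using finite_limits pow pres fin by blast
qed

end

theorem theorem5p4p6:
  fixes K :: "('o, 'm, 'c) two_cat" and p :: 'm and S\<^sub>p S :: 'o
  assumes "two_category K"
    and "corepita K"
    and "p \<in> hom1 K S\<^sub>p S"
    and "generic_DOF K p"
    and "plentiful K p"
  shows "internal_elementary_topos K S"
proof -
  have tp: "tgt K p = S" using assms(3) by (simp add: hom1_def)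
  \<comment> \<open>The witnesses of plentifulness become the parameters of the locale;
    \<open>f\<close> and \<open>t\<close> are the bottom and the top of the bipullback square that
    exhibits \<open>c\<close> as small.\<close>
  obtain M d Si i Mi j c f t \<theta> where "mono_object K S M d" "is_core K S Si i" "is_core K M Mi j"
    "induced_on_cores K (cod2 K d) j i c" "bipullback K f p c t \<theta>"
    using assms(5) unfolding plentiful_def small_SOF_def tp by blast
  moreover have "src K j = Mi" "src K i = Si"
    using calculation by (simp_all add: is_core_def hom1_def)
  ultimately have "plentiful_DOF_classifier K p S\<^sub>p S M d Si i Mi j c f t \<theta>"
    using assms unfolding plentiful_DOF_classifier_def plentiful_DOF_classifier_axioms_def
      DOF_classifier_def DOF_classifier_axioms_def corepita_def plentiful_def induced_on_cores_def
    by auto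
  then show ?thesis by (rule plentiful_DOF_classifier.elementary_topos)
qed

end
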